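(* Let $c\ge 0$ and $\theta\in[0,\infty)^2$, and let $X^{c,\theta}$ be the infinite rate mutually catalytic branching process with parameters $(c,\theta)$. Then $X^{c,\theta}$ is a Feller process and has the strong Markov property. It is ergodic and the unique invariant measure is $Q_\theta$.
   Context: Let $E:=[0,\infty)^2\setminus(0,\infty)^2$. For $x\in[0,\infty)^2$, let $B$ be a standard planar Brownian motion started at $x$, let $\tau=\inf\{t>0: B_t\notin(0,\infty)^2\}$, and let $Q_x$ be the law of $B_\tau$ (a probability measure on $E$; $Q_x=\delta_x$ if $x\in E$). For $c\ge0$, $\theta\in[0,\infty)^2$, $t\ge0$ and $x\in E$ let $p_t(x,\cdot):=Q_{e^{-ct}x+(1-e^{-ct})\theta}$. The infinite rate mutually catalytic branching process $X^{c,\theta}$ with parameters $(c,\theta)$ is the Markov process with state space $E$, càdlàg paths and transition kernels $(p_t)_{t\ge0}$. "Feller" means that $x\mapsto p_t(x,\cdot)$ is (weakly) continuous for every $t\ge0$. "Ergodic" is used in the usual sense of convergence in law, as $t\to\infty$, to the unique invariant probability measure from every initial state.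
   Formalization: Ergodicity and uniqueness of the invariant measure are claimed only for c > 0: for c = 0 the process is constant, so every probability measure on E is invariant and there is no common limit law. The Feller and strong Markov properties and invariance of Q_θ are proved for all c ≥ 0. *)

theory Defs
  imports "HOL-Probability.Probability"
begin

section \<open>Exit distribution of planar Brownian motion from the quadrant\<close>

definition quadrant :: "(real \<times> real) set" where
  "quadrant = {0..} \<times> {0..}"

definition open_quadrant :: "(real \<times> real) set" where
  "open_quadrant = {0<..} \<times> {0<..}"

definition axes :: "(real \<times> real) set" where
  "axes = quadrant - open_quadrant"

text \<open>Throughout, time is \<^typ>\<open>real\<close> and only the times \<open>t \<ge> 0\<close> matter.\<close>

definition planar_brownian_motion ::
  "'a measure \<Rightarrow> (real \<Rightarrow> 'a \<Rightarrow> real \<times> real) \<Rightarrow> real \<times> real \<Rightarrow> bool" where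
  "planar_brownian_motion M W x \<longleftrightarrow>
     prob_space M \<and>
     (\<forall>t\<ge>0. W t \<in> borel_measurable M) \<and>
     (\<forall>\<omega>\<in>space M. W 0 \<omega> = x) \<and>
     (\<forall>\<omega>\<in>space M. continuous_on {0..} (\<lambda>t. W t \<omega>)) \<and>
     (\<forall>s t. 0 \<le> s \<longrightarrow> s < t \<longrightarrow>
        distributed M lborel (\<lambda>\<omega>. W t \<omega> - W s \<omega>)
          (\<lambda>(a, b). ennreal (normal_density 0 (sqrt (t - s)) a * normal_density 0 (sqrt (t - s)) b))) \<and>
     (\<forall>(n::nat) t. 0 \<le> t 0 \<longrightarrow> (\<forall>i<n. t i < t (Suc i)) \<longrightarrow>
        prob_space.indep_vars M (\<lambda>_. borel) (\<lambda>i \<omega>. W (t (Suc i)) \<omega> - W (t i) \<omega>) {..<n})"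

text \<open>The infimum is taken in \<^typ>\<open>ennreal\<close>, so that \<open>inf {} = \<infinity>\<close>.\<close>

definition exit_time :: "(real \<Rightarrow> 'a \<Rightarrow> real \<times> real) \<Rightarrow> 'a \<Rightarrow> ennreal" where
  "exit_time W \<omega> = (INF t\<in>{t. 0 < t \<and> W t \<omega> \<notin> open_quadrant}. ennreal t)"

text \<open>On the null event that the exit time is infinite, \<open>enn2real \<infinity> = 0\<close> selects the starting point.
  The law is a Borel measure on the plane that is concentrated on \<^const>\<open>axes\<close>.\<close>

definition exit_law :: "'a measure \<Rightarrow> (real \<Rightarrow> 'a \<Rightarrow> real \<times> real) \<Rightarrow> (real \<times> real) measure" where
  "exit_law M W = distr M borel (\<lambda>\<omega>. W (enn2real (exit_time W \<omega>)) \<omega>)"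

section \<open>Markov processes\<close>

text \<open>A Markov process on the state space \<open>S\<close> with transition kernels \<open>p t x\<close> is a process \<open>X\<close>
  together with laws \<open>P x\<close>, for \<open>x \<in> S\<close>, on one measurable space with a filtration \<open>F\<close>; under \<open>P x\<close>
  the process starts at \<open>x\<close>. The kernels are Borel measures on the whole type, thought of as measures
  on \<open>S\<close>. The filtration is indexed by \<open>[0, \<infinity>]\<close> and need not be the one generated by \<open>X\<close>.\<close>

definition markov_process ::
  "'e::topological_space set \<Rightarrow> (real \<Rightarrow> 'e \<Rightarrow> 'e measure) \<Rightarrow> (ennreal \<Rightarrow> 'w measure) \<Rightarrow>
   ('e \<Rightarrow> 'w measure) \<Rightarrow> (real \<Rightarrow> 'w \<Rightarrow> 'e) \<Rightarrow> bool" where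
  "markov_process S p F P X \<longleftrightarrow>
     filtration (space (F 0)) F \<and>
     (\<forall>t\<ge>0. X t \<in> borel_measurable (F (ennreal t)) \<and> (\<forall>\<omega>\<in>space (F 0). X t \<omega> \<in> S)) \<and>
     (\<forall>x\<in>S. prob_space (P x) \<and> (\<forall>t. subalgebra (P x) (F t)) \<and>
        (AE \<omega> in P x. X 0 \<omega> = x) \<and>
        (\<forall>s\<ge>0. \<forall>t\<ge>0. \<forall>A\<in>sets borel. AE \<omega> in P x.
           real_cond_exp (P x) (F (ennreal s)) (\<lambda>\<omega>'. indicator A (X (s + t) \<omega>')) \<omega>
             = measure (p t (X s \<omega>)) A))"

definition cadlag :: "(real \<Rightarrow> 'e::topological_space) \<Rightarrow> bool" where
  "cadlag f \<longleftrightarrow> (\<forall>t\<ge>0. (f \<longlongrightarrow> f t) (at_right t)) \<and> (\<forall>t>0. \<exists>l. (f \<longlongrightarrow> l) (at_left t))"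

text \<open>The strong Markov property for functionals of the whole path after a stopping time \<open>T\<close>. The
  stopping time may be infinite, in which case nothing is claimed.\<close>

definition strong_markov_property ::
  "'e::topological_space set \<Rightarrow> (ennreal \<Rightarrow> 'w measure) \<Rightarrow>
   ('e \<Rightarrow> 'w measure) \<Rightarrow> (real \<Rightarrow> 'w \<Rightarrow> 'e) \<Rightarrow> bool" where
  "strong_markov_property S F P X \<longleftrightarrow>
     (\<forall>T f C. stopping_time F T \<longrightarrow>
        f \<in> borel_measurable (PiM {0..} (\<lambda>_. borel)) \<longrightarrow> (\<forall>w. \<bar>f w\<bar> \<le> C) \<longrightarrow>
        (\<forall>x\<in>S. AE \<omega> in P x. T \<omega> < \<infinity> \<longrightarrow>
           real_cond_exp (P x) (filtration.pre_sigma (space (F 0)) F T)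
               (\<lambda>\<omega>'. f (\<lambda>t\<in>{0..}. X (enn2real (T \<omega>') + t) \<omega>')) \<omega>
             = (LINT \<omega>'|P (X (enn2real (T \<omega>)) \<omega>). f (\<lambda>t\<in>{0..}. X t \<omega>'))))"

definition weakly_converges_on ::
  "'e::topological_space set \<Rightarrow> ('i \<Rightarrow> 'e measure) \<Rightarrow> 'e measure \<Rightarrow> 'i filter \<Rightarrow> bool" where
  "weakly_converges_on S \<mu> \<nu> G \<longleftrightarrow>
     (\<forall>f :: 'e \<Rightarrow> real. continuous_on S f \<longrightarrow> bounded (f ` S) \<longrightarrow>
        ((\<lambda>i. LINT y:S|\<mu> i. f y) \<longlongrightarrow> (LINT y:S|\<nu>. f y)) G)"

definition feller :: "'e::topological_space set \<Rightarrow> (real \<Rightarrow> 'e \<Rightarrow> 'e measure) \<Rightarrow> bool" where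
  "feller S p \<longleftrightarrow> (\<forall>t\<ge>0. \<forall>x\<in>S. weakly_converges_on S (p t) (p t x) (at x within S))"

definition invariant_prob ::
  "'e::topological_space set \<Rightarrow> (real \<Rightarrow> 'e \<Rightarrow> 'e measure) \<Rightarrow> 'e measure \<Rightarrow> bool" where
  "invariant_prob S p \<mu> \<longleftrightarrow>
     prob_space \<mu> \<and> sets \<mu> = sets borel \<and> emeasure \<mu> S = 1 \<and>
     (\<forall>t\<ge>0. \<forall>A\<in>sets borel. (\<integral>\<^sup>+x\<in>S. emeasure (p t x) A \<partial>\<mu>) = emeasure \<mu> A)"

definition ergodic ::
  "'e::topological_space set \<Rightarrow> (real \<Rightarrow> 'e \<Rightarrow> 'e measure) \<Rightarrow>
   ('e \<Rightarrow> 'w measure) \<Rightarrow> (real \<Rightarrow> 'w \<Rightarrow> 'e) \<Rightarrow> bool" where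
  "ergodic S p P X \<longleftrightarrow>
     (\<exists>\<pi>. invariant_prob S p \<pi> \<and> (\<forall>\<mu>. invariant_prob S p \<mu> \<longrightarrow> \<mu> = \<pi>) \<and>
        (\<forall>x\<in>S. weakly_converges_on S (\<lambda>t. distr (P x) borel (X t)) \<pi> at_top))"

section \<open>Infinite rate mutually catalytic branching\<close>

definition imcb_kernel ::
  "(real \<times> real \<Rightarrow> (real \<times> real) measure) \<Rightarrow> real \<Rightarrow> real \<times> real \<Rightarrow>
   real \<Rightarrow> real \<times> real \<Rightarrow> (real \<times> real) measure" where
  "imcb_kernel Q c \<theta> t x = Q (exp (- c * t) *\<^sub>R x + (1 - exp (- c * t)) *\<^sub>R \<theta>)"

definition imcb_process ::
  "(real \<times> real \<Rightarrow> (real \<times> real) measure) \<Rightarrow> real \<Rightarrow> real \<times> real \<Rightarrow>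
   (ennreal \<Rightarrow> 'w measure) \<Rightarrow> (real \<times> real \<Rightarrow> 'w measure) \<Rightarrow>
   (real \<Rightarrow> 'w \<Rightarrow> real \<times> real) \<Rightarrow> bool" where
  "imcb_process Q c \<theta> F P X \<longleftrightarrow>
     markov_process axes (imcb_kernel Q c \<theta>) F P X \<and>
     (\<forall>\<omega>\<in>space (F 0). cadlag (\<lambda>t. X t \<omega>))"

end

theory Submission
  imports Defs
begin

text \<open>
Everything rests on the function
\<open>mlf z v = exp (- (z\<^sub>1 + z\<^sub>2) (v\<^sub>1 + v\<^sub>2) + \<i> (z\<^sub>1 - z\<^sub>2) (v\<^sub>1 - v\<^sub>2))\<close>.
It is symmetric, it turns sums in \<open>v\<close> into products, it has modulus at most 1 on the quadrant, and for
\<open>v\<close> on the axes it is harmonic in \<open>z\<close>.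

Planar Brownian motion stopped on leaving the quadrant therefore satisfies
\<open>\<integral> mlf z v Q\<^sub>x(dz) = mlf x v\<close> for \<open>v\<close> on the axes. Optional stopping is proved for all complex exponential
martingales at once. It is a finite computation with independent increments for first hitting times along
a grid (\<open>fair_grid_hit\<close>), and it survives pointwise limits of bounded times (\<open>fair_limit\<close>), which
is enough to reach the exit time. Integrating the identity over \<open>Q\<^sub>v\<close> with \<open>v\<close> inside the quadrant gives the
duality \<open>\<integral> mlf z v Q\<^sub>x(dz) = \<integral> mlf x w Q\<^sub>v(dw)\<close> (\<open>Q_duality\<close>), whose right-hand side is continuous in
\<open>x\<close>.

On the axes the functions \<open>mlf \<cdot> v\<close>, with \<open>v\<close> in the quadrant, span an algebra that is closed under
conjugation and separates the points of the one-point compactification. By the Stone-Weierstrass theorem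
they determine a law on the axes and detect weak convergence to a probability law
(\<open>axes_law_eqI_mlf\<close>, \<open>weakly_converges_mlf\<close>). Three conclusions follow.

The kernels \<open>Q\<close> are weakly continuous, and composing with the affine drift towards \<open>\<theta>\<close> gives the Feller
property. The multiplicative form of \<open>mlf\<close> matches the affine drift, so \<open>Q\<^sub>\<theta>\<close> is invariant. If \<open>c > 0\<close>, the
drift forgets its starting point, and the transform of any invariant law at \<open>v\<close> on the axes must be
\<open>mlf \<theta> v\<close>; this gives uniqueness, and weak continuity gives convergence to \<open>Q\<^sub>\<theta>\<close> from every state.

The strong Markov property holds for every Feller process with right-continuous paths (\<open>strong_markov\<close>).
A stopping time is approximated from the right by times with values in a grid, where the simple Markov
property applies; continuity of the kernels and of the paths then carries one step to the limit. As \<open>T + d\<close>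
is again a stopping time, one step at \<open>T\<close> can be iterated, which gives the finite-dimensional
distributions of the path after \<open>T\<close>, hence its law.
\<close>

section \<open>Complex exponential moments of Gaussian increments\<close>

lemma integral_normal_density_iexp:
  fixes \<mu> \<sigma> q :: real
  assumes \<sigma>: "0 < \<sigma>"
  shows "(LINT x|lborel. normal_density \<mu> \<sigma> x *\<^sub>R iexp (q * x))
          = iexp (q * \<mu>) * exp (- ((q * \<sigma>)\<^sup>2) / 2)"
proof -
  have dens: "\<sigma> * normal_density \<mu> \<sigma> (\<mu> + \<sigma> * y) = std_normal_density y" for y
    using \<sigma> by (simp add: normal_density_def real_sqrt_mult field_simps power_mult_distrib)
  have "(LINT x|lborel. normal_density \<mu> \<sigma> x *\<^sub>R iexp (q * x))
      = \<bar>\<sigma>\<bar> *\<^sub>R (LINT y|lborel. normal_density \<mu> \<sigma> (\<mu> + \<sigma> * y) *\<^sub>R iexp (q * (\<mu> + \<sigma> * y)))"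
    using \<sigma> by (intro lborel_integral_real_affine) auto
  also have "\<dots> = (LINT y|lborel. iexp (q * \<mu>) * (std_normal_density y *\<^sub>R iexp ((q * \<sigma>) * y)))"
    unfolding integral_scaleR_right[symmetric] dens[symmetric] using \<sigma>
    by (intro Bochner_Integration.integral_cong)
       (auto simp: scaleR_conv_of_real exp_add[symmetric] algebra_simps)
  also have "\<dots> = iexp (q * \<mu>) * (LINT y|lborel. std_normal_density y *\<^sub>R iexp ((q * \<sigma>) * y))"
    by (rule integral_mult_right_zero)
  also have "(LINT y|lborel. std_normal_density y *\<^sub>R iexp ((q * \<sigma>) * y))
      = char std_normal_distribution (q * \<sigma>)"
    unfolding char_def by (subst integral_density) auto
  finally show ?thesis
    by (simp add: char_std_normal_distribution)
qed

lemma normal_density_mult_exp: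
  assumes "0 < \<sigma>"
  shows "normal_density 0 \<sigma> x * exp (p * x) = exp ((p * \<sigma>)\<^sup>2 / 2) * normal_density (p * \<sigma>\<^sup>2) \<sigma> x"
proof -
  have "- x\<^sup>2 / (2 * \<sigma>\<^sup>2) + p * x = (p * \<sigma>)\<^sup>2 / 2 + - (x - p * \<sigma>\<^sup>2)\<^sup>2 / (2 * \<sigma>\<^sup>2)"
    using assms by (simp add: field_simps power2_eq_square)
  then have "exp (- x\<^sup>2 / (2 * \<sigma>\<^sup>2)) * exp (p * x) = exp ((p * \<sigma>)\<^sup>2 / 2) * exp (- (x - p * \<sigma>\<^sup>2)\<^sup>2 / (2 * \<sigma>\<^sup>2))"
    by (simp only: exp_add[symmetric])
  then show ?thesis
    by (simp add: normal_density_def field_simps)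
qed

text \<open>The real part of \<open>a\<close> tilts the Gaussian density, which shifts its mean and changes its mass; the
imaginary part is then an evaluation of the characteristic function of the shifted density.\<close>

lemma normal_complex_mgf:
  fixes a :: complex
  assumes \<sigma>: "0 < \<sigma>"
  shows "integrable lborel (\<lambda>x. normal_density 0 \<sigma> x *\<^sub>R exp (a * x))" (is ?int)
    and "(LINT x|lborel. normal_density 0 \<sigma> x *\<^sub>R exp (a * x)) = exp (a\<^sup>2 * \<sigma>\<^sup>2 / 2)" (is ?eq)
proof -
  define p q where "p = Re a" and "q = Im a"
  have a: "a = complex_of_real p + \<i> * complex_of_real q"
    by (simp add: p_def q_def complex_eq)
  have E: "normal_density 0 \<sigma> x *\<^sub>R exp (a * x)
     = exp ((p * \<sigma>)\<^sup>2 / 2) *\<^sub>R (normal_density (p * \<sigma>\<^sup>2) \<sigma> x *\<^sub>R iexp (q * x))" for x :: real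
  proof -
    have "exp (a * x) = exp (p * x) * iexp (q * x)"
      by (simp add: a exp_add[symmetric] exp_of_real[symmetric] algebra_simps)
    then have "normal_density 0 \<sigma> x *\<^sub>R exp (a * x)
        = complex_of_real (normal_density 0 \<sigma> x * exp (p * x)) * iexp (q * x)"
      by (simp add: scaleR_conv_of_real)
    then show ?thesis
      unfolding normal_density_mult_exp[OF \<sigma>] by (simp add: scaleR_conv_of_real)
  qed
  have I: "integrable lborel (\<lambda>x. normal_density \<mu> \<sigma> x *\<^sub>R iexp (q * x))" for \<mu>
    by (rule Bochner_Integration.integrable_bound[OF integrable_normal_density[OF \<sigma>, of \<mu>]]) auto
  show ?int
    unfolding E using I by (intro integrable_scaleR_right) auto
  have "complex_of_real ((p * \<sigma>)\<^sup>2 / 2) + (\<i> * complex_of_real (q * (p * \<sigma>\<^sup>2)) + complex_of_real (- ((q *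
      \<sigma>)\<^sup>2) / 2))
      = a\<^sup>2 * complex_of_real (\<sigma>\<^sup>2) / 2"
    by (simp add: a power2_eq_square algebra_simps)
  then have "exp (complex_of_real ((p * \<sigma>)\<^sup>2 / 2)) * (iexp (q * (p * \<sigma>\<^sup>2)) * exp (complex_of_real (- ((q *
      \<sigma>)\<^sup>2) / 2))) = exp (a\<^sup>2 * \<sigma>\<^sup>2 / 2)"
    by (simp only: exp_add[symmetric])
  then show ?eq
    unfolding E integral_scaleR_right integral_normal_density_iexp[OF \<sigma>]
    by (simp only: scaleR_conv_of_real exp_of_real[symmetric])
qed

lemma (in pair_sigma_finite) integral_fst_times_snd:
  fixes f :: "'a \<Rightarrow> complex" and g :: "'b \<Rightarrow> complex"
  assumes f: "integrable M1 f" and g: "integrable M2 g"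
  shows "integrable (M1 \<Otimes>\<^sub>M M2) (\<lambda>z. f (fst z) * g (snd z))"
    and "integral\<^sup>L (M1 \<Otimes>\<^sub>M M2) (\<lambda>z. f (fst z) * g (snd z)) = integral\<^sup>L M1 f * integral\<^sup>L M2 g"
proof -
  have [measurable]: "f \<in> borel_measurable M1" "g \<in> borel_measurable M2"
    using f g by auto
  show I: "integrable (M1 \<Otimes>\<^sub>M M2) (\<lambda>z. f (fst z) * g (snd z))"
  proof (rule Fubini_integrable)
    show "integrable M1 (\<lambda>x. LINT y|M2. norm (f (fst (x, y)) * g (snd (x, y))))"
      using f by (simp add: norm_mult)
  qed (use g in auto)
  show "integral\<^sup>L (M1 \<Otimes>\<^sub>M M2) (\<lambda>z. f (fst z) * g (snd z)) = integral\<^sup>L M1 f * integral\<^sup>L M2 g"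
    by (subst integral_fst'[OF I, symmetric]) simp
qed

definition exp_functional :: "complex \<Rightarrow> complex \<Rightarrow> real \<times> real \<Rightarrow> complex" where
  "exp_functional a b z = exp (a * fst z + b * snd z)"

lemma measurable_exp_functional [measurable]: "exp_functional a b \<in> borel_measurable borel"
  unfolding exp_functional_def by (intro borel_measurable_continuous_onI continuous_intros)

lemma exp_functional_add: "exp_functional a b (z + w) = exp_functional a b z * exp_functional a b w"
  by (simp add: exp_functional_def exp_add[symmetric] algebra_simps)

lemma planar_normal_mgf:
  fixes a b :: complex
  assumes D: "distributed M lborel D
      (\<lambda>(u, v). ennreal (normal_density 0 \<sigma> u * normal_density 0 \<sigma> v))" and \<sigma>: "0 < \<sigma>"
  shows "integrable M (\<lambda>\<omega>. exp_functional a b (D \<omega>))"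
    and "(LINT \<omega>|M. exp_functional a b (D \<omega>)) = exp ((a\<^sup>2 + b\<^sup>2) * \<sigma>\<^sup>2 / 2)"
proof -
  let ?d = "\<lambda>z. normal_density 0 \<sigma> (fst z) * normal_density 0 \<sigma> (snd z)"
  let ?f = "\<lambda>a x. normal_density 0 \<sigma> x *\<^sub>R exp (a * complex_of_real x)"
  have distr: "distr M lborel D = density lborel (\<lambda>z. ennreal (?d z))" and [measurable]: "D \<in>
      borel_measurable M"
    using D by (auto simp: distributed_def case_prod_beta')
  have E: "?d z *\<^sub>R exp_functional a b z = ?f a (fst z) * ?f b (snd z)" for z :: "real \<times> real"
    by (simp add: exp_functional_def exp_add scaleR_conv_of_real)
  have I: "integrable lborel (\<lambda>z. ?d z *\<^sub>R exp_functional a b z)"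
    unfolding E unfolding lborel_prod[symmetric]
        by (intro lborel_pair.integral_fst_times_snd normal_complex_mgf \<sigma>)
  have [measurable]: "?d \<in> borel_measurable borel"
    by (auto simp: borel_prod[symmetric])
  have "integrable (density lborel (\<lambda>z. ennreal (?d z))) (exp_functional a b)"
    by (subst integrable_density) (use I in auto)
  then show "integrable M (\<lambda>\<omega>. exp_functional a b (D \<omega>))"
    unfolding distr[symmetric] by (subst (asm) integrable_distr_eq) auto
  have "(LINT \<omega>|M. exp_functional a b (D \<omega>)) = integral\<^sup>L (distr M lborel D) (exp_functional a b)"
    by (subst integral_distr) auto
  also have "\<dots> = (LINT z|lborel. ?d z *\<^sub>R exp_functional a b z)"
    unfolding distr by (subst integral_density) auto
  also have "\<dots> = exp (a\<^sup>2 * \<sigma>\<^sup>2 / 2) * exp (b\<^sup>2 * \<sigma>\<^sup>2 / 2)"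
    unfolding E unfolding lborel_prod[symmetric]
    unfolding lborel_pair.integral_fst_times_snd(2)[OF normal_complex_mgf(1)[OF \<sigma>, of a]
        normal_complex_mgf(1)[OF \<sigma>, of b]]
    by (simp only: normal_complex_mgf(2)[OF \<sigma>])
  finally show "(LINT \<omega>|M. exp_functional a b (D \<omega>)) = exp ((a\<^sup>2 + b\<^sup>2) * \<sigma>\<^sup>2 / 2)"
    by (simp add: exp_add[symmetric] algebra_simps add_divide_distrib)
qed

section \<open>Exponential martingales of planar Brownian motion\<close>

text \<open>Bounded second moments make the sequence uniformly integrable: truncation at level \<open>R\<close> changes every
expectation by at most \<open>K / R\<close>, and the truncated variables converge by dominated convergence.\<close>

lemma (in prob_space) integral_convergence_L2:
  fixes X :: "nat \<Rightarrow> 'a \<Rightarrow> complex"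
  assumes [measurable]: "\<And>n. X n \<in> borel_measurable M"
    and lim: "\<And>\<omega>. \<omega> \<in> space M \<Longrightarrow> (\<lambda>n. X n \<omega>) \<longlonglongrightarrow> Y \<omega>"
    and sq: "\<And>n. integrable M (\<lambda>\<omega>. (cmod (X n \<omega>))\<^sup>2)"
    and bound: "\<And>n. (LINT \<omega>|M. (cmod (X n \<omega>))\<^sup>2) \<le> K"
  shows "integrable M Y" and "(\<lambda>n. LINT \<omega>|M. X n \<omega>) \<longlonglongrightarrow> (LINT \<omega>|M. Y \<omega>)"
proof -
  have [measurable]: "Y \<in> borel_measurable M"
    by (rule borel_measurable_LIMSEQ_metric[OF assms(1) lim])
  have K: "0 \<le> K"
    using bound[of 0] by (rule order_trans[rotated]) auto
  have nn: "(\<integral>\<^sup>+\<omega>. ennreal ((cmod (X n \<omega>))\<^sup>2) \<partial>M) \<le> ennreal K" for n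
    by (subst nn_integral_eq_integral[OF sq]) (use bound[of n] in \<open>auto intro: ennreal_leI\<close>)
  have "(\<integral>\<^sup>+\<omega>. ennreal ((cmod (Y \<omega>))\<^sup>2) \<partial>M) = (\<integral>\<^sup>+\<omega>. liminf (\<lambda>n. ennreal ((cmod (X n \<omega>))\<^sup>2)) \<partial>M)"
    by (intro nn_integral_cong lim_imp_Liminf[symmetric] tendsto_ennrealI tendsto_intros lim) auto
  also have "\<dots> \<le> liminf (\<lambda>n. \<integral>\<^sup>+\<omega>. ennreal ((cmod (X n \<omega>))\<^sup>2) \<partial>M)"
    by (intro nn_integral_liminf) auto
  also have "\<dots> \<le> liminf (\<lambda>n::nat. ennreal K)"
    by (intro Liminf_mono always_eventually allI nn)
  finally have Ynn: "(\<integral>\<^sup>+\<omega>. ennreal ((cmod (Y \<omega>))\<^sup>2) \<partial>M) \<le> ennreal K"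
    by (simp add: Liminf_const)
  have Ysq: "integrable M (\<lambda>\<omega>. (cmod (Y \<omega>))\<^sup>2)"
    by (rule integrableI_bounded) (use Ynn in \<open>auto intro: le_less_trans\<close>)
  have YK: "(LINT \<omega>|M. (cmod (Y \<omega>))\<^sup>2) \<le> K"
    using Ynn K by (subst (asm) nn_integral_eq_integral[OF Ysq]) auto
  have int: "integrable M Z" if [measurable]: "Z \<in> borel_measurable M" and "integrable M (\<lambda>\<omega>. (cmod (Z \<omega>))\<^sup>2)"
    for Z :: "'a \<Rightarrow> complex"
  proof (rule Bochner_Integration.integrable_bound[of M "\<lambda>\<omega>. 1 + (cmod (Z \<omega>))\<^sup>2"])
    have "cmod (Z \<omega>) \<le> 1 + (cmod (Z \<omega>))\<^sup>2" for \<omega>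
    proof -
      have "0 \<le> (cmod (Z \<omega>) - 1)\<^sup>2 + (cmod (Z \<omega>))\<^sup>2" by simp
      then show ?thesis by (simp add: power2_diff)
    qed
    then show "AE \<omega> in M. norm (Z \<omega>) \<le> norm (1 + (cmod (Z \<omega>))\<^sup>2)"
      by (auto intro!: AE_I2 order_trans[OF _ abs_ge_self])
  qed (use that in auto)
  show intY: "integrable M Y" by (intro int Ysq) auto
  have intX: "integrable M (X n)" for n by (intro int sq) auto
  \<comment> \<open>Cutting off at level \<open>R\<close> changes expectations by at most \<open>K / R\<close>.\<close>
  define cut where "cut R z = (if cmod z \<le> R then z else of_real (R / cmod z) * z)" for R and z :: complex
  have cut_alt: "cut R z = of_real (R / max R (cmod z)) * z" if "0 < R" for R z
    using that by (auto simp: cut_def max_def)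
  have cut_cont: "continuous_on UNIV (cut R)" if "0 < R" for R
  proof -
    have "continuous_on UNIV (\<lambda>z. of_real (R / max R (cmod z)) * z)"
      using that by (intro continuous_intros) (auto simp: max_def)
    then show ?thesis using cut_alt[OF that] by (auto cong: continuous_on_cong)
  qed
  have cut_norm: "cmod (cut R z) \<le> R" if "0 < R" for R z
    using that by (auto simp: cut_def norm_mult norm_divide)
  have cut_diff: "cmod (z - cut R z) \<le> (cmod z)\<^sup>2 / R" if R: "0 < R" for R z
  proof (cases "cmod z \<le> R")
    case False
    then have "z - cut R z = of_real (1 - R / cmod z) * z"
      by (simp add: cut_def algebra_simps)
    then have "cmod (z - cut R z) = \<bar>1 - R / cmod z\<bar> * cmod z"
      by (simp only: norm_mult norm_of_real)
    also have "\<bar>1 - R / cmod z\<bar> * cmod z = (1 - R / cmod z) * cmod z"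
    proof -
      have "0 < cmod z" using False R by linarith
      then show ?thesis using False R by simp
    qed
    also have "\<dots> \<le> 1 * cmod z"
      using R by (intro mult_right_mono) auto
    also have "\<dots> \<le> cmod z * (cmod z / R)"
      using False R by (intro order_trans[OF _ mult_left_mono[of 1 "cmod z / R" "cmod z"]]) auto
    finally show ?thesis by (simp add: power2_eq_square)
  qed (use R in \<open>auto simp: cut_def\<close>)
  have diff: "cmod ((LINT \<omega>|M. Z \<omega>) - (LINT \<omega>|M. cut R (Z \<omega>))) \<le> K / R"
    if R: "0 < R" and [measurable]: "Z \<in> borel_measurable M" and Z: "integrable M (\<lambda>\<omega>. (cmod (Z \<omega>))\<^sup>2)"
      and ZK: "(LINT \<omega>|M. (cmod (Z \<omega>))\<^sup>2) \<le> K" for R Z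
  proof -
    have [measurable]: "cut R \<in> borel_measurable borel"
      by (rule borel_measurable_continuous_onI[OF cut_cont[OF R]])
    have c: "integrable M (\<lambda>\<omega>. cut R (Z \<omega>))"
      by (rule integrable_const_bound[where B=R]) (auto simp: cut_norm R)
    have z: "integrable M Z" by (intro int Z) auto
    have "cmod ((LINT \<omega>|M. Z \<omega>) - (LINT \<omega>|M. cut R (Z \<omega>))) = cmod (LINT \<omega>|M. Z \<omega> - cut R (Z \<omega>))"
      using c z by simp
    also have "\<dots> \<le> (LINT \<omega>|M. (cmod (Z \<omega>))\<^sup>2 / R)"
      by (rule order_trans[OF integral_norm_bound integral_mono]) (use c z Z in \<open>auto intro: cut_diff R\<close>)
    also have "\<dots> \<le> K / R"
      using ZK R by (simp add: divide_right_mono)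
    finally show ?thesis .
  qed
  show "(\<lambda>n. LINT \<omega>|M. X n \<omega>) \<longlonglongrightarrow> (LINT \<omega>|M. Y \<omega>)"
  proof (rule LIMSEQ_I)
    fix e :: real assume e: "0 < e"
    define R where "R = 3 * (K + 1) / e"
    have R: "0 < R" using e K by (simp add: R_def)
    have KR: "K / R < e / 3" using e K by (simp add: R_def field_simps)
    have [measurable]: "cut R \<in> borel_measurable borel"
      by (rule borel_measurable_continuous_onI[OF cut_cont[OF R]])
    have "(\<lambda>n. LINT \<omega>|M. cut R (X n \<omega>)) \<longlonglongrightarrow> (LINT \<omega>|M. cut R (Y \<omega>))"
    proof (rule integral_dominated_convergence[where w="\<lambda>_. R"])
      show "AE \<omega> in M. (\<lambda>n. cut R (X n \<omega>)) \<longlonglongrightarrow> cut R (Y \<omega>)"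
        using cut_cont[OF R] lim by (auto intro!: AE_I2 isCont_tendsto_compose[of _ "cut R"]
            simp: continuous_on_eq_continuous_at)
    qed (auto simp: cut_norm R)
    from LIMSEQ_D[OF this, of "e/3"] e obtain n0 where
      n0: "cmod ((LINT \<omega>|M. cut R (X n \<omega>)) - (LINT \<omega>|M. cut R (Y \<omega>))) < e / 3" if "n \<ge> n0" for n
      by auto
    have "cmod ((LINT \<omega>|M. X n \<omega>) - (LINT \<omega>|M. Y \<omega>)) < e" if "n \<ge> n0" for n
    proof -
      have 1: "cmod ((LINT \<omega>|M. X n \<omega>) - (LINT \<omega>|M. cut R (X n \<omega>))) < e / 3"
        by (rule le_less_trans[OF diff[OF R _ sq bound] KR]) measurable
      have 2: "cmod ((LINT \<omega>|M. Y \<omega>) - (LINT \<omega>|M. cut R (Y \<omega>))) < e / 3"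
        by (rule le_less_trans[OF diff[OF R _ Ysq YK] KR]) measurable
      have tri: "cmod (u - v) \<le> cmod (u - u') + cmod (u' - v') + cmod (v - v')" for u v u' v' :: complex
        using norm_triangle_ineq4[of "(u - u') + (u' - v')" "v - v'"] norm_triangle_ineq[of "u - u'" "u' -
            v'"] by simp
      show ?thesis
        using tri[of "LINT \<omega>|M. X n \<omega>" "LINT \<omega>|M. Y \<omega>" "LINT \<omega>|M. cut R (X n \<omega>)" "LINT \<omega>|M. cut R (Y \<omega>)"]
          1 2 n0[OF that] by linarith
    qed
    then show "\<exists>no. \<forall>n\<ge>no. cmod ((LINT \<omega>|M. X n \<omega>) - (LINT \<omega>|M. Y \<omega>)) < e"
      by blast
  qed
qed

locale planar_bm =
  fixes M :: "'a measure" and W :: "real \<Rightarrow> 'a \<Rightarrow> real \<times> real" and x :: "real \<times> real"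
  assumes planar_bm: "planar_brownian_motion M W x"
begin

sublocale prob_space M
  using planar_bm by (simp add: planar_brownian_motion_def)

lemma measurable_W [measurable (raw)]: "0 \<le> t \<Longrightarrow> W t \<in> borel_measurable M"
  and W_0: "\<omega> \<in> space M \<Longrightarrow> W 0 \<omega> = x"
  and continuous_W: "\<omega> \<in> space M \<Longrightarrow> continuous_on {0..} (\<lambda>t. W t \<omega>)"
  and increment: "0 \<le> s \<Longrightarrow> s < t \<Longrightarrow> distributed M lborel (\<lambda>\<omega>. W t \<omega> - W s \<omega>)
          (\<lambda>(a, b). ennreal (normal_density 0 (sqrt (t - s)) a * normal_density 0 (sqrt (t - s)) b))"
  and indep_increments: "0 \<le> r 0 \<Longrightarrow> (\<And>i. i < n \<Longrightarrow> r i < r (Suc i)) \<Longrightarrow>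
        indep_vars (\<lambda>_. borel) (\<lambda>i \<omega>. W (r (Suc i)) \<omega> - W (r i) \<omega>) {..<n}"
  using planar_bm unfolding planar_brownian_motion_def by blast+

text \<open>The exponential martingale with complex exponents. When \<open>a\<^sup>2 + b\<^sup>2 = 0\<close> it does not depend on the time
explicitly and is a harmonic function of the position.\<close>

definition expM :: "complex \<Rightarrow> complex \<Rightarrow> real \<Rightarrow> 'a \<Rightarrow> complex" where
  "expM a b t \<omega> = exp_functional a b (W t \<omega> - x) * exp (- ((a\<^sup>2 + b\<^sup>2) / 2 * t))"

lemma expM_0: "\<omega> \<in> space M \<Longrightarrow> expM a b 0 \<omega> = 1"
  by (simp add: expM_def W_0 exp_functional_def)

lemma integrable_expM: "0 \<le> t \<Longrightarrow> integrable M (expM a b t)"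
proof (cases "t = 0")
  case True
  then show ?thesis
    using expM_0[of _ a b] by (subst Bochner_Integration.integrable_cong[where g="\<lambda>_. 1"]) auto
next
  case False
  assume "0 \<le> t"
  with False have "integrable M (\<lambda>\<omega>. exp_functional a b (W t \<omega> - W 0 \<omega>))"
    by (intro planar_normal_mgf[OF increment]) auto
  then have "integrable M (\<lambda>\<omega>. exp_functional a b (W t \<omega> - x))"
    by (subst (asm) Bochner_Integration.integrable_cong[OF refl, where g="\<lambda>\<omega>. exp_functional a b (W t \<omega> - x)"])
       (auto simp: W_0)
  then show ?thesis
    unfolding expM_def by auto
qed

text \<open>Over one time step the martingale is multiplied by an independent factor of mean 1.\<close>

lemma increment_factor:
  assumes "0 \<le> s" "s < t"
  shows "integrable M (\<lambda>\<omega>. exp_functional a b (W t \<omega> - W s \<omega>) * exp (- ((a\<^sup>2 + b\<^sup>2) / 2 * (t - s))) - 1)"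
    and "(LINT \<omega>|M. exp_functional a b (W t \<omega> - W s \<omega>) * exp (- ((a\<^sup>2 + b\<^sup>2) / 2 * (t - s))) - 1) = 0"
proof -
  have D: "0 < sqrt (t - s)" and sq: "(sqrt (t - s))\<^sup>2 = t - s" using assms by auto
  note mgf = planar_normal_mgf[OF increment[OF assms] D, of a b, unfolded sq]
  have I: "integrable M (\<lambda>\<omega>. exp_functional a b (W t \<omega> - W s \<omega>) * exp (- ((a\<^sup>2 + b\<^sup>2) / 2 * (t - s))))"
    by (intro integrable_mult_left mgf)
  then show "integrable M (\<lambda>\<omega>. exp_functional a b (W t \<omega> - W s \<omega>) * exp (- ((a\<^sup>2 + b\<^sup>2) / 2 * (t - s))) - 1)"
    by simp
  have "(LINT \<omega>|M. exp_functional a b (W t \<omega> - W s \<omega>) * exp (- ((a\<^sup>2 + b\<^sup>2) / 2 * (t - s)))) = 1"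
    by (simp only: integral_mult_left_zero mgf(2)) (simp add: exp_add[symmetric] algebra_simps)
  then show "(LINT \<omega>|M. exp_functional a b (W t \<omega> - W s \<omega>) * exp (- ((a\<^sup>2 + b\<^sup>2) / 2 * (t - s))) - 1) = 0"
    using I by (simp add: prob_space)
qed

text \<open>Continuity of the paths makes \<open>W\<close> at a random time the limit of \<open>W\<close> at countably valued times.\<close>

lemma measurable_W_at [measurable (raw)]:
  assumes [measurable]: "\<rho> \<in> borel_measurable M" and \<rho>: "\<And>\<omega>. \<omega> \<in> space M \<Longrightarrow> 0 \<le> \<rho> \<omega>"
  shows "(\<lambda>\<omega>. W (\<rho> \<omega>) \<omega>) \<in> borel_measurable M"
proof (rule borel_measurable_LIMSEQ_metric)
  fix n :: nat
  show "(\<lambda>\<omega>. W (real (nat \<lfloor>real (Suc n) * \<rho> \<omega>\<rfloor>) / real (Suc n)) \<omega>) \<in> borel_measurable M"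
    by (rule measurable_compose_countable[where f="\<lambda>k. W (real k / real (Suc n))" and g="\<lambda>\<omega>. nat \<lfloor>real (Suc
        n) * \<rho> \<omega>\<rfloor>"])
       auto
next
  fix \<omega> assume \<omega>: "\<omega> \<in> space M"
  have "(\<lambda>n. real (nat \<lfloor>real (Suc n) * \<rho> \<omega>\<rfloor>) / real (Suc n)) \<longlonglongrightarrow> \<rho> \<omega>"
  proof (rule tendsto_sandwich[where f="\<lambda>n. \<rho> \<omega> - 1 / real (Suc n)" and h="\<lambda>n. \<rho> \<omega>"])
    have "(\<lambda>n. \<rho> \<omega> - 1 / real (Suc n)) \<longlonglongrightarrow> \<rho> \<omega> - 0"
      by (intro tendsto_intros LIMSEQ_Suc[OF lim_1_over_n])
    then show "(\<lambda>n. \<rho> \<omega> - 1 / real (Suc n)) \<longlonglongrightarrow> \<rho> \<omega>" by simp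
    show "\<forall>\<^sub>F n in sequentially. \<rho> \<omega> - 1 / real (Suc n) \<le> real (nat \<lfloor>real (Suc n) * \<rho> \<omega>\<rfloor>) / real (Suc n)"
    proof (rule always_eventually, rule allI)
      fix n
      have "real (Suc n) * \<rho> \<omega> - 1 \<le> real (nat \<lfloor>real (Suc n) * \<rho> \<omega>\<rfloor>)"
        using \<rho>[OF \<omega>] by (subst of_nat_nat) (simp, linarith)
      then have "(real (Suc n) * \<rho> \<omega> - 1) / real (Suc n) \<le> real (nat \<lfloor>real (Suc n) * \<rho> \<omega>\<rfloor>) / real (Suc n)"
        by (rule divide_right_mono) simp
      then show "\<rho> \<omega> - 1 / real (Suc n) \<le> real (nat \<lfloor>real (Suc n) * \<rho> \<omega>\<rfloor>) / real (Suc n)"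
        by (simp add: diff_divide_distrib del: of_nat_Suc)
    qed
    show "\<forall>\<^sub>F n in sequentially. real (nat \<lfloor>real (Suc n) * \<rho> \<omega>\<rfloor>) / real (Suc n) \<le> \<rho> \<omega>"
    proof (rule always_eventually, rule allI)
      fix n
      have "real (nat \<lfloor>real (Suc n) * \<rho> \<omega>\<rfloor>) \<le> real (Suc n) * \<rho> \<omega>"
        using \<rho>[OF \<omega>] by (subst of_nat_nat) auto
      then show "real (nat \<lfloor>real (Suc n) * \<rho> \<omega>\<rfloor>) / real (Suc n) \<le> \<rho> \<omega>"
        by (simp add: field_simps del: of_nat_Suc)
    qed
  qed auto
  from continuous_on_tendsto_compose[OF continuous_W[OF \<omega>] this]
  show "(\<lambda>n. W (real (nat \<lfloor>real (Suc n) * \<rho> \<omega>\<rfloor>) / real (Suc n)) \<omega>) \<longlonglongrightarrow> W (\<rho> \<omega>) \<omega>"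
    using \<rho>[OF \<omega>] by auto
qed

lemma measurable_expM_at [measurable (raw)]:
  assumes [measurable]: "\<rho> \<in> borel_measurable M" and \<rho>: "\<And>\<omega>. \<omega> \<in> space M \<Longrightarrow> 0 \<le> \<rho> \<omega>"
  shows "(\<lambda>\<omega>. expM a b (\<rho> \<omega>) \<omega>) \<in> borel_measurable M"
  using measurable_W_at[OF assms] unfolding expM_def by measurable

lemma continuous_expM: "\<omega> \<in> space M \<Longrightarrow> continuous_on {0..} (\<lambda>t. expM a b t \<omega>)"
  unfolding expM_def exp_functional_def
  by (intro continuous_intros continuous_W) auto

text \<open>The times, bounded by \<open>T\<close>, at which optional stopping holds for every exponential martingale. Asking for
all exponents together is what makes the class closed under limits: the squared modulus of one martingale is
controlled by another one.\<close>

definition fair :: "real \<Rightarrow> ('a \<Rightarrow> real) \<Rightarrow> bool" where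
  "fair T \<rho> \<longleftrightarrow> \<rho> \<in> borel_measurable M \<and> (\<forall>\<omega>\<in>space M. 0 \<le> \<rho> \<omega> \<and> \<rho> \<omega> \<le> T) \<and>
     (\<forall>a b. integrable M (\<lambda>\<omega>. expM a b (\<rho> \<omega>) \<omega>) \<and> (LINT \<omega>|M. expM a b (\<rho> \<omega>) \<omega>) = 1)"

lemma cmod_expM_square:
  obtains C where "\<And>t \<omega>. (cmod (expM a b t \<omega>))\<^sup>2 = Re (expM (2 * Re a) (2 * Re b) t \<omega>) * exp (C * t)"
proof
  let ?C = "2 * (Re a)\<^sup>2 + 2 * (Re b)\<^sup>2 - Re (a\<^sup>2 + b\<^sup>2)"
  fix t \<omega>
  define u v where "u = fst (W t \<omega> - x)" and "v = snd (W t \<omega> - x)"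
  have 1: "expM (2 * Re a) (2 * Re b) t \<omega>
     = complex_of_real (exp (2 * Re a * u + 2 * Re b * v - (2 * (Re a)\<^sup>2 + 2 * (Re b)\<^sup>2) * t))"
    by (simp add: expM_def exp_functional_def u_def v_def exp_of_real[symmetric] exp_add[symmetric]
        algebra_simps
       power_mult_distrib exp_diff add_divide_distrib)
  have 2: "expM a b t \<omega> = exp (a * u + b * v - (a\<^sup>2 + b\<^sup>2) / 2 * t)"
    unfolding expM_def exp_functional_def u_def v_def exp_add[symmetric] by simp
  have "cmod (expM a b t \<omega>) = exp (Re a * u + Re b * v - Re (a\<^sup>2 + b\<^sup>2) / 2 * t)"
    unfolding 2 norm_exp_eq_Re by simp
  then have "(cmod (expM a b t \<omega>))\<^sup>2 = exp (2 * (Re a * u + Re b * v - Re (a\<^sup>2 + b\<^sup>2) / 2 * t))"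
    by (simp only: exp_double)
  also have "\<dots> = exp (2 * Re a * u + 2 * Re b * v - (2 * (Re a)\<^sup>2 + 2 * (Re b)\<^sup>2) * t + ?C * t)"
    by (simp add: algebra_simps)
  finally show "(cmod (expM a b t \<omega>))\<^sup>2 = Re (expM (2 * Re a) (2 * Re b) t \<omega>) * exp (?C * t)"
    unfolding 1 by (simp add: exp_add)
qed

text \<open>Optional stopping at the exponents \<open>(2 Re a, 2 Re b)\<close> bounds the second moments at \<open>(a, b)\<close> uniformly
on \<open>[0, T]\<close>, so the expectations converge along with the stopped values.\<close>

lemma fair_limit:
  assumes fair: "\<And>n. fair T (\<rho> n)" and lim: "\<And>\<omega>. \<omega> \<in> space M \<Longrightarrow> (\<lambda>n. \<rho> n \<omega>) \<longlonglongrightarrow> \<sigma> \<omega>"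
  shows "fair T \<sigma>"
proof -
  have [measurable]: "\<rho> n \<in> borel_measurable M" for n using fair by (auto simp: fair_def)
  have bnd: "0 \<le> \<rho> n \<omega>" "\<rho> n \<omega> \<le> T" if "\<omega> \<in> space M" for n \<omega>
    using fair[of n] that by (auto simp: fair_def)
  have [measurable]: "\<sigma> \<in> borel_measurable M"
    by (rule borel_measurable_LIMSEQ_metric[of \<rho>]) (use lim in auto)
  have \<sigma>: "0 \<le> \<sigma> \<omega>" "\<sigma> \<omega> \<le> T" if "\<omega> \<in> space M" for \<omega>
    using LIMSEQ_le_const[OF lim[OF that], of 0] LIMSEQ_le_const2[OF lim[OF that], of T] bnd[OF that] by auto
  have "integrable M (\<lambda>\<omega>. expM a b (\<sigma> \<omega>) \<omega>) \<and> (LINT \<omega>|M. expM a b (\<sigma> \<omega>) \<omega>) = 1" for a b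
  proof -
    obtain C where C: "\<And>t \<omega>. (cmod (expM a b t \<omega>))\<^sup>2 = Re (expM (2 * Re a) (2 * Re b) t \<omega>) * exp (C * t)"
      using cmod_expM_square[of a b] by metis
    define R where "R n \<omega> = Re (expM (2 * Re a) (2 * Re b) (\<rho> n \<omega>) \<omega>)" for n \<omega>
    have R0: "0 \<le> R n \<omega>" for n \<omega>
    proof -
      have "0 \<le> (cmod (expM a b (\<rho> n \<omega>) \<omega>))\<^sup>2" by simp
      then show ?thesis unfolding C R_def by (simp add: zero_le_mult_iff)
    qed
    have intR: "integrable M (R n)" and R1: "(LINT \<omega>|M. R n \<omega>) = 1" for n
      unfolding R_def using fair[of n] by (auto simp: fair_def)
    have le: "(cmod (expM a b (\<rho> n \<omega>) \<omega>))\<^sup>2 \<le> R n \<omega> * exp (\<bar>C\<bar> * T)" if "\<omega> \<in> space M" for n \<omega>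
    proof -
      have "C * \<rho> n \<omega> \<le> \<bar>C\<bar> * T"
        using bnd[OF that, of n] by (intro mult_mono) auto
      then show ?thesis unfolding C R_def[symmetric] using R0 by (intro mult_left_mono) auto
    qed
    have sq: "integrable M (\<lambda>\<omega>. (cmod (expM a b (\<rho> n \<omega>) \<omega>))\<^sup>2)" for n
      by (rule Bochner_Integration.integrable_bound[of M "\<lambda>\<omega>. R n \<omega> * exp (\<bar>C\<bar> * T)"])
         (use intR[of n] le bnd in \<open>auto intro!: AE_I2 order_trans[OF _ abs_ge_self]\<close>)
    have "(LINT \<omega>|M. (cmod (expM a b (\<rho> n \<omega>) \<omega>))\<^sup>2) \<le> (LINT \<omega>|M. R n \<omega> * exp (\<bar>C\<bar> * T))" for n
      by (intro integral_mono sq le integrable_mult_left intR)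
    then have bound: "(LINT \<omega>|M. (cmod (expM a b (\<rho> n \<omega>) \<omega>))\<^sup>2) \<le> exp (\<bar>C\<bar> * T)" for n
      by (simp add: R1)
    have conv: "(\<lambda>n. expM a b (\<rho> n \<omega>) \<omega>) \<longlonglongrightarrow> expM a b (\<sigma> \<omega>) \<omega>" if "\<omega> \<in> space M" for \<omega>
      using continuous_on_tendsto_compose[OF continuous_expM[OF that] lim[OF that]] bnd[OF that] \<sigma>[OF that]
          by auto
    note L2 = integral_convergence_L2[where X="\<lambda>n \<omega>. expM a b (\<rho> n \<omega>) \<omega>", OF _ conv sq bound]
    have "(\<lambda>n::nat. 1) \<longlonglongrightarrow> (LINT \<omega>|M. expM a b (\<sigma> \<omega>) \<omega>)"
      using L2(2) fair bnd by (auto simp: fair_def)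
    then show ?thesis
      using L2(1) bnd by (auto simp: LIMSEQ_const_iff)
  qed
  then show ?thesis
    unfolding fair_def using \<sigma> by auto
qed

end

section \<open>Optional stopping along grids\<close>

text \<open>The index 0 is left out because the exit time only looks at strictly positive times.\<close>

definition grid_index :: "(nat \<Rightarrow> bool) \<Rightarrow> nat \<Rightarrow> nat" where
  "grid_index A N = Min (insert N {j\<in>{1..N}. A j})"

lemma grid_index_le: "grid_index A N \<le> N"
  unfolding grid_index_def by (rule Min_le) auto

lemma grid_index_pos: "0 < N \<Longrightarrow> 0 < grid_index A N"
  using Min_in[of "insert N {j\<in>{1..N}. A j}"] by (auto simp: grid_index_def)

lemma grid_index_hit: "grid_index A N < N \<Longrightarrow> A (grid_index A N)"
  using Min_in[of "insert N {j\<in>{1..N}. A j}"] by (auto simp: grid_index_def)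

lemma less_grid_index_iff: "k < N \<Longrightarrow> k < grid_index A N \<longleftrightarrow> (\<forall>j\<in>{1..k}. \<not> A j)"
proof -
  assume k: "k < N"
  have "k < grid_index A N \<longleftrightarrow> (\<forall>j\<in>insert N {j\<in>{1..N}. A j}. k < j)"
    unfolding grid_index_def by (rule Min_gr_iff) auto
  also have "\<dots> \<longleftrightarrow> (\<forall>j\<in>{1..k}. \<not> A j)"
  proof safe
    fix j assume "\<forall>j\<in>{1..k}. \<not> A j" "j \<in> {1..N}" "A j"
    then show "k < j" by (meson atLeastAtMost_iff not_le)
  qed (use k in force)+
  finally show ?thesis .
qed

text \<open>The stopped value as a sum of increments, in which the increment after step \<open>k\<close> is switched on by an
event that depends on the steps up to \<open>k\<close> only.\<close>

lemma grid_index_telescope: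
  fixes f :: "nat \<Rightarrow> 'b::ab_group_add"
  shows "f (grid_index A N) = f 0 + (\<Sum>k<N. if \<forall>j\<in>{1..k}. \<not> A j then f (Suc k) - f k else 0)"
proof -
  have "(\<Sum>k<N. if \<forall>j\<in>{1..k}. \<not> A j then f (Suc k) - f k else 0)
     = (\<Sum>k<N. if k < grid_index A N then f (Suc k) - f k else 0)"
    by (intro sum.cong) (auto simp: less_grid_index_iff)
  also have "\<dots> = (\<Sum>k<grid_index A N. f (Suc k) - f k)"
    using grid_index_le[of A N] by (intro sum.mono_neutral_cong_right) auto
  finally show ?thesis by (simp add: sum_lessThan_telescope)
qed

context planar_bm
begin

lemma W_grid:
  assumes "\<omega> \<in> space M"
  shows "W (h * real k) \<omega> = x + (\<Sum>i<k. W (h * real (Suc i)) \<omega> - W (h * real i) \<omega>)"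
  by (subst sum_lessThan_telescope) (use assms in \<open>auto simp: W_0\<close>)

text \<open>Being alive at step \<open>k\<close> depends on the first \<open>k\<close> increments, while the increment of the martingale is its
current value times an independent variable of mean zero.\<close>

lemma expM_step:
  assumes h: "0 < h" and D[measurable]: "D \<in> sets borel"
  defines "alive \<equiv> \<lambda>k \<omega>. \<forall>j\<in>{1..k}. W (h * real j) \<omega> \<notin> D"
  shows "integrable M (\<lambda>\<omega>. if alive k \<omega> then expM a b (h * real (Suc k)) \<omega> - expM a b (h * real k) \<omega> else 0)"
    and "(LINT \<omega>|M. (if alive k \<omega> then expM a b (h * real (Suc k)) \<omega> - expM a b (h * real k) \<omega> else 0)) = 0"
proof -
  define \<xi> where "\<xi> i \<omega> = W (h * real (Suc i)) \<omega> - W (h * real i) \<omega>" for i \<omega>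
  define past where "past v = (if \<forall>j\<in>{1..k}. x + (\<Sum>i<j. v i) \<notin> D
      then exp_functional a b (\<Sum>i<k. v i) * exp (- ((a\<^sup>2 + b\<^sup>2) / 2 * (h * real k))) else 0)" for v
  define next_factor where "next_factor z = exp_functional a b z * exp (- ((a\<^sup>2 + b\<^sup>2) / 2 * h)) - 1" for z
  have ind: "indep_vars (\<lambda>_. borel) \<xi> {..<Suc k}"
    unfolding \<xi>_def by (rule indep_increments) (use h in \<open>auto simp: algebra_simps\<close>)
  have "indep_var borel (past \<circ> (\<lambda>\<omega>. \<lambda>i\<in>{..<k}. \<xi> i \<omega>)) borel ((\<lambda>v. next_factor (v k)) \<circ> (\<lambda>\<omega>. \<lambda>i\<in>{k}. \<xi> i \<omega>))"
  proof (rule indep_var_compose[OF indep_var_restrict[OF ind]])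
    show "past \<in> borel_measurable (PiM {..<k} (\<lambda>_. borel))"
    proof -
      have [measurable]: "(\<lambda>v::nat \<Rightarrow> real \<times> real. \<Sum>i<j. v i) \<in> borel_measurable (PiM {..<k} (\<lambda>_. borel))"
          if "j \<le> k" for j
        using that by (intro borel_measurable_sum measurable_component_singleton) auto
      have "Measurable.pred (PiM {..<k} (\<lambda>_. borel)) (\<lambda>v. \<forall>j\<in>{1..k}. x + (\<Sum>i<j. v i) \<notin> D)"
        by (intro pred_intros_finite pred_intros_logic) auto
      then show ?thesis
        unfolding past_def by measurable
    qed
    show "(\<lambda>v. next_factor (v k)) \<in> borel_measurable (PiM {k} (\<lambda>_. borel))"
      unfolding next_factor_def by measurable
  qed auto
  then have indep: "indep_var borel (\<lambda>\<omega>. past (\<lambda>i\<in>{..<k}. \<xi> i \<omega>)) borel (\<lambda>\<omega>. next_factor (\<xi> k \<omega>))"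
    by (simp add: comp_def)
  have past_eq: "past (\<lambda>i\<in>{..<k}. \<xi> i \<omega>) = (if alive k \<omega> then expM a b (h * real k) \<omega> else 0)"
      if "\<omega> \<in> space M" for \<omega>
  proof -
    have "(\<Sum>i<j. (\<lambda>i\<in>{..<k}. \<xi> i \<omega>) i) = W (h * real j) \<omega> - x" if "j \<le> k" for j
      using that by (subst W_grid[OF \<open>\<omega> \<in> space M\<close>, of h j]) (auto simp: \<xi>_def intro!: sum.cong)
    then show ?thesis
      by (auto simp: past_def alive_def expM_def)
  qed
  have alive_meas: "Measurable.pred M (alive k)"
    unfolding alive_def using h by (intro pred_intros_finite pred_intros_logic) auto
  have int_past: "integrable M (\<lambda>\<omega>. past (\<lambda>i\<in>{..<k}. \<xi> i \<omega>))"
  proof (rule Bochner_Integration.integrable_bound[OF integrable_expM[of "h * real k" a b]])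
    show "(\<lambda>\<omega>. past (\<lambda>i\<in>{..<k}. \<xi> i \<omega>)) \<in> borel_measurable M"
      using indep_var_rv1[OF indep] .
  qed (use h in \<open>auto simp: past_eq\<close>)
  have inc: "0 \<le> h * real k" "h * real k < h * real (Suc k)" "h * real (Suc k) - h * real k = h"
    using h by (auto simp: algebra_simps)
  have int_next: "integrable M (\<lambda>\<omega>. next_factor (\<xi> k \<omega>))" and zero: "(LINT \<omega>|M. next_factor (\<xi> k \<omega>)) = 0"
    using increment_factor[OF inc(1,2), of a b] unfolding inc(3) next_factor_def \<xi>_def by auto
  have eq: "(if alive k \<omega> then expM a b (h * real (Suc k)) \<omega> - expM a b (h * real k) \<omega> else 0)
      = past (\<lambda>i\<in>{..<k}. \<xi> i \<omega>) * next_factor (\<xi> k \<omega>)" if "\<omega> \<in> space M" for \<omega>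
  proof -
    have "W (h * real (Suc k)) \<omega> - x = (W (h * real k) \<omega> - x) + \<xi> k \<omega>"
      by (simp add: \<xi>_def)
    then have "exp_functional a b (W (h * real (Suc k)) \<omega> - x)
       = exp_functional a b (W (h * real k) \<omega> - x) * exp_functional a b (\<xi> k \<omega>)"
      by (simp only: exp_functional_add)
    moreover have "exp (- ((a\<^sup>2 + b\<^sup>2) / 2 * (h * real (Suc k))))
       = exp (- ((a\<^sup>2 + b\<^sup>2) / 2 * (h * real k))) * exp (- ((a\<^sup>2 + b\<^sup>2) / 2 * complex_of_real h))"
      unfolding exp_add[symmetric] by (simp add: algebra_simps add_divide_distrib)
    ultimately have "expM a b (h * real (Suc k)) \<omega>
       = expM a b (h * real k) \<omega> * (exp_functional a b (\<xi> k \<omega>) * exp (- ((a\<^sup>2 + b\<^sup>2) / 2 * h)))"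
      by (simp only: expM_def mult_ac)
    then show ?thesis
      by (simp add: past_eq[OF that] next_factor_def algebra_simps)
  qed
  show "integrable M (\<lambda>\<omega>. if alive k \<omega> then expM a b (h * real (Suc k)) \<omega> - expM a b (h * real k) \<omega> else 0)"
    by (subst Bochner_Integration.integrable_cong[OF refl eq])
       (auto intro: indep_var_integrable[OF indep int_past int_next])
  show "(LINT \<omega>|M. (if alive k \<omega> then expM a b (h * real (Suc k)) \<omega> - expM a b (h * real k) \<omega> else 0)) = 0"
    by (subst Bochner_Integration.integral_cong[OF refl eq])
       (auto simp: indep_var_lebesgue_integral[OF indep int_past int_next] zero)
qed

text \<open>The grids for successive \<open>n\<close> are nested, so these hitting times decrease in \<open>n\<close>.\<close>

definition grid_hit :: "(real \<times> real) set \<Rightarrow> real \<Rightarrow> nat \<Rightarrow> 'a \<Rightarrow> real" where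
  "grid_hit D T n \<omega> = T / 2 ^ n * real (grid_index (\<lambda>j. W (T / 2 ^ n * real j) \<omega> \<in> D) (2 ^ n))"

lemma fair_grid_hit:
  assumes T: "0 < T" and D[measurable]: "D \<in> sets borel"
  shows "fair T (grid_hit D T n)"
proof -
  define h where "h = T / 2 ^ n"
  have h: "0 < h" and hT: "h * 2 ^ n = T" using T by (auto simp: h_def)
  define alive where "alive k \<omega> \<longleftrightarrow> (\<forall>j\<in>{1..k}. W (h * real j) \<omega> \<notin> D)" for k \<omega>
  have hit: "grid_hit D T n \<omega> = h * real (grid_index (\<lambda>j. W (h * real j) \<omega> \<in> D) (2 ^ n))" for \<omega>
    by (simp add: grid_hit_def h_def)
  have [measurable]: "Measurable.pred M (alive k)" for k
    unfolding alive_def using h by (intro pred_intros_finite pred_intros_logic) auto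
  have "grid_hit D T n = (\<lambda>\<omega>. \<Sum>k<2^n. if alive k \<omega> then h else 0)"
    unfolding hit fun_eq_iff by (subst grid_index_telescope[where f="\<lambda>k. h * real k"])
      (auto simp: alive_def algebra_simps intro!: sum.cong)
  then have meas: "grid_hit D T n \<in> borel_measurable M"
    by simp
  have bnd: "0 \<le> grid_hit D T n \<omega> \<and> grid_hit D T n \<omega> \<le> T" for \<omega>
  proof -
    have "real (grid_index (\<lambda>j. W (h * real j) \<omega> \<in> D) (2 ^ n)) \<le> 2 ^ n"
      using grid_index_le[of "\<lambda>j. W (h * real j) \<omega> \<in> D" "2 ^ n"]
      by (metis of_nat_le_iff of_nat_numeral of_nat_power)
    from mult_left_mono[OF this, of h] h
    have "h * real (grid_index (\<lambda>j. W (h * real j) \<omega> \<in> D) (2 ^ n)) \<le> h * 2 ^ n"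
      by simp
    then show ?thesis using h by (auto simp: hit hT)
  qed
  have eq: "expM a b (grid_hit D T n \<omega>) \<omega> = 1 + (\<Sum>k<2^n.
      if alive k \<omega> then expM a b (h * real (Suc k)) \<omega> - expM a b (h * real k) \<omega> else 0)"
    if "\<omega> \<in> space M" for a b \<omega>
    unfolding hit alive_def
    by (subst grid_index_telescope[where f="\<lambda>k. expM a b (h * real k) \<omega>"]) (simp add: expM_0 that)
  note step = expM_step[OF h D, folded alive_def]
  have "integrable M (\<lambda>\<omega>. expM a b (grid_hit D T n \<omega>) \<omega>)" for a b
    by (subst Bochner_Integration.integrable_cong[OF refl eq])
       (auto intro!: Bochner_Integration.integrable_add Bochner_Integration.integrable_sum step)
  moreover have "(LINT \<omega>|M. expM a b (grid_hit D T n \<omega>) \<omega>) = 1" for a b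
    by (subst Bochner_Integration.integral_cong[OF refl eq])
       (simp_all add: Bochner_Integration.integral_add Bochner_Integration.integral_sum step prob_space del:
           of_nat_Suc)
  ultimately show ?thesis
    using meas bnd by (auto simp: fair_def)
qed

end

section \<open>The exit time from the quadrant\<close>

lemma exists_dyadic_between:
  fixes p q T :: real
  assumes "0 < T" "0 \<le> p" "p < q"
  obtains m j where "1 \<le> j" "p < T / 2 ^ m * real j" "T / 2 ^ m * real j < q"
proof -
  obtain m where m: "T / (q - p) < 2 ^ m"
    using real_arch_pow[of 2 "T / (q - p)"] by auto
  define d where "d = T / 2 ^ m"
  have d: "0 < d" "d < q - p"
    using m assms by (auto simp: d_def field_simps)
  define j where "j = nat \<lfloor>p / d\<rfloor> + 1"
  have "real j = \<lfloor>p / d\<rfloor> + 1"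
    using assms d by (simp add: j_def)
  then have "p / d < real j" "real j \<le> p / d + 1" by linarith+
  then have "p < d * real j" "d * real j \<le> p + d"
    using d by (auto simp: field_simps)
  with d show ?thesis
    by (intro that[of j m]) (auto simp: d_def[symmetric] j_def)
qed

lemma closed_quadrant: "closed quadrant"
  unfolding quadrant_def by (intro closed_Times) auto

lemma open_open_quadrant: "open open_quadrant"
  unfolding open_quadrant_def by (intro open_Times) auto

lemma closed_axes: "closed axes"
  unfolding axes_def using closed_quadrant open_open_quadrant by (rule closed_Diff)

lemma borel_quadrant_sets [measurable]: "quadrant \<in> sets borel" "open_quadrant \<in> sets borel" "axes \<in> sets borel"
  using closed_quadrant open_open_quadrant closed_axes by auto

text \<open>Open sets shrinking to the complement of the open quadrant. A path may touch the axes between dyadic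
times, but it cannot enter an open set without being seen there at a dyadic time.\<close>

definition near_boundary :: "nat \<Rightarrow> (real \<times> real) set" where
  "near_boundary m = {z. min (fst z) (snd z) < 1 / real (Suc m)}"

lemma open_near_boundary: "open (near_boundary m)"
  unfolding near_boundary_def by (intro open_Collect_less continuous_intros)

lemma near_boundary_antimono: "m \<le> m' \<Longrightarrow> near_boundary m' \<subseteq> near_boundary m"
  unfolding near_boundary_def by (auto intro: less_le_trans[OF _ frac_le])

lemma closure_near_boundary: "closure (near_boundary m) \<subseteq> {z. min (fst z) (snd z) \<le> 1 / real (Suc m)}"
  by (rule closure_minimal) (auto simp: near_boundary_def intro!: closed_Collect_le continuous_intros)

lemma not_near_boundaryD: "z \<notin> near_boundary m \<Longrightarrow> z \<in> open_quadrant"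
  by (cases z) (auto simp: near_boundary_def open_quadrant_def not_less intro: less_le_trans[of _ "1 / real
      (Suc m)"])

lemma open_quadrant_iff: "z \<in> open_quadrant \<longleftrightarrow> 0 < min (fst z) (snd z)"
  by (auto simp: open_quadrant_def mem_Times_iff)

context planar_bm
begin

lemma grid_hit_bounds: "0 < T \<Longrightarrow> 0 \<le> grid_hit D T n \<omega> \<and> grid_hit D T n \<omega> \<le> T"
proof -
  assume T: "0 < T"
  have "real (grid_index (\<lambda>j. W (T / 2 ^ n * real j) \<omega> \<in> D) (2 ^ n)) \<le> 2 ^ n"
    using grid_index_le[of "\<lambda>j. W (T / 2 ^ n * real j) \<omega> \<in> D" "2 ^ n"]
    by (metis of_nat_le_iff of_nat_numeral of_nat_power)
  from mult_left_mono[OF this, of "T / 2 ^ n"] T show ?thesis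
    by (simp add: grid_hit_def)
qed

lemma grid_hit_pos: "0 < T \<Longrightarrow> 0 < grid_hit D T n \<omega>"
  unfolding grid_hit_def by (intro mult_pos_pos) (auto simp: grid_index_pos)

lemma grid_hit_in: "0 < T \<Longrightarrow> grid_hit D T n \<omega> < T \<Longrightarrow> W (grid_hit D T n \<omega>) \<omega> \<in> D"
proof -
  let ?i = "grid_index (\<lambda>j. W (T / 2 ^ n * real j) \<omega> \<in> D) (2 ^ n)"
  assume "0 < T" "grid_hit D T n \<omega> < T"
  then have "real ?i < 2 ^ n" by (simp add: grid_hit_def field_simps)
  then have "?i < 2 ^ n" by (metis of_nat_less_iff of_nat_numeral of_nat_power)
  from grid_index_hit[OF this] show ?thesis by (simp add: grid_hit_def)
qed

lemma grid_hit_not_in: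
  assumes T: "0 < T" and mn: "m \<le> n" and j: "1 \<le> j" and less: "T / 2 ^ m * real j < grid_hit D T n \<omega>"
  shows "W (T / 2 ^ m * real j) \<omega> \<notin> D"
proof -
  let ?A = "\<lambda>j. W (T / 2 ^ n * real j) \<omega> \<in> D"
  define k where "k = j * 2 ^ (n - m)"
  have k: "T / 2 ^ m * real j = T / 2 ^ n * real k"
    using mn by (simp add: k_def field_simps flip: power_add)
  have "real k < real (grid_index ?A (2 ^ n))"
    using less T unfolding k grid_hit_def by (simp add: field_simps)
  then have "k < grid_index ?A (2 ^ n)" by simp
  moreover have "1 \<le> k" using j by (simp add: k_def)
  ultimately have "\<not> ?A k"
    using less_grid_index_iff[of k "2 ^ n" ?A] grid_index_le[of ?A "2 ^ n"] by auto
  then show ?thesis unfolding k by simp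
qed

lemma grid_hit_le:
  assumes T: "0 < T" and j: "1 \<le> j" and le: "T / 2 ^ n * real j \<le> T" and D: "W (T / 2 ^ n * real j) \<omega> \<in> D"
  shows "grid_hit D T n \<omega> \<le> T / 2 ^ n * real j"
  using grid_hit_not_in[OF T order_refl j] D by (meson not_le)

lemma grid_hit_antimono_level: "0 < T \<Longrightarrow> grid_hit D T (Suc n) \<omega> \<le> grid_hit D T n \<omega>"
proof -
  assume T: "0 < T"
  let ?i = "grid_index (\<lambda>j. W (T / 2 ^ n * real j) \<omega> \<in> D) (2 ^ n)"
  have eq: "grid_hit D T n \<omega> = T / 2 ^ Suc n * real (2 * ?i)"
    by (simp add: grid_hit_def)
  show ?thesis
  proof (cases "grid_hit D T n \<omega> < T")
    case True
    have "1 \<le> 2 * ?i"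
      using grid_index_pos[of "2 ^ n" "\<lambda>j. W (T / 2 ^ n * real j) \<omega> \<in> D"] by simp
    moreover have "T / 2 ^ Suc n * real (2 * ?i) \<le> T"
      using True unfolding eq by (rule less_imp_le)
    moreover have "W (T / 2 ^ Suc n * real (2 * ?i)) \<omega> \<in> D"
      using grid_hit_in[OF T True] unfolding eq .
    ultimately show ?thesis
      unfolding eq by (rule grid_hit_le[OF T])
  qed (use grid_hit_bounds[OF T, of D "Suc n" \<omega>] in auto)
qed

lemma grid_hit_antimono_set:
  assumes T: "0 < T" and DD': "D \<subseteq> D'" shows "grid_hit D' T n \<omega> \<le> grid_hit D T n \<omega>"
proof (cases "grid_hit D T n \<omega> < T")
  case True
  then show ?thesis
    using grid_hit_in[OF T True] DD' grid_index_pos[of "2 ^ n" "\<lambda>j. W (T / 2 ^ n * real j) \<omega> \<in> D"]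
    unfolding grid_hit_def[of D] by (intro grid_hit_le T) auto
qed (use grid_hit_bounds[OF T, of D' n \<omega>] in auto)

definition hit :: "(real \<times> real) set \<Rightarrow> real \<Rightarrow> 'a \<Rightarrow> real" where
  "hit D T \<omega> = (INF n. grid_hit D T n \<omega>)"

lemma grid_hit_tendsto: "0 < T \<Longrightarrow> (\<lambda>n. grid_hit D T n \<omega>) \<longlonglongrightarrow> hit D T \<omega>"
  unfolding hit_def using grid_hit_bounds[of T D _ \<omega>]
  by (intro LIMSEQ_decseq_INF decseq_SucI grid_hit_antimono_level) (auto intro!: bdd_belowI[where m=0])

lemma fair_hit: "0 < T \<Longrightarrow> D \<in> sets borel \<Longrightarrow> fair T (hit D T)"
  by (rule fair_limit[OF fair_grid_hit grid_hit_tendsto])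

lemma hit_le_grid_hit: "0 < T \<Longrightarrow> hit D T \<omega> \<le> grid_hit D T n \<omega>"
  using grid_hit_tendsto[of T D \<omega>] decseq_ge[of "\<lambda>n. grid_hit D T n \<omega>"] grid_hit_antimono_level[of T D _ \<omega>]
  by (auto intro: decseq_SucI)

lemma hit_bounds: "0 < T \<Longrightarrow> 0 \<le> hit D T \<omega> \<and> hit D T \<omega> \<le> T"
  using LIMSEQ_le_const[OF grid_hit_tendsto, of T 0 D \<omega>] LIMSEQ_le_const2[OF grid_hit_tendsto, of T D \<omega> T]
    grid_hit_bounds[of T D _ \<omega>] by auto

lemma hit_antimono_set: "0 < T \<Longrightarrow> D \<subseteq> D' \<Longrightarrow> hit D' T \<omega> \<le> hit D T \<omega>"
  by (rule LIMSEQ_le[OF grid_hit_tendsto grid_hit_tendsto]) (auto intro: grid_hit_antimono_set)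

text \<open>No dyadic time before the limit hits \<open>D\<close>; dyadic times are dense and the path is continuous.\<close>

lemma W_before_hit:
  assumes T: "0 < T" and \<omega>: "\<omega> \<in> space M" and t: "0 \<le> t" "t \<le> hit D T \<omega>" and pos: "0 < hit D T \<omega>"
  shows "W t \<omega> \<in> closure (- D)"
proof (rule ccontr)
  assume "W t \<omega> \<notin> closure (- D)"
  then have "W t \<omega> \<in> - closure (- D)" by simp
  moreover have "open (- closure (- D))" by auto
  ultimately obtain e where e: "0 < e" "\<And>z. dist z (W t \<omega>) < e \<Longrightarrow> z \<notin> closure (- D)"
    unfolding open_dist by blast
  from continuous_W[OF \<omega>] t e(1) obtain \<delta> where \<delta>: "0 < \<delta>"
    "\<And>s. 0 \<le> s \<Longrightarrow> dist s t < \<delta> \<Longrightarrow> dist (W s \<omega>) (W t \<omega>) < e"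
    unfolding continuous_on_iff by (metis atLeast_iff)
  define p q where "p = max 0 (t - \<delta>)" and "q = min (hit D T \<omega>) (t + \<delta>)"
  have pq: "0 \<le> p" "p < q" using t pos \<delta>(1) by (auto simp: p_def q_def)
  from exists_dyadic_between[OF T pq] obtain m j where
    j: "1 \<le> j" "p < T / 2 ^ m * real j" "T / 2 ^ m * real j < q" .
  let ?s = "T / 2 ^ m * real j"
  have "?s < grid_hit D T m \<omega>"
    using j(3) hit_le_grid_hit[OF T, of D \<omega> m] by (auto simp: q_def)
  then have "W ?s \<omega> \<notin> D"
    by (rule grid_hit_not_in[OF T order_refl j(1)])
  then have "W ?s \<omega> \<in> closure (- D)"
    using closure_subset[of "- D"] by auto
  moreover have "dist (W ?s \<omega>) (W t \<omega>) < e"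
    using j pq by (intro \<delta>(2)) (auto simp: p_def q_def dist_real_def)
  ultimately show False using e(2) by auto
qed

lemma W_at_hit:
  assumes T: "0 < T" and \<omega>: "\<omega> \<in> space M" and less: "hit D T \<omega> < T"
  shows "W (hit D T \<omega>) \<omega> \<in> closure D"
proof -
  have "(\<lambda>n. W (grid_hit D T n \<omega>) \<omega>) \<longlonglongrightarrow> W (hit D T \<omega>) \<omega>"
    using continuous_on_tendsto_compose[OF continuous_W[OF \<omega>] grid_hit_tendsto[OF T, of D \<omega>]]
      hit_bounds[OF T, of D \<omega>] grid_hit_bounds[OF T, of D _ \<omega>] by auto
  moreover have "\<forall>\<^sub>F n in sequentially. W (grid_hit D T n \<omega>) \<omega> \<in> closure D"
    using order_tendstoD(2)[OF grid_hit_tendsto[OF T, of D \<omega>] less]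
    by eventually_elim (intro subsetD[OF closure_subset] grid_hit_in T)
  ultimately show ?thesis
    by (intro Lim_in_closed_set[of "closure D" _ sequentially]) auto
qed

lemma exit_time_le: "0 < t \<Longrightarrow> W t \<omega> \<notin> open_quadrant \<Longrightarrow> exit_time W \<omega> \<le> ennreal t"
  unfolding exit_time_def by (intro INF_lower) auto

lemma exit_time_ge: "(\<And>t. 0 < t \<Longrightarrow> ennreal t < s \<Longrightarrow> W t \<omega> \<in> open_quadrant) \<Longrightarrow> s \<le> exit_time W \<omega>"
  unfolding exit_time_def by (intro INF_greatest) (auto simp: not_less[symmetric])

lemma before_exit_time: "0 < t \<Longrightarrow> ennreal t < exit_time W \<omega> \<Longrightarrow> W t \<omega> \<in> open_quadrant"
  using exit_time_le[of t \<omega>] by (meson leD)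

text \<open>On a compact interval a path inside the open quadrant keeps a positive distance from the axes, so
countably many conditions at rational times decide whether the path has left. The absolute value keeps the
time argument nonnegative, as \<open>W\<close> is constrained at nonnegative times only.\<close>

lemma exit_time_ge_iff:
  assumes \<omega>: "\<omega> \<in> space M"
  shows "s \<le> exit_time W \<omega> \<longleftrightarrow> (\<forall>p q::rat. 0 < p \<and> p < q \<and> ennreal (of_rat q) < s \<longrightarrow>
     (\<exists>m. \<forall>r::rat. p \<le> r \<and> r \<le> q \<longrightarrow> W (\<bar>of_rat r\<bar>) \<omega> \<notin> near_boundary m))" (is "_ \<longleftrightarrow> ?R")
proof
  assume s: "s \<le> exit_time W \<omega>"
  show ?R
  proof safe
    fix p q :: rat assume pq: "0 < p" "p < q" "ennreal (of_rat q) < s"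
    let ?I = "{of_rat p..of_rat q :: real}"
    have pq': "0 < (of_rat p :: real)" "of_rat p < (of_rat q :: real)" using pq by (auto simp: of_rat_less)
    have cont: "continuous_on ?I (\<lambda>t. min (fst (W t \<omega>)) (snd (W t \<omega>)))"
      using pq' by (intro continuous_intros continuous_on_subset[OF continuous_W[OF \<omega>]]) auto
    obtain t where t: "t \<in> ?I" "\<And>u. u \<in> ?I \<Longrightarrow> min (fst (W t \<omega>)) (snd (W t \<omega>)) \<le> min (fst (W u \<omega>)) (snd (W u \<omega>))"
      using continuous_attains_inf[OF _ _ cont] pq' by auto
    have "ennreal t \<le> ennreal (of_rat q)" using t(1) by (intro ennreal_leI) auto
    also have "\<dots> < exit_time W \<omega>" using pq(3) s by simp
    finally have te: "ennreal t < exit_time W \<omega>" .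
    have "of_rat p \<le> t" using t(1) by simp
    then have "0 < t" using pq'(1) by linarith
    from before_exit_time[OF this te] have "0 < min (fst (W t \<omega>)) (snd (W t \<omega>))"
      unfolding open_quadrant_iff .
    then obtain m where "1 / real (Suc m) < min (fst (W t \<omega>)) (snd (W t \<omega>))"
      using nat_approx_posE by blast
    then have "W (\<bar>of_rat r\<bar>) \<omega> \<notin> near_boundary m" if "p \<le> r" "r \<le> q" for r
      using t(2)[of "of_rat r"] that pq' by (auto simp: near_boundary_def of_rat_less_eq)
    then show "\<exists>m. \<forall>r. p \<le> r \<and> r \<le> q \<longrightarrow> W (\<bar>of_rat r\<bar>) \<omega> \<notin> near_boundary m" by blast
  qed
next
  assume R: ?R
  show "s \<le> exit_time W \<omega>"
  proof (rule exit_time_ge)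
    fix t assume t: "0 < t" "ennreal t < s"
    obtain u where u: "ennreal t < ennreal u" "ennreal u < s" "0 \<le> u"
      using t(2) dense[of "ennreal t" s]
          by (metis ennreal_cases order_less_imp_not_less top.not_eq_extremum top.extremum_strict)
    have tu: "t < u" using u t by (simp add: ennreal_less_iff)
    obtain p where p: "0 < (of_rat p :: real)" "of_rat p < t" using of_rat_dense[OF t(1)] by blast
    obtain q where q: "t < of_rat q" "of_rat q < u" using of_rat_dense[OF tu] by blast
    have "(of_rat p :: real) < of_rat q" using p q by linarith
    then have "0 < p" "p < q" using p(1) by (simp_all add: of_rat_less)
    moreover have "ennreal (of_rat q) < s"
      by (rule le_less_trans[OF ennreal_leI u(2)]) (use q in simp)
    ultimately obtain m where m: "\<And>r. p \<le> r \<Longrightarrow> r \<le> q \<Longrightarrow> W (\<bar>of_rat r\<bar>) \<omega> \<notin> near_boundary m"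
      using R by blast
    have "W t \<omega> \<notin> near_boundary m"
    proof
      assume "W t \<omega> \<in> near_boundary m"
      then obtain e where e: "0 < e" "\<And>z. dist z (W t \<omega>) < e \<Longrightarrow> z \<in> near_boundary m"
        using open_near_boundary[of m] unfolding open_dist by blast
      from continuous_W[OF \<omega>] t e(1) obtain \<delta> where \<delta>: "0 < \<delta>"
        "\<And>s. 0 \<le> s \<Longrightarrow> dist s t < \<delta> \<Longrightarrow> dist (W s \<omega>) (W t \<omega>) < e"
        unfolding continuous_on_iff by (metis atLeast_iff less_imp_le)
      have "t < min (of_rat q) (t + \<delta>)" using q \<delta> by auto
      from of_rat_dense[OF this] obtain r where r: "t < of_rat r" "of_rat r < min (of_rat q) (t + \<delta>)" by blast
      then have "(of_rat p :: real) \<le> of_rat r" "(of_rat r :: real) \<le> of_rat q" using p q by linarith+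
      then have "p \<le> r" "r \<le> q" by (simp_all add: of_rat_less_eq)
      then have "W \<bar>of_rat r\<bar> \<omega> \<notin> near_boundary m" by (rule m)
      moreover have "\<bar>of_rat r :: real\<bar> = of_rat r" using r t by linarith
      moreover have "W (of_rat r) \<omega> \<in> near_boundary m"
        using r t by (intro e(2) \<delta>(2)) (auto simp: dist_real_def simp del: zero_le_of_rat_iff)
      ultimately show False by simp
    qed
    then show "W t \<omega> \<in> open_quadrant" by (rule not_near_boundaryD)
  qed
qed

lemma measurable_exit_time [measurable]: "exit_time W \<in> borel_measurable M"
proof (rule borel_measurableI_ge)
  fix s :: ennreal
  have [measurable]: "near_boundary m \<in> sets borel" for m using open_near_boundary by auto
  have "Measurable.pred M (\<lambda>\<omega>. \<forall>p q::rat. 0 < p \<and> p < q \<and> ennreal (of_rat q) < s \<longrightarrow>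
     (\<exists>m. \<forall>r::rat. p \<le> r \<and> r \<le> q \<longrightarrow> W (\<bar>of_rat r\<bar>) \<omega> \<notin> near_boundary m))"
    by measurable
  moreover have "{\<omega> \<in> space M. s \<le> exit_time W \<omega>}
      = {\<omega> \<in> space M. \<forall>p q::rat. 0 < p \<and> p < q \<and> ennreal (of_rat q) < s \<longrightarrow>
     (\<exists>m. \<forall>r::rat. p \<le> r \<and> r \<le> q \<longrightarrow> W (\<bar>of_rat r\<bar>) \<omega> \<notin> near_boundary m)}"
    using exit_time_ge_iff[of _ s] by blast
  ultimately show "{\<omega> \<in> space M. s \<le> exit_time W \<omega>} \<in> sets M"
    by (simp add: pred_def)
qed

definition exit_pos :: "'a \<Rightarrow> real \<times> real" where
  "exit_pos \<omega> = W (enn2real (exit_time W \<omega>)) \<omega>"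

lemma measurable_exit_pos [measurable]: "exit_pos \<in> borel_measurable M"
  unfolding exit_pos_def by measurable

lemma exit_law_eq: "exit_law M W = distr M borel exit_pos"
  by (simp add: exit_law_def exit_pos_def[abs_def])

end

section \<open>The exit position\<close>

lemma open_quadrant_subset: "open_quadrant \<subseteq> quadrant"
  by (auto simp: open_quadrant_def quadrant_def)

context planar_bm
begin

lemma Re_expM_of_real:
  "Re (expM (of_real a) (of_real b) t \<omega>)
     = exp (a * (fst (W t \<omega>) - fst x) + b * (snd (W t \<omega>) - snd x) - (a\<^sup>2 + b\<^sup>2) / 2 * t)"
proof -
  have "expM (of_real a) (of_real b) t \<omega>
     = of_real (exp (a * (fst (W t \<omega>) - fst x) + b * (snd (W t \<omega>) - snd x) - (a\<^sup>2 + b\<^sup>2) / 2 * t))"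
    unfolding expM_def exp_functional_def exp_of_real[symmetric] exp_add[symmetric]
    by (simp add: algebra_simps)
  then show ?thesis by simp
qed

text \<open>Brownian motion started on the axes leaves at once. Up to the limit \<open>h\<close> of the dyadic hitting times of
the complement the path stays in the closed quadrant, so the exponential martingale that charges a vanishing
coordinate of \<open>x\<close> is at most 1 at time \<open>h\<close>. Its mean is 1, so it is 1 almost surely, and its time factor
then forces \<open>h = 0\<close>.\<close>

lemma exit_time_axis:
  assumes x: "x \<in> axes"
  shows "AE \<omega> in M. exit_time W \<omega> = 0"
proof -
  define D where "D = - open_quadrant"
  have D: "D \<in> sets borel" by (auto simp: D_def)
  define h where "h = hit D 1"
  have h: "0 \<le> h \<omega>" "h \<omega> \<le> 1" for \<omega>
    unfolding h_def using hit_bounds[of 1 D \<omega>] by auto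
  have fair: "fair 1 h" unfolding h_def by (rule fair_hit) (use D in auto)
  have xq: "x \<in> quadrant" using x by (simp add: axes_def)
  \<comment> \<open>The exponent charges a coordinate that vanishes at \<open>x\<close>.\<close>
  obtain a b :: real where ab: "a \<le> 0" "b \<le> 0" "0 < a\<^sup>2 + b\<^sup>2" "a * fst x + b * snd x = 0"
  proof (cases "fst x = 0")
    case True
    then show ?thesis by (intro that[of "-1" 0]) auto
  next
    case False
    then have "snd x = 0"
      using x by (auto simp: axes_def quadrant_def open_quadrant_def)
    then show ?thesis by (intro that[of 0 "-1"]) auto
  qed
  define E where "E \<omega> = a * fst (W (h \<omega>) \<omega>) + b * snd (W (h \<omega>) \<omega>) - (a\<^sup>2 + b\<^sup>2) / 2 * h \<omega>" for \<omega>
  have ReE: "Re (expM (of_real a) (of_real b) (h \<omega>) \<omega>) = exp (E \<omega>)" for \<omega>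
    unfolding Re_expM_of_real E_def using ab(4) by (simp add: algebra_simps)
  have E_le: "E \<omega> \<le> 0" "E \<omega> = 0 \<Longrightarrow> h \<omega> = 0" if \<omega>: "\<omega> \<in> space M" for \<omega>
  proof -
    have "W (h \<omega>) \<omega> \<in> quadrant"
    proof (cases "h \<omega> = 0")
      case False
      then have "W (h \<omega>) \<omega> \<in> closure (- D)"
        unfolding h_def using h[of \<omega>] by (intro W_before_hit \<omega>) (auto simp: h_def)
      moreover have "closure (- D) \<subseteq> quadrant"
        by (rule closure_minimal[OF _ closed_quadrant]) (auto simp: D_def open_quadrant_def quadrant_def)
      ultimately show ?thesis by auto
    qed (use xq W_0[OF \<omega>] in simp)
    then have "a * fst (W (h \<omega>) \<omega>) \<le> 0" "b * snd (W (h \<omega>) \<omega>) \<le> 0"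
      using ab by (auto simp: quadrant_def mem_Times_iff intro: mult_nonpos_nonneg)
    moreover have "0 \<le> (a\<^sup>2 + b\<^sup>2) / 2 * h \<omega>" using h[of \<omega>] by simp
    moreover have "h \<omega> = 0" if "(a\<^sup>2 + b\<^sup>2) / 2 * h \<omega> = 0" using that ab(3) by auto
    ultimately show "E \<omega> \<le> 0" "E \<omega> = 0 \<Longrightarrow> h \<omega> = 0" unfolding E_def by linarith+
  qed
  have int: "integrable M (\<lambda>\<omega>. expM (of_real a) (of_real b) (h \<omega>) \<omega>)"
    and one: "(LINT \<omega>|M. expM (of_real a) (of_real b) (h \<omega>) \<omega>) = 1"
    using fair by (auto simp: fair_def)
  have "(LINT \<omega>|M. exp (E \<omega>)) = Re (LINT \<omega>|M. expM (of_real a) (of_real b) (h \<omega>) \<omega>)"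
    unfolding ReE[symmetric] using int by simp
  then have one': "(LINT \<omega>|M. exp (E \<omega>)) = 1" by (simp add: one)
  have int': "integrable M (\<lambda>\<omega>. exp (E \<omega>))"
    unfolding ReE[symmetric] using int by (rule integrable_Re)
  have "(LINT \<omega>|M. 1 - exp (E \<omega>)) = 0"
    using int' one' by (simp add: prob_space)
  moreover have "AE \<omega> in M. 0 \<le> 1 - exp (E \<omega>)"
    using E_le(1) by (intro AE_I2) auto
  ultimately have "AE \<omega> in M. 1 - exp (E \<omega>) = 0"
    using integral_nonneg_eq_0_iff_AE[of M "\<lambda>\<omega>. 1 - exp (E \<omega>)"] int' by simp
  then have "AE \<omega> in M. h \<omega> = 0"
    using AE_space by eventually_elim (use E_le(2) in auto)
  then show ?thesis
    using AE_space
  proof eventually_elim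
    fix \<omega> assume h0: "h \<omega> = 0" and "\<omega> \<in> space M"
    have lim: "(\<lambda>n. grid_hit D 1 n \<omega>) \<longlonglongrightarrow> 0"
      using grid_hit_tendsto[of 1 D \<omega>] h0 by (simp add: h_def)
    have "\<forall>\<^sub>F n in sequentially. exit_time W \<omega> \<le> ennreal (grid_hit D 1 n \<omega>)"
      using order_tendstoD(2)[OF lim, of 1, simplified]
    proof eventually_elim
      fix n assume "grid_hit D 1 n \<omega> < 1"
      then show "exit_time W \<omega> \<le> ennreal (grid_hit D 1 n \<omega>)"
        using grid_hit_in[of 1 D n \<omega>] by (intro exit_time_le grid_hit_pos) (auto simp: D_def)
    qed
    then have "exit_time W \<omega> \<le> ennreal 0"
      by (intro tendsto_le[OF _ tendsto_ennrealI[OF lim] tendsto_const]) auto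
    then show "exit_time W \<omega> = 0" by simp
  qed
qed

text \<open>The limiting hitting times of the sets \<open>near_boundary m\<close> increase with \<open>m\<close> to the exit time, cut off at
\<open>T\<close>: up to each of them the path is inside the open quadrant, and at their limit, if it is less than \<open>T\<close>,
the path is outside.\<close>

lemma truncated_exit_time:
  assumes x: "x \<in> open_quadrant" and T: "0 < T"
  obtains \<rho> where "fair T \<rho>" "\<And>\<omega>. \<omega> \<in> space M \<Longrightarrow> ennreal (\<rho> \<omega>) = min (exit_time W \<omega>) (ennreal T)"
    "\<And>\<omega>. \<omega> \<in> space M \<Longrightarrow> W (\<rho> \<omega>) \<omega> \<in> quadrant"
    "\<And>\<omega>. \<omega> \<in> space M \<Longrightarrow> \<rho> \<omega> < T \<Longrightarrow> W (\<rho> \<omega>) \<omega> \<notin> open_quadrant"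
proof -
  define h where "h m = hit (near_boundary m) T" for m
  define \<rho> where "\<rho> \<omega> = (SUP m. h m \<omega>)" for \<omega>
  have h: "0 \<le> h m \<omega>" "h m \<omega> \<le> T" for m \<omega>
    using hit_bounds[OF T, of "near_boundary m" \<omega>] by (auto simp: h_def)
  have lim: "(\<lambda>m. h m \<omega>) \<longlonglongrightarrow> \<rho> \<omega>" for \<omega>
    unfolding \<rho>_def
  proof (rule LIMSEQ_incseq_SUP)
    show "bdd_above (range (\<lambda>m. h m \<omega>))" using h by (auto intro!: bdd_aboveI[where M=T])
    show "incseq (\<lambda>m. h m \<omega>)"
      unfolding h_def by (intro incseq_SucI hit_antimono_set T near_boundary_antimono) auto
  qed
  have h_le: "h m \<omega> \<le> \<rho> \<omega>" for m \<omega>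
    unfolding \<rho>_def using h by (intro cSUP_upper) (auto intro!: bdd_aboveI[where M=T])
  have fair: "fair T \<rho>"
  proof (rule fair_limit[OF _ lim])
    show "fair T (h n)" for n
      unfolding h_def using open_near_boundary by (intro fair_hit T) auto
  qed
  have \<rho>: "0 \<le> \<rho> \<omega>" "\<rho> \<omega> \<le> T" if "\<omega> \<in> space M" for \<omega>
    using fair that by (auto simp: fair_def)
  have before: "W t \<omega> \<in> open_quadrant" if \<omega>: "\<omega> \<in> space M" and t: "0 \<le> t" "t \<le> h m \<omega>" for t m \<omega>
  proof (cases "h m \<omega> = 0")
    case True
    then show ?thesis using t W_0[OF \<omega>] x by simp
  next
    case False
    then have "W t \<omega> \<in> closure (- near_boundary m)"
      using t h[of m \<omega>] unfolding h_def by (intro W_before_hit \<omega> T) auto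
    also have "closure (- near_boundary m) = - near_boundary m"
      using open_near_boundary by (simp add: closed_Compl)
    finally show ?thesis by (intro not_near_boundaryD[of _ m]) auto
  qed
  have lim_W: "(\<lambda>m. W (h m \<omega>) \<omega>) \<longlonglongrightarrow> W (\<rho> \<omega>) \<omega>" if \<omega>: "\<omega> \<in> space M" for \<omega>
    using continuous_on_tendsto_compose[OF continuous_W[OF \<omega>] lim] \<rho>[OF \<omega>] h by auto
  have not_open: "W (\<rho> \<omega>) \<omega> \<notin> open_quadrant" if \<omega>: "\<omega> \<in> space M" and less: "\<rho> \<omega> < T" for \<omega>
  proof -
    have le: "min (fst (W (h m \<omega>) \<omega>)) (snd (W (h m \<omega>) \<omega>)) \<le> 1 / real (Suc m)" for m
    proof -
      have "W (h m \<omega>) \<omega> \<in> closure (near_boundary m)"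
        unfolding h_def using h_le[of m \<omega>] less by (intro W_at_hit T \<omega>) (auto simp: h_def)
      then show ?thesis using closure_near_boundary by blast
    qed
    have "min (fst (W (\<rho> \<omega>) \<omega>)) (snd (W (\<rho> \<omega>) \<omega>)) \<le> 0"
    proof (rule LIMSEQ_le)
      show "(\<lambda>m. min (fst (W (h m \<omega>) \<omega>)) (snd (W (h m \<omega>) \<omega>))) \<longlonglongrightarrow> min (fst (W (\<rho> \<omega>) \<omega>)) (snd (W (\<rho> \<omega>) \<omega>))"
        by (intro tendsto_intros lim_W \<omega>)
      show "(\<lambda>m. 1 / real (Suc m)) \<longlonglongrightarrow> 0"
        by (rule LIMSEQ_Suc[OF lim_1_over_n])
    qed (use le in blast)
    then show ?thesis by (auto simp: open_quadrant_iff min_def split: if_splits)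
  qed
  have "ennreal (\<rho> \<omega>) = min (exit_time W \<omega>) (ennreal T)" if \<omega>: "\<omega> \<in> space M" for \<omega>
  proof (rule antisym)
    have "ennreal (\<rho> \<omega>) \<le> exit_time W \<omega>"
    proof (rule exit_time_ge)
      fix t assume t: "0 < t" "ennreal t < ennreal (\<rho> \<omega>)"
      then have "t < \<rho> \<omega>" by (simp add: ennreal_less_iff)
      from order_tendstoD(1)[OF lim this] obtain m where "t < h m \<omega>"
        by (auto simp: eventually_sequentially)
      then show "W t \<omega> \<in> open_quadrant" using before[OF \<omega>, of t m] t by auto
    qed
    then show "ennreal (\<rho> \<omega>) \<le> min (exit_time W \<omega>) (ennreal T)"
      using \<rho>[OF \<omega>] by (auto intro: ennreal_leI)
    show "min (exit_time W \<omega>) (ennreal T) \<le> ennreal (\<rho> \<omega>)"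
    proof (cases "\<rho> \<omega> < T")
      case True
      then have "W (\<rho> \<omega>) \<omega> \<notin> open_quadrant" by (rule not_open[OF \<omega>])
      moreover from this have "\<rho> \<omega> \<noteq> 0" using W_0[OF \<omega>] x by auto
      ultimately have "exit_time W \<omega> \<le> ennreal (\<rho> \<omega>)"
        using \<rho>[OF \<omega>] by (intro exit_time_le) auto
      then show ?thesis by (rule min.coboundedI1)
    next
      case False
      then show ?thesis by (intro min.coboundedI2 ennreal_leI) auto
    qed
  qed
  moreover have "W (\<rho> \<omega>) \<omega> \<in> quadrant" if \<omega>: "\<omega> \<in> space M" for \<omega>
  proof (rule Lim_in_closed_set[OF closed_quadrant _ _ lim_W[OF \<omega>]])
    show "\<forall>\<^sub>F m in sequentially. W (h m \<omega>) \<omega> \<in> quadrant"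
      by (intro always_eventually allI subsetD[OF open_quadrant_subset] before[OF \<omega> h(1) order_refl])
  qed simp
  ultimately show ?thesis using fair not_open by (intro that[of \<rho>]) auto
qed

lemma truncated_exit_times:
  assumes x: "x \<in> open_quadrant"
  obtains \<rho> :: "nat \<Rightarrow> 'a \<Rightarrow> real" where "\<And>n. fair (real (Suc n)) (\<rho> n)"
    "\<And>n \<omega>. \<omega> \<in> space M \<Longrightarrow> W (\<rho> n \<omega>) \<omega> \<in> quadrant"
    "\<And>n \<omega>. \<omega> \<in> space M \<Longrightarrow> \<rho> n \<omega> < real (Suc n) \<Longrightarrow> W (\<rho> n \<omega>) \<omega> \<notin> open_quadrant"
    "\<And>\<omega>. \<omega> \<in> space M \<Longrightarrow> exit_time W \<omega> < \<infinity> \<Longrightarrow>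
       \<forall>\<^sub>F n in sequentially. \<rho> n \<omega> = enn2real (exit_time W \<omega>) \<and> \<rho> n \<omega> < real (Suc n)"
    "\<And>n \<omega>. \<omega> \<in> space M \<Longrightarrow> \<not> exit_time W \<omega> < \<infinity> \<Longrightarrow> \<rho> n \<omega> = real (Suc n)"
proof -
  have "\<exists>\<rho>. fair (Suc n) \<rho> \<and> (\<forall>\<omega>\<in>space M. ennreal (\<rho> \<omega>) = min (exit_time W \<omega>) (ennreal (Suc n))
     \<and> W (\<rho> \<omega>) \<omega> \<in> quadrant \<and> (\<rho> \<omega> < Suc n \<longrightarrow> W (\<rho> \<omega>) \<omega> \<notin> open_quadrant))" for n
    using truncated_exit_time[OF x, of "Suc n"] by (metis of_nat_0_less_iff zero_less_Suc)
  then obtain \<rho> where fair: "\<And>n. fair (Suc n) (\<rho> n)"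
    and \<rho>: "\<And>n \<omega>. \<omega> \<in> space M \<Longrightarrow> ennreal (\<rho> n \<omega>) = min (exit_time W \<omega>) (ennreal (Suc n))"
    and quad: "\<And>n \<omega>. \<omega> \<in> space M \<Longrightarrow> W (\<rho> n \<omega>) \<omega> \<in> quadrant"
    and out: "\<And>n \<omega>. \<omega> \<in> space M \<Longrightarrow> \<rho> n \<omega> < Suc n \<Longrightarrow> W (\<rho> n \<omega>) \<omega> \<notin> open_quadrant"
    by metis
  have nn: "0 \<le> \<rho> n \<omega>" if "\<omega> \<in> space M" for n \<omega> using fair[of n] that by (simp add: fair_def)
  have ev: "\<forall>\<^sub>F n in sequentially. \<rho> n \<omega> = enn2real (exit_time W \<omega>) \<and> \<rho> n \<omega> < Suc n"
    if "\<omega> \<in> space M" "exit_time W \<omega> < \<infinity>" for \<omega>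
  proof -
    have "exit_time W \<omega> \<noteq> top" using that by auto
    then obtain r where r: "exit_time W \<omega> = ennreal r" "0 \<le> r" by (cases "exit_time W \<omega>") auto
    obtain N where "r < real N" using reals_Archimedean2 by blast
    have "\<rho> n \<omega> = r \<and> \<rho> n \<omega> < Suc n" if "N \<le> n" for n
    proof -
      have "ennreal (\<rho> n \<omega>) = ennreal r"
        unfolding \<rho>[OF \<open>\<omega> \<in> space M\<close>] r using \<open>r < real N\<close> that by (intro min_absorb1 ennreal_leI) auto
      then show ?thesis using nn[OF \<open>\<omega> \<in> space M\<close>] r(2) \<open>r < real N\<close> that by auto
    qed
    then show ?thesis using r by (auto simp: eventually_sequentially)
  qed
  have inf: "\<rho> n \<omega> = Suc n" if "\<omega> \<in> space M" "\<not> exit_time W \<omega> < \<infinity>" for n \<omega>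
  proof -
    have top: "exit_time W \<omega> = top" using that(2) by (simp add: less_top[symmetric])
    have "ennreal (\<rho> n \<omega>) = ennreal (Suc n)"
      unfolding \<rho>[OF that(1)] top by (rule min_absorb2) simp
    then show ?thesis using nn[OF that(1), of n] by (simp del: of_nat_Suc)
  qed
  show ?thesis by (rule that[OF fair quad out ev inf])
qed

text \<open>The martingale \<open>exp (- l (W\<^sub>1 - x\<^sub>1) - l\<^sup>2 t / 2)\<close> is bounded while the first coordinate is nonnegative
and tends to 0 along paths that never leave. Optional stopping in the limit of large times therefore gives
mean 1 on the event of leaving, and letting \<open>l\<close> tend to 0 turns this mean into the probability of the
event.\<close>

lemma exit_time_finite:
  assumes x: "x \<in> open_quadrant"
  shows "AE \<omega> in M. exit_time W \<omega> < \<infinity>"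
proof -
  obtain \<rho> :: "nat \<Rightarrow> 'a \<Rightarrow> real" where fair: "\<And>n. fair (real (Suc n)) (\<rho> n)"
    and quad: "\<And>n \<omega>. \<omega> \<in> space M \<Longrightarrow> W (\<rho> n \<omega>) \<omega> \<in> quadrant"
    and out: "\<And>n \<omega>. \<omega> \<in> space M \<Longrightarrow> \<rho> n \<omega> < real (Suc n) \<Longrightarrow> W (\<rho> n \<omega>) \<omega> \<notin> open_quadrant"
    and ev': "\<And>\<omega>. \<omega> \<in> space M \<Longrightarrow> exit_time W \<omega> < \<infinity> \<Longrightarrow>
       \<forall>\<^sub>F n in sequentially. \<rho> n \<omega> = enn2real (exit_time W \<omega>) \<and> \<rho> n \<omega> < real (Suc n)"
    and inf': "\<And>n \<omega>. \<omega> \<in> space M \<Longrightarrow> \<not> exit_time W \<omega> < \<infinity> \<Longrightarrow> \<rho> n \<omega> = real (Suc n)"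
    using that by (rule truncated_exit_times[OF x])
  have [measurable]: "\<rho> n \<in> borel_measurable M" for n using fair[of n] by (simp add: fair_def)
  have nn: "0 \<le> \<rho> n \<omega>" if "\<omega> \<in> space M" for n \<omega> using fair[of n] that by (simp add: fair_def)
  define fin where "fin \<omega> \<longleftrightarrow> exit_time W \<omega> < \<infinity>" for \<omega>
  have ev: "\<forall>\<^sub>F n in sequentially. \<rho> n \<omega> = enn2real (exit_time W \<omega>)" if "\<omega> \<in> space M" "fin \<omega>" for \<omega>
    using ev'[OF that(1)] that(2) unfolding fin_def by (auto elim: eventually_mono)
  have inf: "\<rho> n \<omega> = Suc n" if "\<omega> \<in> space M" "\<not> fin \<omega>" for n \<omega>
    using inf' that unfolding fin_def by blast
  define g where "g l n \<omega> = exp (- l * (fst (W (\<rho> n \<omega>) \<omega>) - fst x) - l\<^sup>2 / 2 * \<rho> n \<omega>)" for l :: real and n \<omega>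
  define G where "G l \<omega> = (if fin \<omega> then exp (- l * (fst (exit_pos \<omega>) - fst x) - l\<^sup>2 / 2 * enn2real
      (exit_time W \<omega>)) else 0)"
    for l :: real and \<omega>
  have fst_meas: "(\<lambda>\<omega>. fst (Y \<omega>)) \<in> borel_measurable M" if "Y \<in> borel_measurable M" for Y :: "'a \<Rightarrow> real \<times> real"
    by (rule borel_measurable_continuous_on[OF _ that]) (intro continuous_intros)
  have [measurable]: "(\<lambda>\<omega>. fst (exit_pos \<omega>)) \<in> borel_measurable M"
    by (intro fst_meas measurable_exit_pos)
  have [measurable]: "(\<lambda>\<omega>. fst (W (\<rho> n \<omega>) \<omega>)) \<in> borel_measurable M" for n
    by (intro fst_meas measurable_W_at) (use nn in auto)
  have [measurable]: "{\<omega> \<in> space M. fin \<omega>} \<in> sets M" unfolding fin_def by measurable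
  have [measurable]: "G l \<in> borel_measurable M" for l unfolding G_def[abs_def] by measurable
  have g_meas [measurable]: "g l n \<in> borel_measurable M" for l n unfolding g_def[abs_def] by measurable
  have g_bound: "g l n \<omega> \<le> exp (l * fst x) * exp (- (l\<^sup>2 / 2 * \<rho> n \<omega>))" if "0 \<le> l" "\<omega> \<in> space M" for l n \<omega>
    unfolding g_def exp_add[symmetric] using quad[OF that(2), of n] that(1)
    by (auto simp: quadrant_def mem_Times_iff algebra_simps)
  have g_le: "g l n \<omega> \<le> exp (l * fst x)" if "0 \<le> l" "\<omega> \<in> space M" for l n \<omega>
    by (rule order_trans[OF g_bound[OF that]]) (use nn[OF that(2), of n] in \<open>auto intro!: mult_left_le\<close>)
  have Eg: "(LINT \<omega>|M. g l n \<omega>) = 1" for l n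
  proof -
    have eq: "g l n \<omega> = Re (expM (of_real (- l)) (of_real 0) (\<rho> n \<omega>) \<omega>)" for \<omega>
      unfolding Re_expM_of_real g_def by simp
    have "integrable M (\<lambda>\<omega>. expM (of_real (- l)) (of_real 0) (\<rho> n \<omega>) \<omega>)"
      "(LINT \<omega>|M. expM (of_real (- l)) (of_real 0) (\<rho> n \<omega>) \<omega>) = 1"
      using fair[of n] unfolding fair_def by blast+
    then show ?thesis unfolding eq by (subst integral_Re) auto
  qed
  have g_lim: "(\<lambda>n. g l n \<omega>) \<longlonglongrightarrow> G l \<omega>" if l: "0 < l" and \<omega>: "\<omega> \<in> space M" for l \<omega>
  proof (cases "fin \<omega>")
    case True
    show ?thesis
      by (rule tendsto_eventually, use ev[OF \<omega> True] in eventually_elim)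
         (use True in \<open>auto simp: g_def G_def exit_pos_def\<close>)
  next
    case False
    show ?thesis
    proof (rule tendsto_sandwich[where f="\<lambda>_. 0" and h="\<lambda>n. exp (l * fst x) * exp (- (l\<^sup>2 / 2 * real (Suc
        n)))"])
      have "(\<lambda>n. exp (l * fst x) * exp (- (l\<^sup>2 / 2 * real n))) \<longlonglongrightarrow> 0"
      proof -
        have "(\<lambda>n. exp (l * fst x) * exp (- (l\<^sup>2 / 2)) ^ n) \<longlonglongrightarrow> exp (l * fst x) * 0"
          using l by (intro tendsto_intros LIMSEQ_realpow_zero) auto
        then show ?thesis
          by (simp add: exp_of_nat_mult[symmetric] mult_ac)
      qed
      then show "(\<lambda>n. exp (l * fst x) * exp (- (l\<^sup>2 / 2 * real (Suc n)))) \<longlonglongrightarrow> G l \<omega>"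
        using False by (intro LIMSEQ_Suc) (simp add: G_def)
      show "\<forall>\<^sub>F n in sequentially. g l n \<omega> \<le> exp (l * fst x) * exp (- (l\<^sup>2 / 2 * real (Suc n)))"
        using g_bound[of l \<omega>] l \<omega> inf[OF \<omega> False] by (auto intro!: always_eventually)
    qed (use False in \<open>auto simp: g_def G_def\<close>)
  qed
  have EG: "(LINT \<omega>|M. G l \<omega>) = 1" if l: "0 < l" for l
  proof -
    have "(\<lambda>n. LINT \<omega>|M. g l n \<omega>) \<longlonglongrightarrow> (LINT \<omega>|M. G l \<omega>)"
      by (rule integral_dominated_convergence[where w="\<lambda>_. exp (l * fst x)"])
         (use g_lim[OF l] g_le[of l] l in \<open>auto intro!: AE_I2 simp: g_def[abs_def]\<close>)
    then show ?thesis by (simp add: Eg LIMSEQ_const_iff)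
  qed
  have G_le: "G l \<omega> \<le> exp (l * fst x)" if "0 < l" "\<omega> \<in> space M" for l \<omega>
    using LIMSEQ_le_const2[OF g_lim[OF that]] g_le[of l \<omega>] that by auto
  have "(\<lambda>k. LINT \<omega>|M. G (1 / Suc k) \<omega>) \<longlonglongrightarrow> (LINT \<omega>|M. (if fin \<omega> then 1 else 0))"
  proof (rule integral_dominated_convergence[where w="\<lambda>_. exp (fst x)"])
    show "AE \<omega> in M. (\<lambda>k. G (1 / Suc k) \<omega>) \<longlonglongrightarrow> (if fin \<omega> then 1 else 0)"
    proof (rule AE_I2)
      fix \<omega> assume "\<omega> \<in> space M"
      have l: "(\<lambda>k. 1 / real (Suc k)) \<longlonglongrightarrow> 0" by (rule LIMSEQ_Suc[OF lim_1_over_n])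
      have "(\<lambda>k. exp (- (1 / real (Suc k)) * u - (1 / real (Suc k))\<^sup>2 / 2 * v))
          \<longlonglongrightarrow> exp (- 0 * u - 0\<^sup>2 / 2 * v)" for u v
        by (intro tendsto_intros l) auto
      then show "(\<lambda>k. G (1 / Suc k) \<omega>) \<longlonglongrightarrow> (if fin \<omega> then 1 else 0)"
        by (auto simp: G_def)
    qed
    have "fst x \<ge> 0" using x by (auto simp: open_quadrant_def)
    then have exp_le: "exp (1 / real (Suc k) * fst x) \<le> exp (fst x)" for k
      by (simp add: field_simps mult_left_le)
    show "AE \<omega> in M. norm (G (1 / Suc k) \<omega>) \<le> exp (fst x)" for k
    proof (intro AE_I2)
      fix \<omega> assume "\<omega> \<in> space M"
      then have "G (1 / Suc k) \<omega> \<le> exp (1 / real (Suc k) * fst x)" by (intro G_le) auto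
      moreover have "norm (G (1 / Suc k) \<omega>) = G (1 / Suc k) \<omega>" by (simp add: G_def)
      ultimately show "norm (G (1 / Suc k) \<omega>) \<le> exp (fst x)"
        using exp_le[of k] by linarith
    qed
  qed auto
  then have "(LINT \<omega>|M. (if fin \<omega> then 1 else 0)) = (1 :: real)"
    by (simp add: EG LIMSEQ_const_iff)
  moreover have "(LINT \<omega>|M. (if fin \<omega> then 1 else 0)) = (LINT \<omega>|M. indicator {\<omega>\<in>space M. fin \<omega>} \<omega> :: real)"
    by (intro Bochner_Integration.integral_cong) auto
  ultimately have "prob {\<omega>\<in>space M. fin \<omega>} = 1" by simp
  then show ?thesis
    by (subst (asm) prob_Collect_eq_1) (auto simp: fin_def)
qed

text \<open>For exponents with \<open>a\<^sup>2 + b\<^sup>2 = 0\<close> and nonpositive real parts the martingale is a function of the position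
that is bounded on the quadrant, so the cut-off at \<open>T\<close> can be removed. From the axes the path leaves at
once.\<close>

lemma exit_pos_properties:
  assumes x: "x \<in> quadrant"
  shows "AE \<omega> in M. exit_pos \<omega> \<in> axes"
    and "\<And>a b. a\<^sup>2 + b\<^sup>2 = 0 \<Longrightarrow> Re a \<le> 0 \<Longrightarrow> Re b \<le> 0 \<Longrightarrow>
       (LINT \<omega>|M. exp_functional a b (exit_pos \<omega>)) = exp_functional a b x"
proof -
  have axis: "AE \<omega> in M. exit_pos \<omega> = x" if "x \<in> axes"
    using exit_time_axis[OF that] AE_space
    by eventually_elim (simp add: exit_pos_def W_0)
  have "(AE \<omega> in M. exit_pos \<omega> \<in> axes) \<and> (\<forall>a b. a\<^sup>2 + b\<^sup>2 = 0 \<longrightarrow> Re a \<le> 0 \<longrightarrow> Re b \<le> 0 \<longrightarrow>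
       (LINT \<omega>|M. exp_functional a b (exit_pos \<omega>)) = exp_functional a b x)"
  proof (cases "x \<in> axes")
    case True
    have "(LINT \<omega>|M. exp_functional a b (exit_pos \<omega>)) = (LINT \<omega>|M. exp_functional a b x)" for a b
      using axis[OF True] by (intro integral_cong_AE) auto
    then show ?thesis using axis[OF True] True by (auto simp: prob_space)
  next
    case False
    then have xo: "x \<in> open_quadrant" using x by (auto simp: axes_def)
    obtain \<rho> :: "nat \<Rightarrow> 'a \<Rightarrow> real" where fair: "\<And>n. fair (real (Suc n)) (\<rho> n)"
      and quad: "\<And>n \<omega>. \<omega> \<in> space M \<Longrightarrow> W (\<rho> n \<omega>) \<omega> \<in> quadrant"
      and out: "\<And>n \<omega>. \<omega> \<in> space M \<Longrightarrow> \<rho> n \<omega> < real (Suc n) \<Longrightarrow> W (\<rho> n \<omega>) \<omega> \<notin> open_quadrant"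
      and ev: "\<And>\<omega>. \<omega> \<in> space M \<Longrightarrow> exit_time W \<omega> < \<infinity> \<Longrightarrow>
         \<forall>\<^sub>F n in sequentially. \<rho> n \<omega> = enn2real (exit_time W \<omega>) \<and> \<rho> n \<omega> < real (Suc n)"
      and inf: "\<And>n \<omega>. \<omega> \<in> space M \<Longrightarrow> \<not> exit_time W \<omega> < \<infinity> \<Longrightarrow> \<rho> n \<omega> = real (Suc n)"
      using that by (rule truncated_exit_times[OF xo])
    have [measurable]: "\<rho> n \<in> borel_measurable M" for n using fair[of n] by (simp add: fair_def)
    have nn: "0 \<le> \<rho> n \<omega>" if "\<omega> \<in> space M" for n \<omega> using fair[of n] that by (simp add: fair_def)
    have "AE \<omega> in M. exit_pos \<omega> \<in> axes"
      using exit_time_finite[OF xo] AE_space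
    proof eventually_elim
      fix \<omega> assume "exit_time W \<omega> < \<infinity>" "\<omega> \<in> space M"
      from ev[OF this(2,1)] obtain n where "\<rho> n \<omega> = enn2real (exit_time W \<omega>)" "\<rho> n \<omega> < Suc n"
        by (auto simp: eventually_sequentially)
      then show "exit_pos \<omega> \<in> axes"
        using out[OF \<open>\<omega> \<in> space M\<close>, of n] quad[OF \<open>\<omega> \<in> space M\<close>, of n] by (simp add: exit_pos_def axes_def)
    qed
    moreover have "(LINT \<omega>|M. exp_functional a b (exit_pos \<omega>)) = exp_functional a b x"
      if ab: "a\<^sup>2 + b\<^sup>2 = 0" "Re a \<le> 0" "Re b \<le> 0" for a b
    proof -
      have expM: "expM a b t \<omega> * exp_functional a b x = exp_functional a b (W t \<omega>)" for t \<omega>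
        by (simp add: expM_def ab(1) exp_functional_add[symmetric])
      have E: "(LINT \<omega>|M. exp_functional a b (W (\<rho> n \<omega>) \<omega>)) = exp_functional a b x" for n
        unfolding expM[symmetric] using fair[of n] by (simp add: fair_def)
      have "(\<lambda>n. LINT \<omega>|M. exp_functional a b (W (\<rho> n \<omega>) \<omega>)) \<longlonglongrightarrow> (LINT \<omega>|M. exp_functional a b (exit_pos \<omega>))"
      proof (rule integral_dominated_convergence[where w="\<lambda>_. 1"])
        show "AE \<omega> in M. (\<lambda>n. exp_functional a b (W (\<rho> n \<omega>) \<omega>)) \<longlonglongrightarrow> exp_functional a b (exit_pos \<omega>)"
          using exit_time_finite[OF xo] AE_space
        proof eventually_elim
          fix \<omega> assume "exit_time W \<omega> < \<infinity>" "\<omega> \<in> space M"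
          from ev[OF this(2,1)] show "(\<lambda>n. exp_functional a b (W (\<rho> n \<omega>) \<omega>)) \<longlonglongrightarrow> exp_functional a b (exit_pos \<omega>)"
            by (intro tendsto_eventually, eventually_elim) (simp add: exit_pos_def)
        qed
        show "AE \<omega> in M. norm (exp_functional a b (W (\<rho> n \<omega>) \<omega>)) \<le> 1" for n
        proof (rule AE_I2)
          fix \<omega> assume "\<omega> \<in> space M"
          from quad[OF this, of n] have "Re a * fst (W (\<rho> n \<omega>) \<omega>) \<le> 0" "Re b * snd (W (\<rho> n \<omega>) \<omega>) \<le> 0"
            using ab by (auto simp: quadrant_def mem_Times_iff intro: mult_nonpos_nonneg)
          then show "norm (exp_functional a b (W (\<rho> n \<omega>) \<omega>)) \<le> 1"
            by (simp add: exp_functional_def)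
        qed
      qed (use nn in auto)
      then show ?thesis by (simp add: E LIMSEQ_const_iff)
    qed
    ultimately show ?thesis by blast
  qed
  then show "AE \<omega> in M. exit_pos \<omega> \<in> axes"
    and "\<And>a b. a\<^sup>2 + b\<^sup>2 = 0 \<Longrightarrow> Re a \<le> 0 \<Longrightarrow> Re b \<le> 0 \<Longrightarrow>
       (LINT \<omega>|M. exp_functional a b (exit_pos \<omega>)) = exp_functional a b x"
    by blast+
qed

end

section \<open>The duality function and its linear span\<close>

text \<open>The mixed Laplace-Fourier transform. As a function of \<open>z\<close> it is an exponential with exponents satisfying
\<open>a\<^sup>2 + b\<^sup>2 = 8 v\<^sub>1 v\<^sub>2\<close>, hence harmonic exactly when \<open>v\<^sub>1 v\<^sub>2 = 0\<close>.\<close>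

definition mlf :: "real \<times> real \<Rightarrow> real \<times> real \<Rightarrow> complex" where
  "mlf z v = exp (- of_real ((fst z + snd z) * (fst v + snd v))
     + \<i> * of_real ((fst z - snd z) * (fst v - snd v)))"

lemma mlf_commute: "mlf z v = mlf v z"
  by (simp add: mlf_def mult.commute)

lemma mlf_add_right: "mlf z (v + w) = mlf z v * mlf z w"
  unfolding mlf_def exp_add[symmetric] by (simp add: algebra_simps)

lemma mlf_zero [simp]: "mlf z (0, 0) = 1"
  by (simp add: mlf_def)

lemma cnj_mlf: "cnj (mlf z v) = mlf z (prod.swap v)"
  by (simp add: mlf_def exp_cnj algebra_simps)

lemma cmod_mlf: "cmod (mlf z v) = exp (- ((fst z + snd z) * (fst v + snd v)))"
  by (simp add: mlf_def)

lemma cmod_mlf_le_1: "z \<in> quadrant \<Longrightarrow> v \<in> quadrant \<Longrightarrow> cmod (mlf z v) \<le> 1"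
  by (auto simp: cmod_mlf quadrant_def mem_Times_iff)

lemma continuous_on_mlf: "continuous_on A (\<lambda>z. mlf z v)"
  unfolding mlf_def by (intro continuous_intros)

lemma measurable_mlf [measurable]: "(\<lambda>z. mlf z v) \<in> borel_measurable borel"
  by (intro borel_measurable_continuous_onI continuous_on_mlf)

lemma axes_subset_quadrant: "axes \<subseteq> quadrant"
  by (auto simp: axes_def)

lemma axes_iff: "z \<in> axes \<longleftrightarrow> 0 \<le> fst z \<and> 0 \<le> snd z \<and> (fst z = 0 \<or> snd z = 0)"
  by (auto simp: axes_def quadrant_def open_quadrant_def mem_Times_iff)

text \<open>By \<open>mlf_add_right\<close> and \<open>cnj_mlf\<close> the span is an algebra closed under conjugation, as the
Stone-Weierstrass theorem requires.\<close>

inductive_set mlf_span :: "(real \<times> real \<Rightarrow> complex) set" where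
  mlf_span_base: "v \<in> quadrant \<Longrightarrow> (\<lambda>z. c * mlf z v) \<in> mlf_span"
| mlf_span_add: "f \<in> mlf_span \<Longrightarrow> g \<in> mlf_span \<Longrightarrow> (\<lambda>z. f z + g z) \<in> mlf_span"

lemma quadrant_add: "v \<in> quadrant \<Longrightarrow> w \<in> quadrant \<Longrightarrow> v + w \<in> quadrant"
  by (auto simp: quadrant_def mem_Times_iff)

lemma mlf_span_mult: "f \<in> mlf_span \<Longrightarrow> g \<in> mlf_span \<Longrightarrow> (\<lambda>z. f z * g z) \<in> mlf_span"
proof (induction f rule: mlf_span.induct)
  case (mlf_span_base v c)
  from mlf_span_base(2) show ?case
  proof (induction g rule: mlf_span.induct)
    case (mlf_span_base w d)
    have "(\<lambda>z. (c * d) * mlf z (v + w)) \<in> mlf_span"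
      using \<open>v \<in> quadrant\<close> mlf_span_base by (intro mlf_span.mlf_span_base quadrant_add)
    then show ?case by (simp add: mlf_add_right mult_ac)
  next
    case (mlf_span_add f g)
    then show ?case using mlf_span.mlf_span_add by (simp add: distrib_left)
  qed
next
  case (mlf_span_add f f')
  then show ?case using mlf_span.mlf_span_add by (simp add: distrib_right)
qed

lemma mlf_span_cnj: "f \<in> mlf_span \<Longrightarrow> (\<lambda>z. cnj (f z)) \<in> mlf_span"
proof (induction f rule: mlf_span.induct)
  case (mlf_span_base v c)
  then have "(\<lambda>z. cnj c * mlf z (prod.swap v)) \<in> mlf_span"
    by (intro mlf_span.mlf_span_base) (auto simp: quadrant_def)
  then show ?case by (simp add: cnj_mlf)
qed (use mlf_span.mlf_span_add in simp)

lemma mlf_span_const: "(\<lambda>z. c) \<in> mlf_span"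
  using mlf_span_base[of "(0, 0)" c] by (simp add: quadrant_def)

lemma mlf_span_scale: "f \<in> mlf_span \<Longrightarrow> (\<lambda>z. c * f z) \<in> mlf_span"
  by (rule mlf_span_mult[OF mlf_span_const])

text \<open>One point at infinity for both half-axes: \<open>mlf\<close> at a nonzero \<open>v\<close> in the quadrant vanishes along each of
them.\<close>

definition axes_at_infinity :: "(real \<times> real) filter" where
  "axes_at_infinity = inf (filtercomap (\<lambda>z. fst z + snd z) at_top) (principal axes)"

lemma tendsto_axes_at_infinityD:
  fixes f :: "real \<times> real \<Rightarrow> 'a::metric_space"
  assumes "(f \<longlongrightarrow> L) axes_at_infinity" "0 < e"
  obtains R where "\<And>z. z \<in> axes \<Longrightarrow> R \<le> fst z + snd z \<Longrightarrow> dist (f z) L < e"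
  using tendstoD[OF assms] that
  unfolding axes_at_infinity_def eventually_inf_principal eventually_filtercomap_at_top_linorder by blast

lemma mlf_at_infinity:
  assumes v: "v \<in> quadrant" "v \<noteq> (0, 0)"
  shows "((\<lambda>z. mlf z v) \<longlongrightarrow> 0) axes_at_infinity"
proof (rule tendsto_norm_zero_cancel)
  have s: "0 < fst v + snd v"
    using v by (cases v) (auto simp: quadrant_def add_nonneg_eq_0_iff less_le)
  have "filterlim (\<lambda>z. fst z + snd z) at_top axes_at_infinity"
    unfolding axes_at_infinity_def by (rule filterlim_mono[OF filterlim_filtercomap order_refl inf_le1])
  then have "filterlim (\<lambda>z::real\<times>real. (fst v + snd v) * (fst z + snd z)) at_top axes_at_infinity"
    using s by (intro filterlim_tendsto_pos_mult_at_top[OF tendsto_const])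
  then have "filterlim (\<lambda>z::real\<times>real. - ((fst z + snd z) * (fst v + snd v))) at_bot axes_at_infinity"
    by (simp add: filterlim_uminus_at_top[symmetric] filterlim_uminus_at_bot mult.commute)
  then show "((\<lambda>z. cmod (mlf z v)) \<longlongrightarrow> 0) axes_at_infinity"
    unfolding cmod_mlf by (rule filterlim_compose[OF exp_at_bot])
qed

lemma continuous_on_mlf_span: "f \<in> mlf_span \<Longrightarrow> continuous_on A f"
  by (induction f rule: mlf_span.induct) (auto intro!: continuous_intros continuous_on_mlf)

text \<open>The coordinate \<open>u = z\<^sub>1 - z\<^sub>2\<close> identifies the axes with the real line, and
\<open>u \<mapsto> (u, 1) / (1 + u\<^sup>2)\<close> is inverse stereographic projection of the line onto this circle without the
origin. The origin is the point at infinity.\<close>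

definition circle :: "(real \<times> real) set" where
  "circle = {k. (fst k)\<^sup>2 + (snd k)\<^sup>2 = snd k}"

text \<open>The inverse map: \<open>fst k / snd k\<close> recovers \<open>u\<close>, whose positive and negative parts are the two coordinates
on the axes. At the point at infinity the value is the default of a division by 0; \<open>circle_extend\<close> does
not evaluate \<open>chart\<close> there.\<close>

definition chart :: "real \<times> real \<Rightarrow> real \<times> real" where
  "chart k = (max 0 (fst k / snd k), max 0 (- (fst k / snd k)))"

definition circle_extend :: "(real \<times> real \<Rightarrow> 'a) \<Rightarrow> 'a \<Rightarrow> real \<times> real \<Rightarrow> 'a" where
  "circle_extend f L k = (if k = (0, 0) then L else f (chart k))"

lemma chart_in_axes: "chart k \<in> axes"
  by (auto simp: chart_def axes_iff)

lemma chart_sum: "fst (chart k) + snd (chart k) = \<bar>fst k / snd k\<bar>"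
  and chart_diff: "fst (chart k) - snd (chart k) = fst k / snd k"
  unfolding chart_def by (cases "0 \<le> fst k / snd k"; simp add: max_def del: abs_divide)+

lemma compact_circle: "compact circle"
proof -
  have "closed circle"
    unfolding circle_def by (intro closed_Collect_eq continuous_intros)
  moreover have "circle \<subseteq> cbox (-1, 0) (1, 1)"
  proof
    fix k assume k: "k \<in> circle"
    have q: "0 \<le> snd k" "snd k \<le> 1"
    proof -
      show "0 \<le> snd k" using k by (simp add: circle_def) (metis sum_power2_ge_zero)
      have "(snd k)\<^sup>2 \<le> snd k" using k zero_le_power2[of "fst k"]
          unfolding circle_def mem_Collect_eq by linarith
      then show "snd k \<le> 1"
        using \<open>0 \<le> snd k\<close> by (cases "snd k = 0") (auto simp: power2_eq_square)
    qed
    have "(fst k)\<^sup>2 \<le> 1" using k q zero_le_power2[of "snd k"] unfolding circle_def mem_Collect_eq by linarith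
    then have "\<bar>fst k\<bar> \<le> 1" by (simp add: abs_square_le_1)
    with q show "k \<in> cbox (-1, 0) (1, 1)" by (cases k) (auto simp: cbox_Pair_eq)
  qed
  ultimately show ?thesis
    by (meson bounded_cbox bounded_subset compact_eq_bounded_closed)
qed

lemma circle_pos: "k \<in> circle \<Longrightarrow> k \<noteq> (0, 0) \<Longrightarrow> 0 < snd k"
proof -
  assume k: "k \<in> circle" "k \<noteq> (0, 0)"
  then have "0 < (fst k)\<^sup>2 + (snd k)\<^sup>2"
    by (cases k) (auto simp: sum_power2_gt_zero_iff)
  then show ?thesis using k(1) by (simp add: circle_def)
qed

lemma chart_surj:
  assumes z: "z \<in> axes"
  obtains k where "k \<in> circle" "k \<noteq> (0, 0)" "chart k = z"
proof -
  define u where "u = fst z - snd z"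
  define k where "k = (u / (1 + u\<^sup>2), 1 / (1 + u\<^sup>2))"
  have pos: "0 < 1 + u\<^sup>2" by (simp add: add_pos_nonneg)
  have "u\<^sup>2 / (1 + u\<^sup>2)\<^sup>2 + 1 / (1 + u\<^sup>2)\<^sup>2 = (1 + u\<^sup>2) / (1 + u\<^sup>2)\<^sup>2"
    by (simp add: add_divide_distrib add.commute)
  also have "\<dots> = 1 / (1 + u\<^sup>2)" using pos by (simp add: power2_eq_square)
  finally have "k \<in> circle" by (simp add: circle_def k_def power_divide)
  moreover have "k \<noteq> (0, 0)" using pos by (auto simp: k_def)
  moreover have "fst k / snd k = u" using pos by (simp add: k_def)
  then have "chart k = z"
    using z by (cases z) (auto simp: chart_def u_def axes_iff)
  ultimately show ?thesis by (rule that)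
qed

text \<open>At the origin, \<open>u\<^sup>2 = 1 / snd k - 1\<close> on the circle, so points near the origin have large \<open>\<bar>u\<bar>\<close>.\<close>

lemma continuous_circle_extend:
  fixes f :: "real \<times> real \<Rightarrow> 'a::metric_space"
  assumes f: "continuous_on axes f" and L: "(f \<longlongrightarrow> L) axes_at_infinity"
  shows "continuous_on circle (circle_extend f L)"
  unfolding continuous_on_eq_continuous_within
proof
  fix k assume k: "k \<in> circle"
  show "continuous (at k within circle) (circle_extend f L)"
  proof (cases "k = (0, 0)")
    case False
    let ?U = "circle \<inter> - {(0, 0)}"
    have "continuous_on ?U (\<lambda>k. f (chart k))"
      by (rule continuous_on_compose2[OF f])
         (auto simp: chart_in_axes, auto simp: chart_def intro!: continuous_intros dest!: circle_pos)
    then have "continuous_on ?U (circle_extend f L)"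
      by (rule continuous_on_eq) (auto simp: circle_extend_def)
    then have "continuous (at k within ?U) (circle_extend f L)"
      using k False by (auto simp: continuous_on_eq_continuous_within)
    moreover have "at k within circle = at k within ?U"
      by (rule at_within_nhd[where S="- {(0, 0)}"]) (use False in auto)
    ultimately show ?thesis by simp
  next
    case True
    show ?thesis
      unfolding continuous_within_eps_delta
    proof (intro allI impI)
      fix e :: real assume e: "0 < e"
      from tendsto_axes_at_infinityD[OF L e] obtain R where
        R: "\<And>z. z \<in> axes \<Longrightarrow> R \<le> fst z + snd z \<Longrightarrow> dist (f z) L < e" by blast
      define d where "d = 1 / (2 + R\<^sup>2)"
      have d: "0 < d" by (simp add: d_def add_pos_nonneg)
      have "dist (circle_extend f L k') (circle_extend f L k) < e" if k': "k' \<in> circle" "dist k' k < d" for k'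
      proof (cases "k' = (0, 0)")
        case False
        define p q where "p = fst k'" and "q = snd k'"
        have q: "0 < q" using circle_pos[OF k'(1) False] by (simp add: q_def)
        have pq: "p\<^sup>2 + q\<^sup>2 = q" using k' by (simp add: circle_def p_def q_def)
        have "q < d"
        proof -
          have "dist q 0 \<le> dist k' (0, 0)"
            using dist_snd_le[of k' "(0, 0)"] by (simp add: q_def)
          then show ?thesis using k'(2) True by (simp add: dist_real_def)
        qed
        then have "2 + R\<^sup>2 < 1 / q"
          using q d by (simp add: d_def field_simps add_pos_nonneg)
        moreover have "(p / q)\<^sup>2 = 1 / q - 1"
        proof -
          have "(p / q)\<^sup>2 = (q - q\<^sup>2) / q\<^sup>2" using pq by (simp add: power_divide)
          then show ?thesis using q by (simp add: power2_eq_square diff_divide_distrib)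
        qed
        ultimately have "R\<^sup>2 \<le> (p / q)\<^sup>2" by simp
        then have "R \<le> \<bar>p / q\<bar>"
          by (metis abs_ge_self abs_le_square_iff order_trans)
        then have "R \<le> fst (chart k') + snd (chart k')"
          by (simp add: chart_sum p_def q_def)
        from R[OF chart_in_axes this] show ?thesis
          using True False by (simp add: circle_extend_def)
      qed (use True e in simp)
      then show "\<exists>d>0. \<forall>x'\<in>circle. dist x' k < d \<longrightarrow> dist (circle_extend f L x') (circle_extend f L k) < e"
        using d by blast
    qed
  qed
qed

text \<open>Stone-Weierstrass on the circle. For the separation of points, \<open>mlf\<close> at \<open>v = (1, 1)\<close> equals
\<open>exp (- 2 \<bar>u\<bar>)\<close> and distinguishes all values of \<open>\<bar>u\<bar>\<close>, infinity included; the sign of \<open>u\<close> is seen by the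
imaginary part of \<open>mlf\<close> at a suitable \<open>v\<close> on the axes.\<close>

lemma mlf_span_dense:
  assumes f: "continuous_on axes f" and L: "(f \<longlongrightarrow> L) axes_at_infinity" and e: "0 < (e::real)"
  obtains g where "g \<in> mlf_span" "\<And>z. z \<in> axes \<Longrightarrow> \<bar>f z - Re (g z)\<bar> < e"
proof -
  define P where "P h \<longleftrightarrow> (\<exists>g\<in>mlf_span. \<exists>L. (g \<longlongrightarrow> L) axes_at_infinity \<and>
     (\<forall>k\<in>circle. h k = Re (circle_extend g L k)))" for h :: "real \<times> real \<Rightarrow> real"
  have P_I: "P (\<lambda>k. Re (circle_extend g L k))" if "g \<in> mlf_span" "(g \<longlongrightarrow> L) axes_at_infinity" for g L
    unfolding P_def using that by blast
  have sep: "\<exists>h. P h \<and> h k \<noteq> h l" if kl: "k \<in> circle" "l \<in> circle" "k \<noteq> l" for k l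
  proof -
    let ?g = "\<lambda>v z. 1 * mlf z v"
    have span: "?g v \<in> mlf_span" "(?g v \<longlongrightarrow> 0) axes_at_infinity" if "v \<in> quadrant" "v \<noteq> (0, 0)" for v
      using mlf_span_base[OF that(1), of 1] mlf_at_infinity[OF that] by auto
    have P1: "P (\<lambda>k. Re (circle_extend (?g (1, 1)) 0 k))"
      by (intro P_I span) (auto simp: quadrant_def)
    have v1: "Re (circle_extend (?g (1, 1)) 0 k) = (if k
        = (0, 0) then 0 else exp (- 2 * \<bar>fst k / snd k\<bar>))" for k
      using chart_sum[of k] by (auto simp: circle_extend_def mlf_def Re_exp chart_diff simp del: abs_divide)
    show ?thesis
    proof (cases "Re (circle_extend (?g (1, 1)) 0 k) = Re (circle_extend (?g (1, 1)) 0 l)")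
      case False
      then show ?thesis using P1 by blast
    next
      case True
      then have nz: "k \<noteq> (0, 0)" "l \<noteq> (0, 0)" and abs: "\<bar>fst k / snd k\<bar> = \<bar>fst l / snd l\<bar>"
        using kl(3) unfolding v1 by (auto split: if_splits)
      define u where "u = fst k / snd k"
      have q: "snd m = 1 / (1 + (fst m / snd m)\<^sup>2)" "fst m = (fst m / snd m) * snd m"
          if "m \<in> circle" "m \<noteq> (0, 0)" for m
      proof -
        have pos: "0 < snd m" using circle_pos[OF that] .
        have "1 + (fst m / snd m)\<^sup>2 = ((fst m)\<^sup>2 + (snd m)\<^sup>2) / (snd m)\<^sup>2"
          using pos by (simp add: power_divide add_divide_distrib)
        also have "\<dots> = 1 / snd m" using that(1) pos by (simp add: circle_def power2_eq_square)
        finally show "snd m = 1 / (1 + (fst m / snd m)\<^sup>2)" by simp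
        show "fst m = (fst m / snd m) * snd m" using pos by simp
      qed
      have ne: "fst k / snd k \<noteq> fst l / snd l"
      proof
        assume eq: "fst k / snd k = fst l / snd l"
        then have "snd k = snd l" using q(1)[OF kl(1) nz(1)] q(1)[OF kl(2) nz(2)] by simp
        then have "fst k = fst l" using q(2)[OF kl(1) nz(1)] q(2)[OF kl(2) nz(2)] eq by metis
        then show False using \<open>snd k = snd l\<close> kl(3) by (simp add: prod_eq_iff)
      qed
      then have l: "fst l / snd l = - u" and u0: "u \<noteq> 0" using abs by (auto simp: u_def abs_if split: if_splits)
      \<comment> \<open>This choice makes \<open>b u = \<plusminus>1\<close>, where the sine has opposite nonzero values.\<close>
      define b where "b = 1 / \<bar>u\<bar>"
      have b: "0 < b" using u0 by (simp add: b_def)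
      \<comment> \<open>The factor \<open>- \<i>\<close> turns the imaginary part into the real part.\<close>
      let ?h = "\<lambda>z. (- \<i>) * (1 * mlf z (b, 0))"
      have lim: "(?h \<longlongrightarrow> - \<i> * 0) axes_at_infinity"
        using b by (intro tendsto_mult_left span) (auto simp: quadrant_def)
      define h where "h k = Re (circle_extend ?h (- \<i> * 0) k)" for k
      have "P h"
        unfolding h_def[abs_def]
        by (rule P_I[OF _ lim], rule mlf_span_scale, rule span) (use b in \<open>auto simp: quadrant_def\<close>)
      moreover have "h k = exp (- b * \<bar>u\<bar>) * sin (b * u)"
        using nz by (auto simp: h_def circle_extend_def mlf_def Im_exp chart_sum chart_diff u_def[symmetric]
            mult.commute simp del: abs_divide)
      moreover have "h l = exp (- b * \<bar>u\<bar>) * sin (b * - u)"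
        using nz by (auto simp: h_def circle_extend_def mlf_def Im_exp chart_sum chart_diff l mult.commute
            simp del: abs_divide)
      moreover have "sin (b * u) \<noteq> sin (b * - u)"
      proof -
        have "0 < sin (1::real)" using pi_gt3 by (intro sin_gt_zero) auto
        moreover have "b * u = 1 \<or> b * u = - 1" using u0 by (auto simp: b_def abs_if)
        ultimately show ?thesis by auto
      qed
      ultimately show ?thesis by (intro exI[of _ h]) simp
    qed
  qed
  have "\<exists>g. P g \<and> (\<forall>k\<in>circle. \<bar>circle_extend f L k - g k\<bar> < e)"
  proof (rule Stone_Weierstrass_HOL[OF compact_circle])
    show "P (\<lambda>_. c)" for c
      unfolding P_def
      by (intro bexI[OF _ mlf_span_const[of "of_real c"]] exI[of _ "of_real c"]) (auto simp: circle_extend_def)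
    show "continuous_on circle h" if "P h" for h
    proof -
      from that obtain g L where g: "g \<in> mlf_span" "(g \<longlongrightarrow> L) axes_at_infinity"
        "\<And>k. k \<in> circle \<Longrightarrow> h k = Re (circle_extend g L k)" unfolding P_def by blast
      have "continuous_on circle (\<lambda>k. Re (circle_extend g L k))"
        by (intro continuous_intros continuous_circle_extend continuous_on_mlf_span g)
      then show ?thesis by (rule continuous_on_eq) (simp add: g)
    qed
    show "P (\<lambda>k. h1 k + h2 k)" if "P h1 \<and> P h2" for h1 h2
    proof -
      from that obtain g1 L1 g2 L2 where g: "g1 \<in> mlf_span" "(g1 \<longlongrightarrow> L1) axes_at_infinity"
        "\<And>k. k \<in> circle \<Longrightarrow> h1 k = Re (circle_extend g1 L1 k)"
        "g2 \<in> mlf_span" "(g2 \<longlongrightarrow> L2) axes_at_infinity"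
        "\<And>k. k \<in> circle \<Longrightarrow> h2 k = Re (circle_extend g2 L2 k)" unfolding P_def by blast
      show ?thesis
        unfolding P_def
        by (rule bexI[OF _ mlf_span_add[OF g(1,4)]], rule exI[of _ "L1 + L2"])
           (use g in \<open>auto intro: tendsto_add simp: circle_extend_def\<close>)
    qed
    show "P (\<lambda>k. h1 k * h2 k)" if "P h1 \<and> P h2" for h1 h2
    proof -
      from that obtain g1 L1 g2 L2 where g: "g1 \<in> mlf_span" "(g1 \<longlongrightarrow> L1) axes_at_infinity"
        "\<And>k. k \<in> circle \<Longrightarrow> h1 k = Re (circle_extend g1 L1 k)"
        "g2 \<in> mlf_span" "(g2 \<longlongrightarrow> L2) axes_at_infinity"
        "\<And>k. k \<in> circle \<Longrightarrow> h2 k = Re (circle_extend g2 L2 k)" unfolding P_def by blast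
      \<comment> \<open>Products of real parts are real parts of members of the span because it is closed under conjugation.\<close>
      have Re: "Re a * Re b = Re ((1 / 2) * (a * b + a * cnj b))" for a b by (simp add: field_simps)
      have "(\<lambda>z. (1 / 2) * (g1 z * g2 z + g1 z * cnj (g2 z))) \<in> mlf_span"
        by (intro mlf_span_scale mlf_span_add mlf_span_mult mlf_span_cnj g)
      moreover have "((\<lambda>z. (1 / 2) * (g1 z * g2 z + g1 z * cnj (g2 z))) \<longlongrightarrow> (1 / 2) * (L1 * L2 + L1 * cnj L2))
          axes_at_infinity"
        by (intro tendsto_intros g)
      moreover have "h1 k * h2 k = Re (circle_extend (\<lambda>z. (1 / 2) * (g1 z * g2 z + g1 z * cnj (g2 z))) ((1 /
          2) * (L1 * L2 + L1 * cnj L2)) k)"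
        if "k \<in> circle" for k
        unfolding g(3,6)[OF that] Re by (simp add: circle_extend_def)
      ultimately show ?thesis unfolding P_def by blast
    qed
    show "\<exists>f. P f \<and> f x \<noteq> f y" if "x \<in> circle \<and> y \<in> circle \<and> x \<noteq> y" for x y
      using sep that by blast
    show "continuous_on circle (circle_extend f L)" by (rule continuous_circle_extend[OF f L])
  qed (rule e)
  then obtain h where "P h" and h: "\<And>k. k \<in> circle \<Longrightarrow> \<bar>circle_extend f L k - h k\<bar> < e" by blast
  then obtain g L' where g: "g \<in> mlf_span" "\<And>k. k \<in> circle \<Longrightarrow> h k = Re (circle_extend g L' k)"
    unfolding P_def by blast
  have "\<bar>f z - Re (g z)\<bar> < e" if z: "z \<in> axes" for z
  proof -
    obtain k where k: "k \<in> circle" "k \<noteq> (0, 0)" "chart k = z" by (rule chart_surj[OF z])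
    show ?thesis using h[OF k(1)] unfolding g(2)[OF k(1)] using k by (simp add: circle_extend_def)
  qed
  with g(1) show ?thesis by (rule that)
qed

section \<open>Laws on metric spaces and kernels\<close>

text \<open>Continuous functions that decrease to the indicator of a nonempty closed set.\<close>

definition closed_approx :: "'a::metric_space set \<Rightarrow> nat \<Rightarrow> 'a \<Rightarrow> real" where
  "closed_approx C n z = max 0 (1 - real n * infdist z C)"

lemma closed_approx_bounds: "0 \<le> closed_approx C n z" "closed_approx C n z \<le> 1"
  by (auto simp: closed_approx_def infdist_nonneg)

lemma continuous_on_closed_approx: "continuous_on A (closed_approx C n)"
  unfolding closed_approx_def by (intro continuous_intros)

lemma measurable_closed_approx [measurable]: "closed_approx C n \<in> borel_measurable borel"
  by (intro borel_measurable_continuous_onI continuous_on_closed_approx)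

lemma closed_approx_tendsto:
  assumes C: "closed C" "C \<noteq> {}"
  shows "(\<lambda>n. closed_approx C n z) \<longlonglongrightarrow> indicator C z"
proof (cases "z \<in> C")
  case False
  then have d: "0 < infdist z C"
    using C by (metis in_closed_iff_infdist_zero infdist_nonneg less_eq_real_def)
  obtain N where N: "1 / infdist z C < real N" using reals_Archimedean2 by blast
  have "closed_approx C n z = 0" if "N \<le> n" for n
  proof -
    have "1 / infdist z C \<le> real n" using N that by linarith
    then have "1 \<le> real n * infdist z C" using d by (simp add: field_simps)
    then show ?thesis by (simp add: closed_approx_def)
  qed
  then have "\<forall>\<^sub>F n in sequentially. closed_approx C n z = indicator C z"
    using False by (auto simp: eventually_sequentially)
  then show ?thesis by (rule tendsto_eventually)
qed (simp add: closed_approx_def)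

lemma nn_integral_closed_approx_tendsto:
  assumes C: "closed C" "C \<noteq> {}" and \<mu>: "finite_measure \<mu>" and [simp]: "sets \<mu> = sets M"
    and Y[measurable]: "Y \<in> borel_measurable M"
  shows "(\<lambda>n. \<integral>\<^sup>+\<omega>. ennreal (closed_approx C n (Y \<omega>)) \<partial>\<mu>) \<longlonglongrightarrow> emeasure \<mu> {\<omega>\<in>space \<mu>. Y \<omega> \<in> C}"
proof -
  interpret finite_measure \<mu> by fact
  have [measurable]: "Y \<in> borel_measurable \<mu>" using Y by (simp cong: measurable_cong_sets)
  have [measurable]: "C \<in> sets borel" using C by auto
  have "(\<lambda>n. \<integral>\<^sup>+\<omega>. ennreal (closed_approx C n (Y \<omega>)) \<partial>\<mu>) \<longlonglongrightarrow> (\<integral>\<^sup>+\<omega>. ennreal (indicator C (Y \<omega>)) \<partial>\<mu>)"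
  proof (rule nn_integral_dominated_convergence[where w="\<lambda>_. 1"])
    show "AE \<omega> in \<mu>. (\<lambda>n. ennreal (closed_approx C n (Y \<omega>))) \<longlonglongrightarrow> ennreal (indicator C (Y \<omega>))"
      by (intro AE_I2 tendsto_ennrealI closed_approx_tendsto C)
    show "AE \<omega> in \<mu>. ennreal (closed_approx C n (Y \<omega>)) \<le> 1" for n
      using closed_approx_bounds by (intro AE_I2) (simp add: ennreal_le_1)
  qed (auto simp: less_top[symmetric] emeasure_finite)
  also have "(\<integral>\<^sup>+\<omega>. ennreal (indicator C (Y \<omega>)) \<partial>\<mu>) = (\<integral>\<^sup>+\<omega>. indicator {\<omega>\<in>space \<mu>. Y \<omega> \<in> C} \<omega> \<partial>\<mu>)"
    by (intro nn_integral_cong) (auto split: split_indicator)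
  also have "\<dots> = emeasure \<mu> {\<omega>\<in>space \<mu>. Y \<omega> \<in> C}"
    by (rule nn_integral_indicator) measurable
  finally show ?thesis .
qed

lemma sets_borel_closed: "sets (borel :: 'a::topological_space measure) = sigma_sets UNIV {C. closed C}"
  unfolding borel_eq_closed by (rule sets_measure_of) auto

lemma measure_eqI_closed_approx:
  fixes \<mu> \<nu> :: "'a::metric_space measure"
  assumes fin: "finite_measure \<mu>" "finite_measure \<nu>" and sets: "sets \<mu> = sets borel" "sets \<nu> = sets borel"
    and eq: "\<And>C n. closed C \<Longrightarrow> (\<integral>\<^sup>+z. ennreal (closed_approx C n z) \<partial>\<mu>)
        = (\<integral>\<^sup>+z. ennreal (closed_approx C n z) \<partial>\<nu>)"
  shows "\<mu> = \<nu>"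
proof (rule measure_eqI_generator_eq[where E="{C. closed C}" and \<Omega>=UNIV and A="\<lambda>_. UNIV"])
  show "Int_stable {C::'a set. closed C}" by (auto simp: Int_stable_def)
  show "emeasure \<mu> C = emeasure \<nu> C" if "C \<in> {C. closed C}" for C
  proof (cases "C = {}")
    case False
    have sp: "space \<mu> = UNIV" "space \<nu> = UNIV"
        using sets_eq_imp_space_eq[OF sets(1)] sets_eq_imp_space_eq[OF sets(2)] by auto
    have C: "closed C" using that by simp
    note nn_integral_closed_approx_tendsto[OF C False fin(1) sets(1), of "\<lambda>z. z", simplified sp]
      and nn_integral_closed_approx_tendsto[OF C False fin(2) sets(2), of "\<lambda>z. z", simplified sp]
    then show ?thesis using eq[OF C] LIMSEQ_unique by simp
  qed simp
  show "emeasure \<mu> UNIV \<noteq> \<infinity>" using finite_measure.emeasure_finite[OF fin(1)] by auto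
qed (auto simp: sets sets_borel_closed)

text \<open>Outside \<open>S\<close> the extended kernel stays where it is, so that it is a measurable kernel on the whole type.\<close>

definition extend_kernel :: "'a::topological_space set \<Rightarrow> ('a \<Rightarrow> 'a measure) \<Rightarrow> 'a \<Rightarrow> 'a measure" where
  "extend_kernel S \<kappa> x = (if x \<in> S then \<kappa> x else return borel x)"

text \<open>The measure of a closed set is a limit of integrals of continuous functions, which depend continuously on
the starting point in \<open>S\<close>; closed sets generate the Borel sets.\<close>

lemma measurable_extend_kernel:
  fixes S :: "'a::metric_space set"
  assumes S[measurable]: "S \<in> sets borel"
    and \<kappa>: "\<And>x. x \<in> S \<Longrightarrow> prob_space (\<kappa> x)" "\<And>x. x \<in> S \<Longrightarrow> sets (\<kappa> x) = sets borel"
    and cont: "\<And>C n. closed C \<Longrightarrow> continuous_on S (\<lambda>x. LINT y|\<kappa> x. closed_approx C n y)"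
  shows "extend_kernel S \<kappa> \<in> borel \<rightarrow>\<^sub>M prob_algebra borel"
proof (rule measurable_prob_algebraI)
  have prob: "prob_space (extend_kernel S \<kappa> x)" for x
    using \<kappa> by (auto simp: extend_kernel_def intro: prob_space_return)
  then show "prob_space (extend_kernel S \<kappa> x)" for x .
  show "extend_kernel S \<kappa> \<in> borel \<rightarrow>\<^sub>M subprob_algebra borel"
  proof (rule measurable_subprob_algebra_generated[OF sets_borel_closed])
    show "Int_stable {C::'a set. closed C}" by (auto simp: Int_stable_def)
    show "subprob_space (extend_kernel S \<kappa> x)" for x
      using prob by (rule prob_space_imp_subprob_space)
    show sets: "sets (extend_kernel S \<kappa> x) = sets borel" for x
      using \<kappa> by (auto simp: extend_kernel_def)
    have sp: "space (extend_kernel S \<kappa> x) = UNIV" for x using sets_eq_imp_space_eq[OF sets] by simp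
    show "(\<lambda>x. emeasure (extend_kernel S \<kappa> x) C) \<in> borel_measurable borel" if C: "C \<in> {C. closed C}" for C
    proof (cases "C = {}")
      case False
      have cC: "closed C" using C by simp
      have I: "(\<integral>\<^sup>+y. ennreal (closed_approx C n y) \<partial>extend_kernel S \<kappa> x)
        = ennreal (if x \<in> S then LINT y|\<kappa> x. closed_approx C n y else closed_approx C n x)" for n x
      proof -
        interpret prob_space "extend_kernel S \<kappa> x" by (rule prob)
        have "integrable (extend_kernel S \<kappa> x) (closed_approx C n)"
          by (rule integrable_const_bound[where B=1])
             (auto simp: closed_approx_bounds sets cong: measurable_cong_sets)
        then have "(\<integral>\<^sup>+y. ennreal (closed_approx C n y) \<partial>extend_kernel S \<kappa> x)
            = ennreal (LINT y|extend_kernel S \<kappa> x. closed_approx C n y)"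
          by (intro nn_integral_eq_integral) (auto simp: closed_approx_bounds)
        also have "(LINT y|extend_kernel S \<kappa> x. closed_approx C n y)
          = (if x \<in> S then LINT y|\<kappa> x. closed_approx C n y else closed_approx C n x)"
          by (auto simp: extend_kernel_def integral_return)
        finally show ?thesis .
      qed
      have meas: "(\<lambda>x. if x \<in> S then LINT y|\<kappa> x. closed_approx C n y else closed_approx C n x) \<in>
          borel_measurable borel" for n
      proof -
        have "(\<lambda>x. indicator S x *\<^sub>R (LINT y|\<kappa> x. closed_approx C n y) + indicator (- S) x *\<^sub>R closed_approx
            C n x) \<in> borel_measurable borel"
          by (intro borel_measurable_add borel_measurable_continuous_on_indicator[OF S cont[OF cC]]) measurable
        also have "(\<lambda>x. indicator S x *\<^sub>R (LINT y|\<kappa> x. closed_approx C n y) + indicator (- S) x *\<^sub>R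
            closed_approx C n x)
           = (\<lambda>x. if x \<in> S then LINT y|\<kappa> x. closed_approx C n y else closed_approx C n x)"
          by (auto simp: fun_eq_iff)
        finally show ?thesis .
      qed
      show ?thesis
      proof (rule borel_measurable_LIMSEQ_order)
        show "(\<lambda>x. \<integral>\<^sup>+y. ennreal (closed_approx C n y) \<partial>extend_kernel S \<kappa> x) \<in> borel_measurable borel" for n
          unfolding I using meas by measurable
        show "(\<lambda>n. \<integral>\<^sup>+y. ennreal (closed_approx C n y) \<partial>extend_kernel S \<kappa> x)
            \<longlonglongrightarrow> emeasure (extend_kernel S \<kappa> x) C" for x
          using nn_integral_closed_approx_tendsto[OF cC False prob_space.finite_measure[OF prob] sets, of
              "\<lambda>z. z"]
          by (simp add: sp)
      qed
    qed simp
    show "(\<lambda>x. emeasure (extend_kernel S \<kappa> x) UNIV) \<in> borel_measurable borel"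
      using prob_space.emeasure_space_1[OF prob] sp by simp
  qed auto
qed

section \<open>Convergence and uniqueness of laws on the axes\<close>

definition axes_law :: "(real \<times> real) measure \<Rightarrow> bool" where
  "axes_law \<mu> \<longleftrightarrow> prob_space \<mu> \<and> sets \<mu> = sets borel \<and> emeasure \<mu> axes = 1"

lemma axes_law_AE: "axes_law \<mu> \<Longrightarrow> AE z in \<mu>. z \<in> axes"
proof -
  assume \<mu>: "axes_law \<mu>"
  then interpret prob_space \<mu> by (simp add: axes_law_def)
  have "axes \<in> sets \<mu>" using \<mu> by (simp add: axes_law_def)
  moreover have "prob axes = 1" using \<mu> by (simp add: axes_law_def measure_def)
  ultimately show ?thesis by (rule prob_eq_1[THEN iffD1])
qed

lemma axes_law_integral: 
  assumes \<mu>: "axes_law \<mu>" and f: "f \<in> borel_measurable borel"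
  shows "(LINT z:axes|\<mu>. f z) = integral\<^sup>L \<mu> f"
  unfolding set_lebesgue_integral_def
  by (rule integral_cong_AE)
     (use \<mu> f axes_law_AE[OF \<mu>] in \<open>auto simp: axes_law_def cong: measurable_cong_sets elim: eventually_mono\<close>)

lemma axes_law_integrable:
  fixes f :: "real \<times> real \<Rightarrow> 'b::{banach, second_countable_topology}"
  assumes \<mu>: "axes_law \<mu>" and f: "f \<in> borel_measurable borel" and B: "\<And>z. z \<in> axes \<Longrightarrow> norm (f z) \<le> B"
  shows "integrable \<mu> f"
proof -
  interpret prob_space \<mu> using \<mu> by (simp add: axes_law_def)
  show ?thesis
    by (rule integrable_const_bound[where B=B])
       (use \<mu> f B axes_law_AE[OF \<mu>] in \<open>auto simp: axes_law_def cong: measurable_cong_sets elim: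
           eventually_mono\<close>)
qed

lemma axes_law_set_integrable:
  fixes f :: "real \<times> real \<Rightarrow> real"
  assumes \<mu>: "axes_law \<mu>" and f: "continuous_on axes f" and B: "\<And>z. z \<in> axes \<Longrightarrow> \<bar>f z\<bar> \<le> B"
  shows "set_integrable \<mu> axes f"
  unfolding set_integrable_def
  by (rule axes_law_integrable[OF \<mu>, where B=B])
     (use B borel_measurable_continuous_on_indicator[OF borel_quadrant_sets(3) f] in auto)

lemma axes_law_set_integral_bound:
  fixes f :: "real \<times> real \<Rightarrow> real"
  assumes \<mu>: "axes_law \<mu>" and f: "continuous_on axes f" and B: "\<And>z. z \<in> axes \<Longrightarrow> \<bar>f z\<bar> \<le> B"
  shows "\<bar>LINT z:axes|\<mu>. f z\<bar> \<le> B"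
proof -
  interpret prob_space \<mu> using \<mu> by (simp add: axes_law_def)
  have i: "integrable \<mu> (\<lambda>z. indicator axes z *\<^sub>R f z)"
    using axes_law_set_integrable[OF assms] by (simp add: set_integrable_def)
  have "0 \<le> B" using B[of "(0, 0)"] by (simp add: axes_iff)
  have "\<bar>LINT z:axes|\<mu>. f z\<bar> \<le> (LINT z|\<mu>. \<bar>indicator axes z *\<^sub>R f z\<bar>)"
    unfolding set_lebesgue_integral_def by (rule integral_abs_bound)
  also have "\<dots> \<le> (LINT z|\<mu>. B)"
    using i B \<open>0 \<le> B\<close> by (intro integral_mono) (auto split: split_indicator)
  finally show ?thesis by (simp add: prob_space)
qed

lemma mlf_span_bounded: "f \<in> mlf_span \<Longrightarrow> \<exists>B. \<forall>z\<in>axes. cmod (f z) \<le> B"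
proof (induction f rule: mlf_span.induct)
  case (mlf_span_base v c)
  then show ?case
    using cmod_mlf_le_1[OF _ mlf_span_base] axes_subset_quadrant
    by (intro exI[of _ "cmod c"]) (auto simp: norm_mult intro!: mult_left_le)
next
  case (mlf_span_add f g)
  then obtain A B where "\<forall>z\<in>axes. cmod (f z) \<le> A" "\<forall>z\<in>axes. cmod (g z) \<le> B" by blast
  then have "\<forall>z\<in>axes. cmod (f z + g z) \<le> A + B"
    by (auto intro: order_trans[OF norm_triangle_ineq add_mono])
  then show ?case by blast
qed

lemma measurable_mlf_span: "f \<in> mlf_span \<Longrightarrow> f \<in> borel_measurable borel"
  by (intro borel_measurable_continuous_onI continuous_on_mlf_span)

lemma mlf_span_integrable: "axes_law \<mu> \<Longrightarrow> f \<in> mlf_span \<Longrightarrow> integrable \<mu> f"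
  using mlf_span_bounded[of f] axes_law_integrable[of \<mu> f] measurable_mlf_span by blast

lemma mlf_span_integral_tendsto:
  assumes \<mu>: "\<forall>\<^sub>F i in G. axes_law (\<mu> i)" and \<nu>: "axes_law \<nu>"
    and conv: "\<And>v. v \<in> quadrant \<Longrightarrow> ((\<lambda>i. LINT z|\<mu> i. mlf z v) \<longlongrightarrow> (LINT z|\<nu>. mlf z v)) G"
    and g: "g \<in> mlf_span"
  shows "((\<lambda>i. LINT z|\<mu> i. g z) \<longlongrightarrow> (LINT z|\<nu>. g z)) G"
  using g
proof (induction g rule: mlf_span.induct)
  case (mlf_span_base v c)
  from conv[OF this] show ?case
    by (simp only: integral_mult_right_zero) (rule tendsto_mult_left)
next
  case (mlf_span_add f g)
  have "\<forall>\<^sub>F i in G. (LINT z|\<mu> i. f z) + (LINT z|\<mu> i. g z) = (LINT z|\<mu> i. f z + g z)"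
    using \<mu> by eventually_elim (use mlf_span_add mlf_span_integrable in simp)
  then show ?case
    using mlf_span_add \<nu> mlf_span_integrable[OF \<nu>]
    by (subst tendsto_cong[symmetric]) (auto intro: tendsto_add)
qed

text \<open>A function with a limit at infinity is uniformly close on the axes to a member of \<open>mlf_span\<close>, whose
integrals converge by linearity.\<close>

lemma integral_tendsto_of_limit_at_infinity:
  assumes \<mu>: "\<forall>\<^sub>F i in G. axes_law (\<mu> i)" and \<nu>: "axes_law \<nu>"
    and conv: "\<And>v. v \<in> quadrant \<Longrightarrow> ((\<lambda>i. LINT z|\<mu> i. mlf z v) \<longlongrightarrow> (LINT z|\<nu>. mlf z v)) G"
    and f: "continuous_on axes f" "(f \<longlongrightarrow> L) axes_at_infinity"
  shows "((\<lambda>i. LINT z:axes|\<mu> i. f z) \<longlongrightarrow> (LINT z:axes|\<nu>. f z :: real)) G"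
proof (rule tendstoI)
  fix e :: real assume e: "0 < e"
  obtain g where g: "g \<in> mlf_span" and fg: "\<And>z. z \<in> axes \<Longrightarrow> \<bar>f z - Re (g z)\<bar> < e / 3"
    using mlf_span_dense[OF f, of "e / 3"] e by auto
  obtain B where B: "\<And>z. z \<in> axes \<Longrightarrow> cmod (g z) \<le> B" using mlf_span_bounded[OF g] by blast
  have cont: "continuous_on axes (\<lambda>z. f z - Re (g z))" "continuous_on axes (\<lambda>z. Re (g z))"
    by (intro continuous_intros f continuous_on_mlf_span g)+
  have diff: "\<bar>(LINT z:axes|\<rho>. f z) - Re (LINT z|\<rho>. g z)\<bar> \<le> e / 3" if \<rho>: "axes_law \<rho>" for \<rho>
  proof -
    have B': "\<bar>Re (g z)\<bar> \<le> B" if "z \<in> axes" for z using B[OF that] abs_Re_le_cmod[of "g z"] by linarith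
    have fB: "\<bar>f z\<bar> \<le> B + e" if "z \<in> axes" for z using B'[OF that] fg[OF that] e by linarith
    have "Re (LINT z|\<rho>. g z) = (LINT z|\<rho>. Re (g z))"
      using mlf_span_integrable[OF \<rho> g] by simp
    also have "\<dots> = (LINT z:axes|\<rho>. Re (g z))"
      using measurable_mlf_span[OF g] by (subst axes_law_integral[OF \<rho>]) auto
    finally have "(LINT z:axes|\<rho>. f z) - Re (LINT z|\<rho>. g z) = (LINT z:axes|\<rho>. f z - Re (g z))"
      using axes_law_set_integrable[OF \<rho> f(1) fB] axes_law_set_integrable[OF \<rho> cont(2) B'] by simp
    also have "\<bar>\<dots>\<bar> \<le> e / 3"
      by (rule axes_law_set_integral_bound[OF \<rho> cont(1)]) (use fg less_imp_le in blast)
    finally show ?thesis .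
  qed
  have "((\<lambda>i. Re (LINT z|\<mu> i. g z)) \<longlongrightarrow> Re (LINT z|\<nu>. g z)) G"
    by (intro tendsto_intros mlf_span_integral_tendsto[OF \<mu> \<nu> conv g])
  then have "\<forall>\<^sub>F i in G. dist (Re (LINT z|\<mu> i. g z)) (Re (LINT z|\<nu>. g z)) < e / 3"
    using e by (intro tendstoD) auto
  with \<mu> show "\<forall>\<^sub>F i in G. dist (LINT z:axes|\<mu> i. f z) (LINT z:axes|\<nu>. f z) < e"
  proof eventually_elim
    case (elim i)
    then show ?case using diff[OF elim(1)] diff[OF \<nu>] unfolding dist_real_def by linarith
  qed
qed

text \<open>A bounded continuous function need not have a limit at infinity. Multiplied by a cut-off it has one, and
the cut-off loses little mass because the limit \<open>\<nu>\<close> is a probability measure and the integrals of the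
cut-off itself converge.\<close>

theorem weakly_converges_mlf:
  assumes \<mu>: "\<forall>\<^sub>F i in G. axes_law (\<mu> i)" and \<nu>: "axes_law \<nu>"
    and conv: "\<And>v. v \<in> quadrant \<Longrightarrow> ((\<lambda>i. LINT z|\<mu> i. mlf z v) \<longlongrightarrow> (LINT z|\<nu>. mlf z v)) G"
  shows "weakly_converges_on axes \<mu> \<nu> G"
  unfolding weakly_converges_on_def
proof (intro allI impI tendstoI)
  fix f :: "real \<times> real \<Rightarrow> real" and e :: real
  assume f: "continuous_on axes f" and "bounded (f ` axes)" and e: "0 < e"
  then obtain C where C: "\<And>z. z \<in> axes \<Longrightarrow> \<bar>f z\<bar> \<le> C" by (auto simp: bounded_iff)
  have C0: "0 \<le> C" using C[of "(0, 0)"] by (simp add: axes_iff)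
  define cut where "cut R z = max 0 (min 1 (R + 1 - (fst z + snd z)))" for R :: real and z :: "real \<times> real"
  have cut: "0 \<le> cut R z" "cut R z \<le> 1" for R z by (auto simp: cut_def)
  have cut_cont: "continuous_on A (cut R)" for A R unfolding cut_def by (intro continuous_intros)
  have vanish: "((\<lambda>z. h z * cut R z) \<longlongrightarrow> 0) axes_at_infinity" for h R
  proof (rule tendsto_eventually)
    show "\<forall>\<^sub>F z in axes_at_infinity. h z * cut R z = 0"
      unfolding axes_at_infinity_def eventually_inf_principal eventually_filtercomap_at_top_linorder
      by (rule exI[of _ "R + 1"]) (auto simp: cut_def)
  qed
  have cut_lim: "((\<lambda>i. LINT z:axes|\<mu> i. cut R z) \<longlongrightarrow> (LINT z:axes|\<nu>. cut R z)) G" for R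
    using vanish[of "\<lambda>_. 1" R] by (intro integral_tendsto_of_limit_at_infinity[OF \<mu> \<nu> conv cut_cont]) simp_all
  have fcut_lim: "((\<lambda>i. LINT z:axes|\<mu> i. f z * cut R z) \<longlongrightarrow> (LINT z:axes|\<nu>. f z * cut R z)) G" for R
    by (rule integral_tendsto_of_limit_at_infinity[OF \<mu> \<nu> conv _ vanish]) (assumption | intro
        continuous_intros f cut_cont)+
  interpret \<nu>: prob_space \<nu> using \<nu> by (simp add: axes_law_def)
  have "(\<lambda>n. LINT z:axes|\<nu>. cut (real n) z) \<longlonglongrightarrow> (LINT z:axes|\<nu>. 1)"
    unfolding set_lebesgue_integral_def
  proof (rule integral_dominated_convergence[where w="\<lambda>_. 1"])
    have [measurable]: "cut R \<in> borel_measurable borel" for R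
      by (intro borel_measurable_continuous_onI cut_cont)
    show "(\<lambda>z. indicator axes z *\<^sub>R cut (real n) z) \<in> borel_measurable \<nu>" for n
      using \<nu> by (simp add: axes_law_def cong: measurable_cong_sets)
    show "(\<lambda>z. indicator axes z *\<^sub>R (1::real)) \<in> borel_measurable \<nu>"
      using \<nu> by (simp add: axes_law_def cong: measurable_cong_sets)
    show "AE z in \<nu>. (\<lambda>n. indicator axes z *\<^sub>R cut (real n) z) \<longlonglongrightarrow> indicator axes z *\<^sub>R 1"
    proof (intro AE_I2 tendsto_scaleR tendsto_const tendsto_eventually)
      fix z :: "real \<times> real"
      obtain N where "fst z + snd z < real N" using reals_Archimedean2 by blast
      then have "cut (real n) z = 1" if "N \<le> n" for n using that by (auto simp: cut_def)
      then show "\<forall>\<^sub>F n in sequentially. cut (real n) z = 1" by (auto simp: eventually_sequentially)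
    qed
  qed (auto simp: cut split: split_indicator)
  moreover have one: "(LINT z:axes|\<rho>. 1) = (1::real)" if "axes_law \<rho>" for \<rho>
    using that by (subst axes_law_integral) (auto simp: axes_law_def prob_space.prob_space)
  ultimately have "(\<lambda>n. LINT z:axes|\<nu>. cut (real n) z) \<longlonglongrightarrow> 1" using \<nu> by simp
  moreover define d where "d = e / (4 * (C + 1))"
  have d: "0 < d" "C * d \<le> e / 4" using e C0 by (auto simp: d_def field_simps)
  ultimately have "\<forall>\<^sub>F n in sequentially. 1 - d < (LINT z:axes|\<nu>. cut (real n) z)"
    by (intro order_tendstoD) auto
  then obtain R where R: "1 - d < (LINT z:axes|\<nu>. cut R z)" by (auto simp: eventually_sequentially)
  have diff: "\<bar>(LINT z:axes|\<rho>. f z) - (LINT z:axes|\<rho>. f z * cut R z)\<bar> \<le> C * (1 - (LINT z:axes|\<rho>. cut R z))"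
    if \<rho>: "axes_law \<rho>" for \<rho>
  proof -
    have i: "set_integrable \<rho> axes f" "set_integrable \<rho> axes (\<lambda>z. f z * cut R z)"
      "set_integrable \<rho> axes (cut R)" "set_integrable \<rho> axes (\<lambda>z. 1 :: real)"
      by (rule axes_law_set_integrable[OF \<rho> f C], assumption,
          rule axes_law_set_integrable[OF \<rho> _, where B=C],
          (intro continuous_intros f cut_cont)[1],
          (use C cut C0 in \<open>auto simp: abs_mult intro!: order_trans[OF mult_left_le]\<close>)[1],
          rule axes_law_set_integrable[OF \<rho> cut_cont, where B=1], use cut in simp,
          rule axes_law_set_integrable[OF \<rho>, where B=1], auto)
    have "\<bar>(LINT z:axes|\<rho>. f z) - (LINT z:axes|\<rho>. f z * cut R z)\<bar> = \<bar>LINT z:axes|\<rho>. f z - f z * cut R z\<bar>"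
      using i by simp
    also have "\<dots> \<le> (LINT z|\<rho>. \<bar>indicator axes z *\<^sub>R (f z - f z * cut R z)\<bar>)"
      unfolding set_lebesgue_integral_def by (rule integral_abs_bound)
    also have "\<dots> \<le> (LINT z:axes|\<rho>. C * (1 - cut R z))"
      unfolding set_lebesgue_integral_def
    proof (rule integral_mono)
      have "set_integrable \<rho> axes (\<lambda>z. f z - f z * cut R z)" using i by simp
      then show "integrable \<rho> (\<lambda>z. \<bar>indicator axes z *\<^sub>R (f z - f z * cut R z)\<bar>)"
        unfolding set_integrable_def by (rule integrable_abs)
      have "set_integrable \<rho> axes (\<lambda>z. C * (1 - cut R z))" using i by simp
      then show "integrable \<rho> (\<lambda>z. indicator axes z *\<^sub>R (C * (1 - cut R z)))"
        unfolding set_integrable_def .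
      fix z
      have "\<bar>f z - f z * cut R z\<bar> \<le> C * (1 - cut R z)" if "z \<in> axes"
      proof -
        have "f z - f z * cut R z = f z * (1 - cut R z)" by (simp add: algebra_simps)
        then have "\<bar>f z - f z * cut R z\<bar> = \<bar>f z\<bar> * (1 - cut R z)" using cut[of R z] by (simp add: abs_mult)
        also have "\<dots> \<le> C * (1 - cut R z)" using C[OF that] cut[of R z] by (intro mult_right_mono) auto
        finally show ?thesis .
      qed
      then show "\<bar>indicator axes z *\<^sub>R (f z - f z * cut R z)\<bar> \<le> indicator axes z *\<^sub>R (C * (1 - cut R z))"
        by (simp split: split_indicator)
    qed
    also have "\<dots> = C * (1 - (LINT z:axes|\<rho>. cut R z))"
      using i one[OF \<rho>] by simp
    finally show ?thesis .
  qed
  have "\<forall>\<^sub>F i in G. 1 - d < (LINT z:axes|\<mu> i. cut R z)"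
    using cut_lim R by (rule order_tendstoD)
  moreover have "\<forall>\<^sub>F i in G. dist (LINT z:axes|\<mu> i. f z * cut R z) (LINT z:axes|\<nu>. f z * cut R z) < e / 4"
    using fcut_lim e by (intro tendstoD) auto
  ultimately show "\<forall>\<^sub>F i in G. dist (LINT z:axes|\<mu> i. f z) (LINT z:axes|\<nu>. f z) < e"
    using \<mu>
  proof eventually_elim
    case (elim i)
    have "C * (1 - (LINT z:axes|\<rho>. cut R z)) \<le> e / 4" if "1 - d < (LINT z:axes|\<rho>. cut R z)" for \<rho>
      using that d C0 by (intro order_trans[OF mult_left_mono d(2)]) auto
    from this[OF R] this[OF elim(1)] diff[OF \<nu>] diff[OF elim(3)] elim(2) e
    show ?case unfolding dist_real_def by linarith
  qed
qed

theorem axes_law_eqI_mlf: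
  assumes \<mu>: "axes_law \<mu>" and \<nu>: "axes_law \<nu>"
    and eq: "\<And>v. v \<in> quadrant \<Longrightarrow> (LINT z|\<mu>. mlf z v) = (LINT z|\<nu>. mlf z v)"
  shows "\<mu> = \<nu>"
proof (rule measure_eqI_closed_approx)
  have w: "weakly_converges_on axes (\<lambda>_. \<mu>) \<nu> sequentially"
    by (rule weakly_converges_mlf) (use \<mu> \<nu> eq in auto)
  fix C :: "(real \<times> real) set" and n assume "closed C"
  have "bounded (closed_approx C n ` axes)"
    by (rule boundedI[where B=1]) (auto simp: closed_approx_bounds)
  with w have "(\<lambda>i::nat. LINT z:axes|\<mu>. closed_approx C n z) \<longlonglongrightarrow> (LINT z:axes|\<nu>. closed_approx C n z)"
    unfolding weakly_converges_on_def using continuous_on_closed_approx by blast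
  then have *: "integral\<^sup>L \<mu> (closed_approx C n) = integral\<^sup>L \<nu> (closed_approx C n)"
    by (simp add: LIMSEQ_const_iff axes_law_integral \<mu> \<nu>)
  have "(\<integral>\<^sup>+z. ennreal (closed_approx C n z) \<partial>\<rho>) = ennreal (integral\<^sup>L \<rho> (closed_approx C n))"
      if "axes_law \<rho>" for \<rho>
    by (intro nn_integral_eq_integral axes_law_integrable[OF that, where B=1]) (auto simp: closed_approx_bounds)
  then show "(\<integral>\<^sup>+z. ennreal (closed_approx C n z) \<partial>\<mu>) = (\<integral>\<^sup>+z. ennreal (closed_approx C n z) \<partial>\<nu>)"
    using \<mu> \<nu> * by simp
qed (use \<mu> \<nu> in \<open>auto simp: axes_law_def prob_space.finite_measure\<close>)

section \<open>The strong Markov property of Feller processes\<close>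

text \<open>The grid point is strictly larger than \<open>\<sigma>\<close>, as needed for limits along \<open>at_right \<sigma>\<close>.\<close>

definition round_up :: "nat \<Rightarrow> real \<Rightarrow> real" where
  "round_up n \<sigma> = (real (nat \<lfloor>2 ^ n * \<sigma>\<rfloor>) + 1) / 2 ^ n"

lemma round_up_bounds:
  assumes "0 \<le> \<sigma>" shows "\<sigma> < round_up n \<sigma>" "round_up n \<sigma> \<le> \<sigma> + 1 / 2 ^ n"
proof -
  have "real (nat \<lfloor>2 ^ n * \<sigma>\<rfloor>) = of_int \<lfloor>2 ^ n * \<sigma>\<rfloor>" using assms by (subst of_nat_nat) auto
  then have "2 ^ n * \<sigma> < real (nat \<lfloor>2 ^ n * \<sigma>\<rfloor>) + 1" "real (nat \<lfloor>2 ^ n * \<sigma>\<rfloor>) + 1 \<le> 2 ^ n * \<sigma> + 1"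
    by linarith+
  then show "\<sigma> < round_up n \<sigma>" "round_up n \<sigma> \<le> \<sigma> + 1 / 2 ^ n"
    by (simp_all add: round_up_def field_simps)
qed

lemma round_up_at_right:
  assumes "0 \<le> \<sigma>" shows "filterlim (\<lambda>n. round_up n \<sigma>) (at_right \<sigma>) sequentially"
  unfolding filterlim_at
proof
  show "\<forall>\<^sub>F n in sequentially. round_up n \<sigma> \<in> {\<sigma><..} \<and> round_up n \<sigma> \<noteq> \<sigma>"
    using round_up_bounds(1)[OF assms] by (auto intro!: always_eventually simp: less_imp_neq[symmetric])
  have "(\<lambda>n. \<sigma> + (1 / 2) ^ n) \<longlonglongrightarrow> \<sigma> + 0"
    by (intro tendsto_intros LIMSEQ_realpow_zero) auto
  then have lim: "(\<lambda>n. \<sigma> + 1 / 2 ^ n) \<longlonglongrightarrow> \<sigma>"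
    unfolding power_one_over by simp
  show "(\<lambda>n. round_up n \<sigma>) \<longlonglongrightarrow> \<sigma>"
  proof (rule tendsto_sandwich[OF _ _ tendsto_const lim])
    show "\<forall>\<^sub>F n in sequentially. \<sigma> \<le> round_up n \<sigma>"
      by (intro always_eventually allI less_imp_le round_up_bounds assms)
    show "\<forall>\<^sub>F n in sequentially. round_up n \<sigma> \<le> \<sigma> + 1 / 2 ^ n"
      by (intro always_eventually allI round_up_bounds assms)
  qed
qed

lemma emeasure_distr_restricted:
  assumes A: "A \<in> sets M" and Z[measurable]: "Z \<in> M \<rightarrow>\<^sub>M L" and C: "C \<in> sets L"
  shows "emeasure (distr (density M (indicator A)) L Z) C = emeasure M {\<omega>\<in>A. Z \<omega> \<in> C}"
proof -
  have "{\<omega>\<in>A. Z \<omega> \<in> C} = A \<inter> (Z -` C \<inter> space M)"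
    using sets.sets_into_space[OF A] by auto
  then have "{\<omega>\<in>A. Z \<omega> \<in> C} \<in> sets M" using A measurable_sets[OF Z C] by auto
  moreover have "emeasure (distr (density M (indicator A)) L Z) C
      = (\<integral>\<^sup>+\<omega>. indicator A \<omega> * indicator (Z -` C \<inter> space M) \<omega> \<partial>M)"
    using A C by (simp add: emeasure_distr emeasure_density)
  moreover have "\<dots> = (\<integral>\<^sup>+\<omega>. indicator {\<omega>\<in>A. Z \<omega> \<in> C} \<omega> \<partial>M)"
    by (intro nn_integral_cong) (auto split: split_indicator)
  ultimately show ?thesis by simp
qed

lemma emeasure_bind_restricted:
  assumes A[measurable]: "A \<in> sets M" and Y[measurable]: "Y \<in> M \<rightarrow>\<^sub>M N"
    and K[measurable]: "K \<in> N \<rightarrow>\<^sub>M subprob_algebra L" and N: "space N \<noteq> {}" and C[measurable]: "C \<in> sets L"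
  shows "emeasure (distr (density M (indicator A)) N Y \<bind> K) C = (\<integral>\<^sup>+\<omega>\<in>A. emeasure (K (Y \<omega>)) C \<partial>M)"
proof -
  have [measurable]: "(\<lambda>y. emeasure (K y) C) \<in> borel_measurable N"
    by (intro measurable_compose[OF K measurable_emeasure_subprob_algebra]) simp
  show ?thesis
    using N by (subst emeasure_bind[where N=L]) (auto simp: nn_integral_distr nn_integral_density mult.commute)
qed

text \<open>The hypothesis is an equality of two measures: the law of \<open>Z\<close> on the event \<open>A\<close>, and the mixture of the
kernels \<open>K\<close> over the law of \<open>Y\<close> on \<open>A\<close>.\<close>

lemma nn_integral_kernel:
  fixes h :: "'c \<Rightarrow> ennreal"
  assumes A[measurable]: "A \<in> sets M" and Y[measurable]: "Y \<in> M \<rightarrow>\<^sub>M N" and Z[measurable]: "Z \<in> M \<rightarrow>\<^sub>M L"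
    and K[measurable]: "K \<in> N \<rightarrow>\<^sub>M subprob_algebra L" and N: "space N \<noteq> {}"
    and eq: "\<And>C. C \<in> sets L \<Longrightarrow> emeasure M {\<omega>\<in>A. Z \<omega> \<in> C} = (\<integral>\<^sup>+\<omega>\<in>A. emeasure (K (Y \<omega>)) C \<partial>M)"
    and h[measurable]: "h \<in> borel_measurable L"
  shows "(\<integral>\<^sup>+\<omega>\<in>A. h (Z \<omega>) \<partial>M) = (\<integral>\<^sup>+\<omega>\<in>A. (\<integral>\<^sup>+z. h z \<partial>K (Y \<omega>)) \<partial>M)"
proof -
  let ?M = "density M (indicator A)"
  note [measurable] = nn_integral_measurable_subprob_algebra
  have "distr ?M L Z = distr ?M N Y \<bind> K"
  proof (rule measure_eqI)
    show "sets (distr ?M L Z) = sets (distr ?M N Y \<bind> K)"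
      using N sets_kernel[OF K] by (subst sets_bind[where N=L]) auto
    fix C assume "C \<in> sets (distr ?M L Z)"
    then have C: "C \<in> sets L" by simp
    show "emeasure (distr ?M L Z) C = emeasure (distr ?M N Y \<bind> K) C"
      unfolding emeasure_distr_restricted[OF A Z C] emeasure_bind_restricted[OF A Y K N C] by (rule eq[OF C])
  qed
  then have "(\<integral>\<^sup>+z. h z \<partial>distr ?M L Z) = (\<integral>\<^sup>+y. (\<integral>\<^sup>+z. h z \<partial>K y) \<partial>distr ?M N Y)"
    by (simp add: nn_integral_bind[where B=L])
  then show ?thesis
    by (simp add: nn_integral_distr nn_integral_density mult.commute)
qed

locale feller_kernel =
  fixes S :: "'e::metric_space set" and p :: "real \<Rightarrow> 'e \<Rightarrow> 'e measure"
  assumes feller: "feller S p"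
    and S[measurable]: "S \<in> sets borel"
    and kernel: "\<And>t x. 0 \<le> t \<Longrightarrow> x \<in> S \<Longrightarrow> prob_space (p t x)"
      "\<And>t x. 0 \<le> t \<Longrightarrow> x \<in> S \<Longrightarrow> sets (p t x) = sets borel"
      "\<And>t x. 0 \<le> t \<Longrightarrow> x \<in> S \<Longrightarrow> emeasure (p t x) S = 1"
begin

definition \<kappa> :: "real \<Rightarrow> 'e \<Rightarrow> 'e measure" where
  "\<kappa> t = extend_kernel S (p t)"

lemma kernel_integral_continuous:
  assumes t: "0 \<le> t" and f: "continuous_on UNIV (f :: 'e \<Rightarrow> real)" "bounded (range f)"
  shows "continuous_on S (\<lambda>x. LINT y|p t x. f y)"
proof -
  have [measurable]: "f \<in> borel_measurable borel" by (rule borel_measurable_continuous_onI[OF f(1)])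
  have eq: "(LINT y:S|p t x. f y) = (LINT y|p t x. f y)" if x: "x \<in> S" for x
  proof -
    interpret prob_space "p t x" by (rule kernel[OF t x])
    have "S \<in> events" using kernel(2)[OF t x] by simp
    moreover have "prob S = 1" using kernel(3)[OF t x] by (simp add: measure_def)
    ultimately have "AE y in p t x. y \<in> S" by (rule prob_eq_1[THEN iffD1])
    then show ?thesis
      unfolding set_lebesgue_integral_def using kernel(2)[OF t x]
      by (intro integral_cong_AE) (auto cong: measurable_cong_sets elim: eventually_mono)
  qed
  have "((\<lambda>y. LINT z:S|p t y. f z) \<longlongrightarrow> (LINT z:S|p t x. f z)) (at x within S)" if "x \<in> S" for x
    using feller that t continuous_on_subset[OF f(1)] bounded_subset[OF f(2), of "f ` S"]
    unfolding feller_def weakly_converges_on_def by blast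
  moreover have "((\<lambda>y. LINT z:S|p t y. f z) \<longlongrightarrow> (LINT z:S|p t x. f z)) (at x within S)
      \<longleftrightarrow> ((\<lambda>y. LINT z|p t y. f z) \<longlongrightarrow> (LINT z|p t x. f z)) (at x within S)" if "x \<in> S" for x
    unfolding eq[OF that] by (intro tendsto_cong) (auto simp: eventually_at_filter eq)
  ultimately show ?thesis unfolding continuous_on_def by blast
qed

lemma bounded_closed_approx: "bounded (range (closed_approx C n))"
  by (rule boundedI[where B=1]) (auto simp: closed_approx_bounds)

lemma measurable_\<kappa>_prob: "0 \<le> t \<Longrightarrow> \<kappa> t \<in> borel \<rightarrow>\<^sub>M prob_algebra borel"
  unfolding \<kappa>_def
  by (intro measurable_extend_kernel S kernel kernel_integral_continuous continuous_on_closed_approx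
      bounded_closed_approx)

lemma measurable_\<kappa>: "0 \<le> t \<Longrightarrow> \<kappa> t \<in> borel \<rightarrow>\<^sub>M subprob_algebra borel"
  using measurable_\<kappa>_prob measurable_prob_algebraD by blast

lemma \<kappa>_eq: "y \<in> S \<Longrightarrow> \<kappa> t y = p t y"
  by (simp add: \<kappa>_def extend_kernel_def)

end

locale feller_markov = feller_kernel S p
  for S :: "'e::metric_space set" and p :: "real \<Rightarrow> 'e \<Rightarrow> 'e measure" +
  fixes F :: "ennreal \<Rightarrow> 'w measure" and P :: "'e \<Rightarrow> 'w measure" and X :: "real \<Rightarrow> 'w \<Rightarrow> 'e"
  assumes markov: "markov_process S p F P X"
    and right_continuous: "\<And>\<omega> t. \<omega> \<in> space (F 0) \<Longrightarrow> 0 \<le> t \<Longrightarrow> ((\<lambda>t. X t \<omega>) \<longlongrightarrow> X t \<omega>) (at_right t)"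
begin

abbreviation \<Omega> :: "'w set" where "\<Omega> \<equiv> space (F 0)"

sublocale filtration \<Omega> F
  using markov by (simp add: markov_process_def)

lemma X_adapted: "0 \<le> t \<Longrightarrow> X t \<in> borel_measurable (F (ennreal t))"
  and X_in: "0 \<le> t \<Longrightarrow> \<omega> \<in> \<Omega> \<Longrightarrow> X t \<omega> \<in> S"
  and prob_P: "x \<in> S \<Longrightarrow> prob_space (P x)"
  and subalgebra_F: "x \<in> S \<Longrightarrow> subalgebra (P x) (F u)"
  and X_start: "x \<in> S \<Longrightarrow> AE \<omega> in P x. X 0 \<omega> = x"
  and cond_exp_X: "x \<in> S \<Longrightarrow> 0 \<le> s \<Longrightarrow> 0 \<le> t \<Longrightarrow> C \<in> sets borel \<Longrightarrow> AE \<omega> in P x.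
      real_cond_exp (P x) (F (ennreal s)) (\<lambda>\<omega>'. indicator C (X (s + t) \<omega>')) \<omega> = measure (p t (X s \<omega>)) C"
  using markov unfolding markov_process_def by blast+

lemma space_P: "x \<in> S \<Longrightarrow> space (P x) = \<Omega>"
  using subalgebra_F[of x 0] by (simp add: subalgebra_def)

lemma sets_F_subset: "x \<in> S \<Longrightarrow> sets (F u) \<subseteq> sets (P x)"
  using subalgebra_F[of x u] by (simp add: subalgebra_def)

lemma X_measurable:
  assumes "0 \<le> t" "space N = \<Omega>" "sets (F (ennreal t)) \<subseteq> sets N"
  shows "X t \<in> borel_measurable N"
  using X_adapted[OF assms(1)] assms(2,3) space_F[of "ennreal t"] by (auto simp: measurable_def)

lemma X_measurable_P [measurable (raw)]: "x \<in> S \<Longrightarrow> 0 \<le> t \<Longrightarrow> X t \<in> borel_measurable (P x)"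
  by (intro X_measurable space_P sets_F_subset)

lemma markov_step:
  assumes x: "x \<in> S" and s: "0 \<le> s" and t: "0 \<le> t"
      and A: "A \<in> sets (F (ennreal s))" and C[measurable]: "C \<in> sets borel"
  shows "emeasure (P x) {\<omega>\<in>A. X (s + t) \<omega> \<in> C} = (\<integral>\<^sup>+\<omega>\<in>A. emeasure (\<kappa> t (X s \<omega>)) C \<partial>P x)"
proof -
  interpret prob_space "P x" by (rule prob_P[OF x])
  interpret finite_measure_subalgebra "P x" "F (ennreal s)"
    by standard (rule subalgebra_F[OF x])
  have AP[measurable]: "A \<in> sets (P x)" using A sets_F_subset[OF x] by blast
  have A_sub: "A \<subseteq> \<Omega>" using sets.sets_into_space[OF A] space_F[of "ennreal s"] by blast
  note [measurable] = X_measurable_P[OF x] measurable_compose[OF _ measurable_compose[OF measurable_\<kappa>[OF t]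
      measurable_emeasure_subprob_algebra]]
  have st: "0 \<le> s + t" using s t by simp
  have int: "integrable (P x) (\<lambda>\<omega>. indicator C (X (s + t) \<omega>) :: real)"
    using st by (intro integrable_const_bound[where B=1]) auto
  have le1: "measure (p t (X s \<omega>)) C \<le> 1" if "\<omega> \<in> \<Omega>" for \<omega>
    using kernel(1)[OF t X_in[OF s that]] by (rule prob_space.prob_le_1)
  have em: "emeasure (\<kappa> t (X s \<omega>)) C = ennreal (measure (p t (X s \<omega>)) C)" if "\<omega> \<in> \<Omega>" for \<omega>
  proof -
    interpret K: prob_space "p t (X s \<omega>)" by (rule kernel(1)[OF t X_in[OF s that]])
    show ?thesis using X_in[OF s that] by (simp add: \<kappa>_eq K.emeasure_eq_measure)
  qed
  have meas: "(\<lambda>\<omega>. measure (p t (X s \<omega>)) C) \<in> borel_measurable (P x)"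
  proof -
    have "(\<lambda>\<omega>. enn2real (emeasure (\<kappa> t (X s \<omega>)) C)) \<in> borel_measurable (P x)"
      using s by measurable
    then show ?thesis
      by (rule measurable_cong[THEN iffD1, rotated]) (auto simp: em space_P[OF x])
  qed
  have eq: "{\<omega>\<in>A. X (s + t) \<omega> \<in> C} = {\<omega>\<in>space (P x). \<omega> \<in> A \<and> X (s + t) \<omega> \<in> C}"
    using A_sub by (auto simp: space_P[OF x])
  have sets: "{\<omega>\<in>A. X (s + t) \<omega> \<in> C} \<in> events"
    unfolding eq using st by measurable
  have "emeasure (P x) {\<omega>\<in>A. X (s + t) \<omega> \<in> C} = ennreal (prob {\<omega>\<in>A. X (s + t) \<omega> \<in> C})"
    by (rule emeasure_eq_measure)
  also have "prob {\<omega>\<in>A. X (s + t) \<omega> \<in> C} = (LINT \<omega>|P x. indicator {\<omega>\<in>A. X (s + t) \<omega> \<in> C} \<omega>)"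
    using sets by simp
  also have "\<dots> = (LINT \<omega>:A|P x. indicator C (X (s + t) \<omega>))"
    unfolding set_lebesgue_integral_def
        by (intro Bochner_Integration.integral_cong) (auto split: split_indicator)
  also have "\<dots> = (LINT \<omega>:A|P x. real_cond_exp (P x) (F (ennreal s)) (\<lambda>\<omega>'. indicator C (X (s + t) \<omega>')) \<omega>)"
    by (rule real_cond_exp_intA[OF int A])
  also have "\<dots> = (LINT \<omega>:A|P x. measure (p t (X s \<omega>)) C)"
    unfolding set_lebesgue_integral_def
    by (rule integral_cong_AE) (use meas cond_exp_X[OF x s t C] in \<open>auto elim: eventually_mono\<close>)
  also have "ennreal \<dots> = (\<integral>\<^sup>+\<omega>. ennreal (indicator A \<omega> *\<^sub>R measure (p t (X s \<omega>)) C) \<partial>P x)"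
    unfolding set_lebesgue_integral_def
  proof (rule nn_integral_eq_integral[symmetric])
    show "integrable (P x) (\<lambda>\<omega>. indicator A \<omega> *\<^sub>R measure (p t (X s \<omega>)) C)"
      using meas le1 by (intro integrable_const_bound[where B=1]) (auto simp: space_P[OF x] split:
          split_indicator)
  qed auto
  also have "\<dots> = (\<integral>\<^sup>+\<omega>\<in>A. emeasure (\<kappa> t (X s \<omega>)) C \<partial>P x)"
    by (intro nn_integral_cong) (auto simp: em space_P[OF x] split: split_indicator)
  finally show ?thesis .
qed

text \<open>Progressive measurability: by right-continuity the value at \<open>min \<sigma> u\<close> is a limit of values at countably
valued times that do not exceed \<open>u\<close>.\<close>

lemma X_at_measurable:
  fixes \<sigma> :: "'w \<Rightarrow> real"
  assumes N: "space N = \<Omega>" "\<And>s. 0 \<le> s \<Longrightarrow> s \<le> u \<Longrightarrow> sets (F (ennreal s)) \<subseteq> sets N" and u: "0 \<le> u"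
    and \<sigma>[measurable]: "\<sigma> \<in> borel_measurable N" and nn: "\<And>\<omega>. \<omega> \<in> \<Omega> \<Longrightarrow> 0 \<le> \<sigma> \<omega>"
  shows "(\<lambda>\<omega>. X (min (\<sigma> \<omega>) u) \<omega>) \<in> borel_measurable N"
proof (rule borel_measurable_LIMSEQ_metric)
  fix n
  show "(\<lambda>\<omega>. X (min (round_up n (\<sigma> \<omega>)) u) \<omega>) \<in> borel_measurable N"
    unfolding round_up_def
    by (rule measurable_compose_countable[where f="\<lambda>k. X (min ((real k + 1) / 2 ^ n) u)" and g="\<lambda>\<omega>. nat \<lfloor>2 ^
        n * \<sigma> \<omega>\<rfloor>"])
       (use u in \<open>auto intro!: X_measurable[OF _ N(1) N(2)]\<close>)
next
  fix \<omega> assume "\<omega> \<in> space N"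
  then have \<omega>: "\<omega> \<in> \<Omega>" by (simp add: N)
  show "(\<lambda>n. X (min (round_up n (\<sigma> \<omega>)) u) \<omega>) \<longlonglongrightarrow> X (min (\<sigma> \<omega>) u) \<omega>"
  proof (cases "\<sigma> \<omega> < u")
    case True
    have lim: "(\<lambda>n. X (round_up n (\<sigma> \<omega>)) \<omega>) \<longlonglongrightarrow> X (\<sigma> \<omega>) \<omega>"
      by (rule filterlim_compose[OF right_continuous[OF \<omega> nn[OF \<omega>]] round_up_at_right[OF nn[OF \<omega>]]])
    have "(\<lambda>n. round_up n (\<sigma> \<omega>)) \<longlonglongrightarrow> \<sigma> \<omega>"
      using round_up_at_right[OF nn[OF \<omega>]] by (simp add: filterlim_at)
    from order_tendstoD(2)[OF this True]
    have "\<forall>\<^sub>F n in sequentially. X (round_up n (\<sigma> \<omega>)) \<omega> = X (min (round_up n (\<sigma> \<omega>)) u) \<omega>"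
      by eventually_elim simp
    from Lim_transform_eventually[OF lim this] show ?thesis using True by simp
  next
    case False
    then have "min (round_up n (\<sigma> \<omega>)) u = u" for n
      using round_up_bounds(1)[OF nn[OF \<omega>], of n] by auto
    then show ?thesis using False by simp
  qed
qed

lemma X_at_measurable_P:
  assumes x: "x \<in> S" and [measurable]: "\<sigma> \<in> borel_measurable (P x)" and nn: "\<And>\<omega>. \<omega> \<in> \<Omega> \<Longrightarrow> 0 \<le> \<sigma> \<omega>"
  shows "(\<lambda>\<omega>. X (\<sigma> \<omega>) \<omega>) \<in> borel_measurable (P x)"
proof (rule borel_measurable_LIMSEQ_metric)
  show "(\<lambda>\<omega>. X (min (\<sigma> \<omega>) (real n)) \<omega>) \<in> borel_measurable (P x)" for n
    by (intro X_at_measurable) (use x space_P sets_F_subset nn in auto)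
  fix \<omega>
  obtain N where "\<sigma> \<omega> < real N" using reals_Archimedean2 by blast
  then have "X (min (\<sigma> \<omega>) (real n)) \<omega> = X (\<sigma> \<omega>) \<omega>" if "N \<le> n" for n using that by auto
  then show "(\<lambda>n. X (min (\<sigma> \<omega>) (real n)) \<omega>) \<longlonglongrightarrow> X (\<sigma> \<omega>) \<omega>"
    by (intro tendsto_eventually) (auto simp: eventually_sequentially)
qed

lemma stopping_time_measurable_P:
  assumes x: "x \<in> S" and T: "stopping_time F T" shows "T \<in> borel_measurable (P x)"
  by (rule measurable_stopping_time[OF T sets_F_subset[OF x]]) (unfold space_P[OF x], rule space_F)

lemma pre_sigma_subset:
  assumes x: "x \<in> S" and T: "stopping_time F T" shows "sets (pre_sigma T) \<subseteq> sets (P x)"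
proof
  fix A assume "A \<in> sets (pre_sigma T)"
  from sets_pre_sigmaD[OF T this, of top] show "A \<in> sets (P x)"
    using sets_F_subset[OF x, of top] by auto
qed

lemma pre_sigma_sub_space: "A \<in> sets (pre_sigma T) \<Longrightarrow> A \<subseteq> \<Omega>"
  using sets.sets_into_space[of A "pre_sigma T"] space_pre_sigma[of T] by blast

text \<open>On this event the rounded time has the value \<open>(k + 1) / 2\<^sup>n\<close>, and \<open>T\<close> is strictly smaller; the event is
therefore known at that time.\<close>

lemma round_up_level_set:
  assumes T: "stopping_time F T" and A: "A \<in> sets (pre_sigma T)" and fin: "\<And>\<omega>. \<omega> \<in> A \<Longrightarrow> T \<omega> < \<infinity>"
  shows "{\<omega>\<in>A. nat \<lfloor>2 ^ n * enn2real (T \<omega>)\<rfloor> = k} \<in> sets (F (ennreal ((real k + 1) / 2 ^ n)))"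
proof -
  let ?a = "ennreal (real k / 2 ^ n)" and ?b = "ennreal ((real k + 1) / 2 ^ n)"
  have ab: "?a \<le> ?b" by (intro ennreal_leI divide_right_mono) auto
  have A_sub: "A \<subseteq> \<Omega>" by (rule pre_sigma_sub_space[OF A])
  have "nat \<lfloor>2 ^ n * enn2real (T \<omega>)\<rfloor> = k \<longleftrightarrow> ?a \<le> T \<omega> \<and> T \<omega> < ?b" if "\<omega> \<in> A" for \<omega>
  proof -
    have "T \<omega> \<noteq> top" using fin[OF that] by auto
    then obtain r where r: "T \<omega> = ennreal r" "0 \<le> r" by (cases "T \<omega>") auto
    have "nat \<lfloor>2 ^ n * r\<rfloor> = k \<longleftrightarrow> \<lfloor>2 ^ n * r\<rfloor> = int k" using r by auto
    also have "\<dots> \<longleftrightarrow> real k \<le> 2 ^ n * r \<and> 2 ^ n * r < real k + 1" by linarith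
    also have "\<dots> \<longleftrightarrow> real k / 2 ^ n \<le> r \<and> r < (real k + 1) / 2 ^ n" by (simp add: field_simps)
    also have "\<dots> \<longleftrightarrow> ?a \<le> T \<omega> \<and> T \<omega> < ?b" using r by (simp add: ennreal_less_iff)
    finally show ?thesis using r by simp
  qed
  then have "{\<omega>\<in>A. nat \<lfloor>2 ^ n * enn2real (T \<omega>)\<rfloor> = k} = {\<omega>\<in>A. ?a \<le> T \<omega> \<and> T \<omega> < ?b}"
    by blast
  also have "\<dots> = {\<omega>\<in>A. T \<omega> \<le> ?b} \<inter> {\<omega>\<in>\<Omega>. T \<omega> < ?b} - {\<omega>\<in>\<Omega>. T \<omega> < ?a}"
    using A_sub by (auto simp: not_less intro: less_imp_le)
  also have "\<dots> \<in> sets (F ?b)"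
  proof (intro sets.Diff sets.Int)
    show "{\<omega>\<in>A. T \<omega> \<le> ?b} \<in> sets (F ?b)" by (rule sets_pre_sigmaD[OF T A])
    show "{\<omega>\<in>\<Omega>. T \<omega> < ?b} \<in> sets (F ?b)"
      using stopping_time_less_const[OF T, of ?b] space_F[of ?b] by (simp add: pred_def)
    have "{\<omega>\<in>\<Omega>. T \<omega> < ?a} \<in> sets (F ?a)"
      using stopping_time_less_const[OF T, of ?a] space_F[of ?a] by (simp add: pred_def)
    then show "{\<omega>\<in>\<Omega>. T \<omega> < ?a} \<in> sets (F ?b)" using sets_F_mono[OF ab] by blast
  qed
  finally show ?thesis .
qed

text \<open>The rounded time takes countably many values, and on each of them the Markov property at a fixed time
applies.\<close>

lemma stopping_step_round_up:
  assumes x: "x \<in> S" and T: "stopping_time F T" and A: "A \<in> sets (pre_sigma T)"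
    and fin: "\<And>\<omega>. \<omega> \<in> A \<Longrightarrow> T \<omega> < \<infinity>" and d: "0 \<le> d" and h[measurable]: "h \<in> borel_measurable borel"
  defines "\<sigma> \<equiv> \<lambda>n \<omega>. round_up n (enn2real (T \<omega>))"
  shows "(\<integral>\<^sup>+\<omega>\<in>A. h (X (\<sigma> n \<omega> + d) \<omega>) \<partial>P x) = (\<integral>\<^sup>+\<omega>\<in>A. (\<integral>\<^sup>+y. h y \<partial>\<kappa> d (X (\<sigma> n \<omega>) \<omega>)) \<partial>P x)"
proof -
  note [measurable] = stopping_time_measurable_P[OF x T]
  define K where "K y = (\<integral>\<^sup>+z. h z \<partial>\<kappa> d y)" for y
  have K_meas[measurable]: "K \<in> borel_measurable borel"
    unfolding K_def by (intro measurable_compose[OF measurable_\<kappa>[OF d]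
        nn_integral_measurable_subprob_algebra] h)
  define A' where "A' k = {\<omega>\<in>A. nat \<lfloor>2 ^ n * enn2real (T \<omega>)\<rfloor> = k}" for k
  define s where "s k = (real k + 1) / 2 ^ n" for k
  have s: "0 \<le> s k" for k by (simp add: s_def)
  have A'F: "A' k \<in> sets (F (ennreal (s k)))" for k
    unfolding A'_def s_def by (rule round_up_level_set[OF T A fin])
  then have A'[measurable]: "A' k \<in> sets (P x)" for k using sets_F_subset[OF x] by blast
  have A'_Un: "A = (\<Union>k. A' k)" and disj: "disjoint_family A'"
    by (auto simp: A'_def disjoint_family_on_def)
  have \<sigma>_eq: "\<sigma> n \<omega> = s k" if "\<omega> \<in> A' k" for \<omega> k
  proof -
    have k: "nat \<lfloor>2 ^ n * enn2real (T \<omega>)\<rfloor> = k" using that by (simp only: A'_def mem_Collect_eq)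
    show ?thesis by (simp only: \<sigma>_def round_up_def s_def k)
  qed
  have [measurable]: "\<sigma> n \<in> borel_measurable (P x)" unfolding \<sigma>_def round_up_def by measurable
  have \<sigma>0: "0 \<le> \<sigma> n \<omega>" for \<omega> by (simp add: \<sigma>_def round_up_def)
  have X\<sigma>[measurable]: "(\<lambda>\<omega>. X (\<sigma> n \<omega> + d) \<omega>) \<in> borel_measurable (P x)" "(\<lambda>\<omega>. X (\<sigma> n \<omega>) \<omega>) \<in>
      borel_measurable (P x)"
    using X_at_measurable_P[OF x, of "\<lambda>\<omega>. \<sigma> n \<omega> + d"] X_at_measurable_P[OF x, of "\<sigma> n"] \<sigma>0 d by auto
  have "(\<integral>\<^sup>+\<omega>\<in>A. h (X (\<sigma> n \<omega> + d) \<omega>) \<partial>P x) = (\<Sum>k. \<integral>\<^sup>+\<omega>\<in>A' k. h (X (\<sigma> n \<omega> + d) \<omega>) \<partial>P x)"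
    unfolding A'_Un by (rule nn_integral_disjoint_family[OF _ A' disj]) measurable
  also have "\<dots> = (\<Sum>k. \<integral>\<^sup>+\<omega>\<in>A' k. K (X (\<sigma> n \<omega>) \<omega>) \<partial>P x)"
  proof (intro arg_cong[where f=suminf] ext)
    fix k
    have "(\<integral>\<^sup>+\<omega>\<in>A' k. h (X (\<sigma> n \<omega> + d) \<omega>) \<partial>P x) = (\<integral>\<^sup>+\<omega>\<in>A' k. h (X (s k + d) \<omega>) \<partial>P x)"
      by (intro nn_integral_cong) (auto simp: \<sigma>_eq split: split_indicator)
    also have "\<dots> = (\<integral>\<^sup>+\<omega>\<in>A' k. K (X (s k) \<omega>) \<partial>P x)"
      unfolding K_def
    proof (rule nn_integral_kernel[OF A', where L=borel and N=borel])
      show "X (s k) \<in> borel_measurable (P x)" "X (s k + d) \<in> borel_measurable (P x)"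
        using s[of k] d by (auto intro!: X_measurable_P x)
      show "emeasure (P x) {\<omega> \<in> A' k. X (s k + d) \<omega> \<in> C} = (\<integral>\<^sup>+\<omega>\<in>A' k. emeasure (\<kappa> d (X (s k) \<omega>)) C \<partial>P x)"
        if "C \<in> sets borel" for C
        by (rule markov_step[OF x s d A'F that])
    qed (use measurable_\<kappa>[OF d] h in auto)
    also have "\<dots> = (\<integral>\<^sup>+\<omega>\<in>A' k. K (X (\<sigma> n \<omega>) \<omega>) \<partial>P x)"
      by (intro nn_integral_cong) (auto simp: \<sigma>_eq split: split_indicator)
    finally show "(\<integral>\<^sup>+\<omega>\<in>A' k. h (X (\<sigma> n \<omega> + d) \<omega>) \<partial>P x) = (\<integral>\<^sup>+\<omega>\<in>A' k. K (X (\<sigma> n \<omega>) \<omega>) \<partial>P x)" .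
  qed
  also have "\<dots> = (\<integral>\<^sup>+\<omega>\<in>A. K (X (\<sigma> n \<omega>) \<omega>) \<partial>P x)"
    unfolding A'_Un by (rule nn_integral_disjoint_family[OF _ A' disj, symmetric]) measurable
  finally show ?thesis unfolding K_def .
qed

text \<open>Both sides of the identity at rounded times converge when tested on continuous functions: the left one by
right-continuity of the paths, the right one also by the Feller property. Equality of the two limits for
the functions \<open>closed_approx\<close> extends to all Borel sets.\<close>

lemma stopping_step:
  assumes x: "x \<in> S" and T: "stopping_time F T" and A: "A \<in> sets (pre_sigma T)"
    and fin: "\<And>\<omega>. \<omega> \<in> A \<Longrightarrow> T \<omega> < \<infinity>" and d: "0 \<le> d" and C: "C \<in> sets borel"
  shows "emeasure (P x) {\<omega>\<in>A. X (enn2real (T \<omega>) + d) \<omega> \<in> C}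
     = (\<integral>\<^sup>+\<omega>\<in>A. emeasure (\<kappa> d (X (enn2real (T \<omega>)) \<omega>)) C \<partial>P x)"
proof -
  interpret prob_space "P x" by (rule prob_P[OF x])
  note [measurable] = stopping_time_measurable_P[OF x T]
  have AP[measurable]: "A \<in> sets (P x)" using A pre_sigma_subset[OF x T] by blast
  have A_sub: "A \<subseteq> \<Omega>" by (rule pre_sigma_sub_space[OF A])
  let ?Y = "\<lambda>\<omega>. X (enn2real (T \<omega>)) \<omega>" and ?Z = "\<lambda>\<omega>. X (enn2real (T \<omega>) + d) \<omega>"
  define \<sigma> where "\<sigma> n \<omega> = round_up n (enn2real (T \<omega>))" for n \<omega>
  have [measurable]: "\<sigma> n \<in> borel_measurable (P x)" for n unfolding \<sigma>_def round_up_def by measurable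
  have \<sigma>0: "0 \<le> \<sigma> n \<omega>" for n \<omega> by (simp add: \<sigma>_def round_up_def)
  have [measurable]: "(\<lambda>\<omega>. X (\<sigma> n \<omega> + d) \<omega>) \<in> borel_measurable (P x)" "(\<lambda>\<omega>. X (\<sigma> n \<omega>) \<omega>) \<in> borel_measurable
      (P x)" for n
    using X_at_measurable_P[OF x, of "\<lambda>\<omega>. \<sigma> n \<omega> + d"] X_at_measurable_P[OF x, of "\<sigma> n"] \<sigma>0 d by auto
  have Y[measurable]: "?Y \<in> borel_measurable (P x)" and Z[measurable]: "?Z \<in> borel_measurable (P x)"
    using X_at_measurable_P[OF x, of "\<lambda>\<omega>. enn2real (T \<omega>) + d"] X_at_measurable_P[OF x, of "\<lambda>\<omega>. enn2real (T
        \<omega>)"] d by auto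
  note K[measurable] = measurable_\<kappa>[OF d]
  let ?M = "density (P x) (indicator A)"
  have finM: "finite_measure ?M"
    by (rule finite_measureI) (simp add: emeasure_density nn_integral_indicator emeasure_eq_measure cong:
        nn_integral_cong)
  have lim\<sigma>: "(\<lambda>n. X (\<sigma> n \<omega>) \<omega>) \<longlonglongrightarrow> ?Y \<omega>" "(\<lambda>n. X (\<sigma> n \<omega> + d) \<omega>) \<longlonglongrightarrow> ?Z \<omega>" if \<omega>: "\<omega> \<in> \<Omega>" for \<omega>
  proof -
    have fl: "filterlim (\<lambda>n. \<sigma> n \<omega>) (at_right (enn2real (T \<omega>))) sequentially"
      unfolding \<sigma>_def by (rule round_up_at_right) simp
    show "(\<lambda>n. X (\<sigma> n \<omega>) \<omega>) \<longlonglongrightarrow> ?Y \<omega>"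
      by (rule filterlim_compose[OF right_continuous[OF \<omega>] fl]) simp
    have "filterlim (\<lambda>n. \<sigma> n \<omega> + d) (at_right (enn2real (T \<omega>) + d)) sequentially"
      using fl unfolding filterlim_at by (auto intro!: tendsto_add)
    then show "(\<lambda>n. X (\<sigma> n \<omega> + d) \<omega>) \<longlonglongrightarrow> ?Z \<omega>"
      by (intro filterlim_compose[OF right_continuous[OF \<omega>]]) (use d in auto)
  qed
  define g where "g D j y = (LINT z|p d y. closed_approx D j z)" for D j and y :: 'e
  have \<kappa>g: "(\<integral>\<^sup>+z. ennreal (closed_approx D j z) \<partial>\<kappa> d y) = ennreal (g D j y)" if y: "y \<in> S" for D j y
  proof -
    interpret K: prob_space "p d y" by (rule kernel[OF d y])
    have "integrable (p d y) (closed_approx D j)"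
      by (rule K.integrable_const_bound[where B=1])
         (auto simp: closed_approx_bounds kernel[OF d y] cong: measurable_cong_sets)
    then show ?thesis
      unfolding g_def \<kappa>_eq[OF y] by (intro nn_integral_eq_integral) (auto simp: closed_approx_bounds)
  qed
  have step: "(\<integral>\<^sup>+\<omega>\<in>A. ennreal (closed_approx D j (?Z \<omega>)) \<partial>P x)
     = (\<integral>\<^sup>+\<omega>\<in>A. (\<integral>\<^sup>+z. ennreal (closed_approx D j z) \<partial>\<kappa> d (?Y \<omega>)) \<partial>P x)" for D j
  proof (rule LIMSEQ_unique)
    have [measurable]: "(\<lambda>y. \<integral>\<^sup>+z. ennreal (closed_approx D j z) \<partial>\<kappa> d y) \<in> borel_measurable borel"
      by (intro measurable_compose[OF K nn_integral_measurable_subprob_algebra]) measurable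
    show "(\<lambda>n. \<integral>\<^sup>+\<omega>\<in>A. ennreal (closed_approx D j (X (\<sigma> n \<omega> + d) \<omega>)) \<partial>P x)
       \<longlonglongrightarrow> (\<integral>\<^sup>+\<omega>\<in>A. ennreal (closed_approx D j (?Z \<omega>)) \<partial>P x)"
    proof (rule nn_integral_dominated_convergence[where w="\<lambda>_. 1"])
      show "AE \<omega> in P x. (\<lambda>n. ennreal (closed_approx D j (X (\<sigma> n \<omega> + d) \<omega>)) * indicator A \<omega>)
          \<longlonglongrightarrow> ennreal (closed_approx D j (?Z \<omega>)) * indicator A \<omega>"
      proof (rule AE_I2)
        fix \<omega> assume "\<omega> \<in> space (P x)"
        then have \<omega>: "\<omega> \<in> \<Omega>" by (simp add: space_P[OF x])
        have "(\<lambda>n. closed_approx D j (X (\<sigma> n \<omega> + d) \<omega>)) \<longlonglongrightarrow> closed_approx D j (?Z \<omega>)"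
          by (rule continuous_on_tendsto_compose[OF continuous_on_closed_approx[of UNIV] lim\<sigma>(2)[OF \<omega>]]) auto
        then show "(\<lambda>n. ennreal (closed_approx D j (X (\<sigma> n \<omega> + d) \<omega>)) * indicator A \<omega>)
          \<longlonglongrightarrow> ennreal (closed_approx D j (?Z \<omega>)) * indicator A \<omega>"
          by (cases "\<omega> \<in> A") (auto intro: tendsto_ennrealI)
      qed
      show "AE \<omega> in P x. ennreal (closed_approx D j (X (\<sigma> n \<omega> + d) \<omega>)) * indicator A \<omega> \<le> 1" for n
        by (intro AE_I2) (auto simp: closed_approx_bounds ennreal_le_1 split: split_indicator)
    qed (auto simp: emeasure_space_1)
    have "(\<lambda>n. \<integral>\<^sup>+\<omega>\<in>A. (\<integral>\<^sup>+z. ennreal (closed_approx D j z) \<partial>\<kappa> d (X (\<sigma> n \<omega>) \<omega>)) \<partial>P x)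
       \<longlonglongrightarrow> (\<integral>\<^sup>+\<omega>\<in>A. (\<integral>\<^sup>+z. ennreal (closed_approx D j z) \<partial>\<kappa> d (?Y \<omega>)) \<partial>P x)"
    proof (rule nn_integral_dominated_convergence[where w="\<lambda>_. 1"])
      show "AE \<omega> in P x. (\<lambda>n. (\<integral>\<^sup>+z. ennreal (closed_approx D j z) \<partial>\<kappa> d (X (\<sigma> n \<omega>) \<omega>)) * indicator A \<omega>)
          \<longlonglongrightarrow> (\<integral>\<^sup>+z. ennreal (closed_approx D j z) \<partial>\<kappa> d (?Y \<omega>)) * indicator A \<omega>"
      proof (rule AE_I2)
        fix \<omega> assume "\<omega> \<in> space (P x)"
        then have \<omega>: "\<omega> \<in> \<Omega>" by (simp add: space_P[OF x])
        have XS: "X (\<sigma> n \<omega>) \<omega> \<in> S" "?Y \<omega> \<in> S" for n using X_in[OF _ \<omega>] \<sigma>0 by auto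
        have "continuous_on S (g D j)"
          unfolding g_def[abs_def] by (intro kernel_integral_continuous d continuous_on_closed_approx
              bounded_closed_approx)
        then have "(\<lambda>n. g D j (X (\<sigma> n \<omega>) \<omega>)) \<longlonglongrightarrow> g D j (?Y \<omega>)"
          by (rule continuous_on_tendsto_compose[OF _ lim\<sigma>(1)[OF \<omega>]]) (auto simp: XS)
        then show "(\<lambda>n. (\<integral>\<^sup>+z. ennreal (closed_approx D j z) \<partial>\<kappa> d (X (\<sigma> n \<omega>) \<omega>)) * indicator A \<omega>)
          \<longlonglongrightarrow> (\<integral>\<^sup>+z. ennreal (closed_approx D j z) \<partial>\<kappa> d (?Y \<omega>)) * indicator A \<omega>"
          unfolding \<kappa>g[OF XS(1)] \<kappa>g[OF XS(2)] by (cases "\<omega> \<in> A") (auto intro: tendsto_ennrealI)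
      qed
      show "AE \<omega> in P x. (\<integral>\<^sup>+z. ennreal (closed_approx D j z) \<partial>\<kappa> d (X (\<sigma> n \<omega>) \<omega>)) * indicator A \<omega> \<le> 1" for n
      proof (rule AE_I2)
        fix \<omega> assume "\<omega> \<in> space (P x)"
        then have \<omega>: "\<omega> \<in> \<Omega>" by (simp add: space_P[OF x])
        have y: "X (\<sigma> n \<omega>) \<omega> \<in> S" using X_in[OF \<sigma>0 \<omega>] .
        have "(\<integral>\<^sup>+z. ennreal (closed_approx D j z) \<partial>\<kappa> d (X (\<sigma> n \<omega>) \<omega>)) \<le> (\<integral>\<^sup>+z. 1 \<partial>\<kappa> d (X (\<sigma> n \<omega>) \<omega>))"
          by (intro nn_integral_mono) (auto simp: closed_approx_bounds ennreal_le_1)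
        also have "\<dots> = 1"
          using prob_space.emeasure_space_1[OF kernel(1)[OF d y]] by (simp add: \<kappa>_eq[OF y])
        finally show "(\<integral>\<^sup>+z. ennreal (closed_approx D j z) \<partial>\<kappa> d (X (\<sigma> n \<omega>) \<omega>)) * indicator A \<omega> \<le> 1"
          by (auto split: split_indicator)
      qed
    qed (auto simp: emeasure_space_1)
    then show "(\<lambda>n. \<integral>\<^sup>+\<omega>\<in>A. ennreal (closed_approx D j (X (\<sigma> n \<omega> + d) \<omega>)) \<partial>P x)
       \<longlonglongrightarrow> (\<integral>\<^sup>+\<omega>\<in>A. (\<integral>\<^sup>+z. ennreal (closed_approx D j z) \<partial>\<kappa> d (?Y \<omega>)) \<partial>P x)"
      unfolding \<sigma>_def by (subst stopping_step_round_up[OF x T A fin d]) auto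
  qed
  have sets_bind: "sets (distr ?M borel ?Y \<bind> \<kappa> d) = sets borel"
    using sets_kernel[OF K] by (intro sets_bind) auto
  have "distr ?M borel ?Z = distr ?M borel ?Y \<bind> \<kappa> d"
  proof (rule measure_eqI_closed_approx)
    interpret M: finite_measure ?M by (rule finM)
    show "finite_measure (distr ?M borel ?Z)" by (rule M.finite_measure_distr) simp
    have "emeasure (distr ?M borel ?Y \<bind> \<kappa> d) UNIV = (\<integral>\<^sup>+y. emeasure (\<kappa> d y) UNIV \<partial>distr ?M borel ?Y)"
      by (rule emeasure_bind[where N=borel]) (use K in auto)
    also have "\<dots> \<le> (\<integral>\<^sup>+y. 1 \<partial>distr ?M borel ?Y)"
      by (intro nn_integral_mono subprob_space.subprob_emeasure_le_1 subprob_space_kernel[OF K]) simp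
    also have "\<dots> < \<infinity>"
      using finite_measure.emeasure_finite[OF M.finite_measure_distr, of ?Y borel UNIV] by (simp add: less_top)
    finally show "finite_measure (distr ?M borel ?Y \<bind> \<kappa> d)"
      using sets_eq_imp_space_eq[OF sets_bind] by (intro finite_measureI) (auto simp: less_top)
    fix D :: "'e set" and j
    show "(\<integral>\<^sup>+z. ennreal (closed_approx D j z) \<partial>distr ?M borel ?Z)
        = (\<integral>\<^sup>+z. ennreal (closed_approx D j z) \<partial>(distr ?M borel ?Y \<bind> \<kappa> d))"
    proof -
      have [measurable]: "(\<lambda>y. \<integral>\<^sup>+z. ennreal (closed_approx D j z) \<partial>\<kappa> d y) \<in> borel_measurable borel"
        by (intro measurable_compose[OF K nn_integral_measurable_subprob_algebra]) measurable
      show ?thesis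
        using step[of D j]
        by (simp add: nn_integral_bind[where B=borel] nn_integral_distr nn_integral_density mult.commute)
    qed
  qed (auto simp: sets_bind)
  then show ?thesis
    using emeasure_distr_restricted[OF AP Z C] emeasure_bind_restricted[OF AP Y K _ C] by simp
qed

lemma stopping_time_add:
  assumes T: "stopping_time F T" and d: "0 \<le> d"
  shows "stopping_time F (\<lambda>\<omega>. T \<omega> + ennreal d)"
proof (rule stopping_timeI)
  fix t
  show "Measurable.pred (F t) (\<lambda>\<omega>. T \<omega> + ennreal d \<le> t)"
  proof (cases "ennreal d \<le> t")
    case True
    have "T \<omega> + ennreal d \<le> t \<longleftrightarrow> T \<omega> \<le> t - ennreal d" for \<omega>
      using True by (auto simp: ennreal_le_minus_iff)
    then show ?thesis
      by (simp only:) (rule stopping_time_le_const[OF T], simp add: diff_le_self_ennreal)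
  next
    case False
    then have "\<not> T \<omega> + ennreal d \<le> t" for \<omega> by (meson add_increasing order_trans zero_le order_refl)
    then show ?thesis by simp
  qed
qed

text \<open>On \<open>T \<le> t\<close> the value at time \<open>T\<close> is the value at time \<open>min T t\<close>, which is known at time \<open>t\<close>.\<close>

lemma X_stopped_in_pre_sigma:
  assumes T: "stopping_time F T" and A: "A \<in> sets (pre_sigma T)" and fin: "\<And>\<omega>. \<omega> \<in> A \<Longrightarrow> T \<omega> < \<infinity>"
    and C: "C \<in> sets borel"
  shows "{\<omega>\<in>A. X (enn2real (T \<omega>)) \<omega> \<in> C} \<in> sets (pre_sigma T)"
proof (rule sets_pre_sigmaI[OF T])
  have A_sub: "A \<subseteq> \<Omega>" by (rule pre_sigma_sub_space[OF A])
  have finite: "{\<omega>\<in>A. X (enn2real (T \<omega>)) \<omega> \<in> C \<and> T \<omega> \<le> ennreal t} \<in> sets (F (ennreal t))" if t: "0 \<le> t" for t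
  proof -
    let ?\<sigma> = "\<lambda>\<omega>. enn2real (min (T \<omega>) (ennreal t))"
    have "(\<lambda>\<omega>. min (T \<omega>) (ennreal t)) \<in> borel_measurable (F (ennreal t))"
    proof (rule borel_measurableI_le)
      fix u
      show "{\<omega> \<in> space (F (ennreal t)). min (T \<omega>) (ennreal t) \<le> u} \<in> sets (F (ennreal t))"
      proof (cases "ennreal t \<le> u")
        case False
        then have "u \<le> ennreal t" by simp
        from stopping_time_le_const[OF T this] False show ?thesis by (simp add: min_le_iff_disj pred_def)
      qed (simp add: min_le_iff_disj)
    qed
    then have \<sigma>: "?\<sigma> \<in> borel_measurable (F (ennreal t))" by measurable
    have "(\<lambda>\<omega>. X (min (?\<sigma> \<omega>) t) \<omega>) \<in> borel_measurable (F (ennreal t))"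
    proof (rule X_at_measurable[OF space_F _ t \<sigma>])
      show "sets (F (ennreal s)) \<subseteq> sets (F (ennreal t))" if "0 \<le> s" "s \<le> t" for s
        using that by (intro sets_F_mono ennreal_leI)
    qed simp
    from measurable_sets[OF this C]
    have "{\<omega>\<in>space (F (ennreal t)). X (min (?\<sigma> \<omega>) t) \<omega> \<in> C} \<in> sets (F (ennreal t))"
      by (simp add: vimage_def Int_def conj_commute)
    then have "{\<omega>\<in>A. T \<omega>
        \<le> ennreal t} \<inter> {\<omega>\<in>space (F (ennreal t)). X (min (?\<sigma> \<omega>) t) \<omega> \<in> C} \<in> sets (F (ennreal t))"
      by (intro sets.Int sets_pre_sigmaD[OF T A])
    also have "{\<omega>\<in>A. T \<omega> \<le> ennreal t} \<inter> {\<omega>\<in>space (F (ennreal t)). X (min (?\<sigma> \<omega>) t) \<omega> \<in> C}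
        = {\<omega>\<in>A. X (enn2real (T \<omega>)) \<omega> \<in> C \<and> T \<omega> \<le> ennreal t}"
    proof -
      have "min (?\<sigma> \<omega>) t = enn2real (T \<omega>)" if "T \<omega> \<le> ennreal t" for \<omega>
      proof -
        have "enn2real (T \<omega>) \<le> t" using that t by (cases "T \<omega>") (auto simp: top_unique)
        then show ?thesis using that by (simp add: min_absorb1)
      qed
      then show ?thesis using A_sub space_F[of "ennreal t"] by auto
    qed
    finally show ?thesis .
  qed
  fix t :: ennreal
  show "{\<omega> \<in> {\<omega> \<in> A. X (enn2real (T \<omega>)) \<omega> \<in> C}. T \<omega> \<le> t} \<in> sets (F t)"
  proof (cases t)
    case (real r)
    then show ?thesis using finite[of r] by simp
  next
    case top
    have "{\<omega> \<in> A. X (enn2real (T \<omega>)) \<omega> \<in> C} = (\<Union>n::nat. {\<omega>\<in>A. X (enn2real (T \<omega>)) \<omega> \<in> C \<and> T \<omega>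
        \<le> ennreal (real n)})"
    proof -
      have "\<exists>n::nat. T \<omega> \<le> ennreal (real n)" if "\<omega> \<in> A" for \<omega>
      proof -
        have "T \<omega> \<noteq> top" using fin[OF that] by auto
        then obtain r where "T \<omega> = ennreal r" by (cases "T \<omega>") auto
        moreover obtain n where "r \<le> real n" using real_arch_simple by blast
        ultimately show ?thesis by (auto intro: ennreal_leI)
      qed
      then show ?thesis by auto
    qed
    also have "\<dots> \<in> sets (F t)"
    proof (rule sets.countable_UN, rule image_subsetI)
      fix n :: nat
      have "ennreal (real n) \<le> t" using top by simp
      from subsetD[OF sets_F_mono[OF this] finite]
      show "{\<omega>\<in>A. X (enn2real (T \<omega>)) \<omega> \<in> C \<and> T \<omega> \<le> ennreal (real n)} \<in> sets (F t)" by simp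
    qed
    finally show ?thesis using top by simp
  qed
qed

text \<open>Listing increments of time, rather than times, fits the induction in which the stopping time advances by
\<open>d\<close>.\<close>

fun visits :: "(real \<times> 'e set) list \<Rightarrow> real \<Rightarrow> 'w \<Rightarrow> bool" where
  "visits [] r \<omega> \<longleftrightarrow> True"
| "visits ((d, C) # l) r \<omega> \<longleftrightarrow> X (r + d) \<omega> \<in> C \<and> visits l (r + d) \<omega>"

fun visit_prob :: "(real \<times> 'e set) list \<Rightarrow> 'e \<Rightarrow> ennreal" where
  "visit_prob [] y = 1"
| "visit_prob ((d, C) # l) y = (\<integral>\<^sup>+z. indicator C z * visit_prob l z \<partial>\<kappa> d y)"

definition admissible :: "(real \<times> 'e set) list \<Rightarrow> bool" where
  "admissible l \<longleftrightarrow> (\<forall>(d, C)\<in>set l. 0 \<le> d \<and> C \<in> sets borel)"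

lemma admissible_Cons [simp]: "admissible ((d, C) # l) \<longleftrightarrow> 0 \<le> d \<and> C \<in> sets borel \<and> admissible l"
  by (auto simp: admissible_def)

lemma measurable_visit_prob: "admissible l \<Longrightarrow> visit_prob l \<in> borel_measurable borel"
proof (induction l)
  case (Cons a l)
  obtain d C where a: "a = (d, C)" by force
  have [measurable]: "C \<in> sets borel" "visit_prob l \<in> borel_measurable borel" and d: "0 \<le> d" using Cons
      by (auto simp: a)
  have "(\<lambda>y. \<integral>\<^sup>+z. indicator C z * visit_prob l z \<partial>\<kappa> d y) \<in> borel_measurable borel"
    by (intro measurable_compose[OF measurable_\<kappa>[OF d] nn_integral_measurable_subprob_algebra]) measurable
  then show ?case by (simp add: a)
qed (simp add: visit_prob.simps(1)[abs_def])

text \<open>One step at \<open>T\<close> leads to the stopping time \<open>T + d\<close> and to an event of its past, where the induction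
hypothesis applies.\<close>

lemma stopping_visits:
  assumes "x \<in> S" "admissible l" "stopping_time F T" "A \<in> sets (pre_sigma T)" "\<And>\<omega>. \<omega> \<in> A \<Longrightarrow> T \<omega> < \<infinity>"
  shows "{\<omega>\<in>A. visits l (enn2real (T \<omega>)) \<omega>} \<in> sets (P x)
    \<and> emeasure (P x) {\<omega>\<in>A. visits l (enn2real (T \<omega>)) \<omega>} = (\<integral>\<^sup>+\<omega>\<in>A. visit_prob l (X (enn2real (T \<omega>)) \<omega>) \<partial>P x)"
  using assms(2-)
proof (induction l arbitrary: T A)
  case Nil
  have "A \<in> sets (P x)" using pre_sigma_subset[OF assms(1) Nil(2)] Nil(3) by blast
  then show ?case by simp
next
  case (Cons a l)
  obtain d C where a: "a = (d, C)" by force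
  have d: "0 \<le> d" and C[measurable]: "C \<in> sets borel" and l: "admissible l" using Cons.prems by (auto simp: a)
  note T = Cons.prems(2) and A = Cons.prems(3) and fin = Cons.prems(4)
  let ?T' = "\<lambda>\<omega>. T \<omega> + ennreal d"
  have T': "stopping_time F ?T'" by (rule stopping_time_add[OF T d])
  have enn: "enn2real (T \<omega> + ennreal d) = enn2real (T \<omega>) + d" if "\<omega> \<in> A" for \<omega>
    using fin[OF that] d by (subst enn2real_plus) (auto simp: less_top)
  have AT': "A \<in> sets (pre_sigma ?T')"
    using mono_pre_sigma[OF T T'] A by auto
  have fin': "T \<omega> + ennreal d < \<infinity>" if "\<omega> \<in> A" for \<omega>
    using fin[OF that] by (simp add: less_top)
  define A' where "A' = {\<omega>\<in>A. X (enn2real (T \<omega>) + d) \<omega> \<in> C}"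
  have A'_eq: "A' = {\<omega>\<in>A. X (enn2real (?T' \<omega>)) \<omega> \<in> C}" unfolding A'_def using enn by auto
  have A': "A' \<in> sets (pre_sigma ?T')"
    unfolding A'_eq by (rule X_stopped_in_pre_sigma[OF T' AT' fin' C])
  have set_eq: "{\<omega>\<in>A. visits (a # l) (enn2real (T \<omega>)) \<omega>} = {\<omega>\<in>A'. visits l (enn2real (?T' \<omega>)) \<omega>}"
    unfolding A'_def a using enn by auto
  have fin'': "?T' \<omega> < \<infinity>" if "\<omega> \<in> A'" for \<omega> using fin' that by (auto simp: A'_def)
  note IH = Cons.IH[OF l T' A' fin'']
  note x = assms(1)
  have AP[measurable]: "A \<in> sets (P x)" using pre_sigma_subset[OF x T] A by blast
  have Y: "(\<lambda>\<omega>. X (enn2real (T \<omega>)) \<omega>) \<in> borel_measurable (P x)"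
      and Z: "(\<lambda>\<omega>. X (enn2real (T \<omega>) + d) \<omega>) \<in> borel_measurable (P x)"
    using stopping_time_measurable_P[OF x T] d by (auto intro!: X_at_measurable_P[OF x])
  have h: "(\<lambda>z. indicator C z * visit_prob l z) \<in> borel_measurable borel"
    using measurable_visit_prob[OF l] by measurable
  have "(\<integral>\<^sup>+\<omega>\<in>A'. visit_prob l (X (enn2real (?T' \<omega>)) \<omega>) \<partial>P x)
     = (\<integral>\<^sup>+\<omega>\<in>A. indicator C (X (enn2real (T \<omega>) + d) \<omega>) * visit_prob l (X (enn2real (T \<omega>) + d) \<omega>) \<partial>P x)"
    by (intro nn_integral_cong) (auto simp: A'_def enn split: split_indicator)
  also have "\<dots> = (\<integral>\<^sup>+\<omega>\<in>A. (\<integral>\<^sup>+z. indicator C z * visit_prob l z \<partial>\<kappa> d (X (enn2real (T \<omega>)) \<omega>)) \<partial>P x)"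
    by (rule nn_integral_kernel[OF AP Y Z measurable_\<kappa>[OF d] _ stopping_step[OF x T A fin d] h]) auto
  finally show ?case
    using IH unfolding set_eq by (simp add: a)
qed

lemma visits_start:
  assumes y: "y \<in> S" and l: "admissible l"
  shows "{\<omega>\<in>\<Omega>. visits l 0 \<omega>} \<in> sets (P y)" and "emeasure (P y) {\<omega>\<in>\<Omega>. visits l 0 \<omega>} = visit_prob l y"
proof -
  interpret prob_space "P y" by (rule prob_P[OF y])
  have T: "stopping_time F (\<lambda>_. 0)" by (rule stopping_time_const)
  have \<Omega>: "\<Omega> \<in> sets (pre_sigma (\<lambda>_. 0))" using sets.top[of "pre_sigma (\<lambda>_. 0)"] by (simp only: space_pre_sigma)
  note * = stopping_visits[OF y l T \<Omega>, simplified]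
  then show "{\<omega>\<in>\<Omega>. visits l 0 \<omega>} \<in> sets (P y)" by simp
  have "(\<integral>\<^sup>+\<omega>\<in>\<Omega>. visit_prob l (X 0 \<omega>) \<partial>P y) = (\<integral>\<^sup>+\<omega>. visit_prob l y \<partial>P y)"
    by (intro nn_integral_cong_AE) (use X_start[OF y] AE_space in eventually_elim, simp add: space_P[OF y])
  then show "emeasure (P y) {\<omega>\<in>\<Omega>. visits l 0 \<omega>} = visit_prob l y"
    using * by (simp add: emeasure_space_1)
qed

fun increments :: "real \<Rightarrow> real list \<Rightarrow> (real \<Rightarrow> 'e set) \<Rightarrow> (real \<times> 'e set) list" where
  "increments a [] E = []"
| "increments a (j # js) E = (j - a, E j) # increments j js E"

lemma visits_increments: "visits (increments a js E) (r + a) \<omega> \<longleftrightarrow> (\<forall>j\<in>set js. X (r + j) \<omega> \<in> E j)"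
proof (induction js arbitrary: a)
  case (Cons j js)
  have "r + a + (j - a) = r + j" by simp
  then show ?case using Cons[of j] by (simp only: increments.simps visits.simps) simp
qed simp

lemma admissible_increments:
  "sorted js \<Longrightarrow> (\<And>j. j \<in> set js \<Longrightarrow> a \<le> j \<and> E j \<in> sets borel) \<Longrightarrow> admissible (increments a js E)"
  by (induction js arbitrary: a) (auto simp: admissible_def)

abbreviation path_space :: "(real \<Rightarrow> 'e) measure" where
  "path_space \<equiv> PiM {0..} (\<lambda>_. borel)"

definition future :: "real \<Rightarrow> 'w \<Rightarrow> real \<Rightarrow> 'e" where
  "future r \<omega> = (\<lambda>t\<in>{0..}. X (r + t) \<omega>)"

lemma future_in_emb:
  assumes J: "finite J" "J \<subseteq> {0..}"
  shows "future r \<omega> \<in> prod_emb {0..} (\<lambda>_. borel) J (Pi\<^sub>E J E)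
      \<longleftrightarrow> visits (increments 0 (sorted_list_of_set J) E) r \<omega>"
proof -
  have "future r \<omega> \<in> prod_emb {0..} (\<lambda>_. borel) J (Pi\<^sub>E J E) \<longleftrightarrow> (\<forall>j\<in>J. X (r + j) \<omega> \<in> E j)"
    using J(2) by (auto simp: prod_emb_iff future_def PiE_iff)
  then show ?thesis using visits_increments[of 0 "sorted_list_of_set J" E r \<omega>] J(1) by simp
qed

lemma admissible_sorted:
  "finite J \<Longrightarrow> J \<subseteq> {0..} \<Longrightarrow> (\<And>j. j \<in> J \<Longrightarrow> E j \<in> sets borel) \<Longrightarrow> admissible (increments 0 (sorted_list_of_set J) E)"
  by (rule admissible_increments) auto

lemma measurable_future:
  assumes x: "x \<in> S" and [measurable]: "\<sigma> \<in> borel_measurable (P x)" and "\<And>\<omega>. \<omega> \<in> \<Omega> \<Longrightarrow> 0 \<le> \<sigma> \<omega>"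
  shows "(\<lambda>\<omega>. future (\<sigma> \<omega>) \<omega>) \<in> P x \<rightarrow>\<^sub>M path_space"
  unfolding future_def
proof (rule measurable_restrict)
  fix t :: real assume "t \<in> {0..}"
  then show "(\<lambda>\<omega>. X (\<sigma> \<omega> + t) \<omega>) \<in> borel_measurable (P x)"
    using assms by (intro X_at_measurable_P[OF x]) auto
qed

text \<open>For starting points outside \<open>S\<close> the constant path is used. It is what the extended kernels produce, so
cylinder probabilities are given by \<open>visit_prob\<close> everywhere (\<open>future_law_emb\<close>).\<close>

definition future_law :: "'e \<Rightarrow> (real \<Rightarrow> 'e) measure" where
  "future_law y = (if y \<in> S then distr (P y) path_space (future 0) else return path_space (\<lambda>t\<in>{0..}. y))"

lemma sets_future_law [simp]: "sets (future_law y) = sets path_space"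
  by (simp add: future_law_def)

lemma visit_prob_outside:
  assumes "y \<notin> S" shows "admissible l \<Longrightarrow> visit_prob l y = (if \<forall>(d, C)\<in>set l. y \<in> C then 1 else 0)"
proof (induction l)
  case (Cons a l)
  obtain d C where a: "a = (d, C)" by force
  have [measurable]: "C \<in> sets borel" "visit_prob l \<in> borel_measurable borel"
    using Cons.prems measurable_visit_prob by (auto simp: a)
  have "visit_prob (a # l) y = indicator C y * visit_prob l y"
    using assms by (simp add: a \<kappa>_def extend_kernel_def nn_integral_return)
  then show ?case using Cons by (auto simp: a split: split_indicator)
qed simp

lemma future_law_emb:
  assumes J: "finite J" "J \<subseteq> {0..}" "\<And>j. j \<in> J \<Longrightarrow> E j \<in> sets borel"
  shows "emeasure (future_law y) (prod_emb {0..} (\<lambda>_. borel) J (Pi\<^sub>E J E))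
      = visit_prob (increments 0 (sorted_list_of_set J) E) y"
proof (cases "y \<in> S")
  case True
  have "emeasure (future_law y) (prod_emb {0..} (\<lambda>_. borel) J (Pi\<^sub>E J E))
     = emeasure (P y) (future 0 -` prod_emb {0..} (\<lambda>_. borel) J (Pi\<^sub>E J E) \<inter> space (P y))"
    using True measurable_future[OF True, of "\<lambda>_. 0"] J by (simp add: future_law_def emeasure_distr)
  also have "future 0 -` prod_emb {0..} (\<lambda>_. borel) J (Pi\<^sub>E J E) \<inter> space (P y)
      = {\<omega>\<in>\<Omega>. visits (increments 0 (sorted_list_of_set J) E) 0 \<omega>}"
    using future_in_emb[of J _ _ E, OF J(1,2)] space_P[OF True] by auto
  finally show ?thesis
    using visits_start(2)[OF True admissible_sorted[of J E, OF J]] by simp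
next
  case False
  have incs: "(\<forall>(d, C)\<in>set (increments a js E). y \<in> C) \<longleftrightarrow> (\<forall>j\<in>set js. y \<in> E j)" for a js
    by (induction js arbitrary: a) auto
  have "(\<lambda>t\<in>{0..}. y) \<in> prod_emb {0..} (\<lambda>_. borel) J (Pi\<^sub>E J E) \<longleftrightarrow> (\<forall>j\<in>J. y \<in> E j)"
    using J(2) by (auto simp: prod_emb_iff PiE_iff)
  then show ?thesis
    using False J by (simp add: future_law_def visit_prob_outside[OF False admissible_sorted[of J E, OF J]]
        incs indicator_def)
qed

lemma prob_future_law: "prob_space (future_law y)"
proof (cases "y \<in> S")
  case True
  then interpret prob_space "P y" by (rule prob_P)
  show ?thesis using True measurable_future[OF True, of "\<lambda>_. 0"] by (simp add: future_law_def prob_space_distr)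
next
  case False
  then show ?thesis by (simp add: future_law_def prob_space_return space_PiM)
qed

lemma measurable_future_law: "future_law \<in> borel \<rightarrow>\<^sub>M subprob_algebra path_space"
proof (rule measurable_subprob_algebra_generated[OF sets_PiM Int_stable_prod_algebra
    prod_algebra_sets_into_space])
  show "subprob_space (future_law y)" for y by (rule prob_space_imp_subprob_space[OF prob_future_law])
  show "(\<lambda>y. emeasure (future_law y) (\<Pi>\<^sub>E i\<in>{0..}. space borel)) \<in> borel_measurable borel"
  proof -
    have "emeasure (future_law y) (\<Pi>\<^sub>E i\<in>{0::real..}. space borel) = 1" for y
      using prob_space.emeasure_space_1[OF prob_future_law, of y] sets_eq_imp_space_eq[OF sets_future_law, of y]
      by (simp add: space_PiM)
    then show ?thesis by simp
  qed
  fix A :: "(real \<Rightarrow> 'e) set" assume "A \<in> prod_algebra {0..} (\<lambda>_. borel)"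
  then obtain J E where A: "A = prod_emb {0..} (\<lambda>_. borel) J (Pi\<^sub>E J E)"
      and J: "finite J" "J \<subseteq> {0..}" "\<And>j. j \<in> J \<Longrightarrow> E j \<in> sets borel"
    by (auto elim!: prod_algebraE)
  show "(\<lambda>y. emeasure (future_law y) A) \<in> borel_measurable borel"
  proof -
    have "emeasure (future_law y) A = visit_prob (increments 0 (sorted_list_of_set J) E) y" for y
      unfolding A by (rule future_law_emb) (use J in auto)
    moreover have "admissible (increments 0 (sorted_list_of_set J) E)"
      by (rule admissible_sorted) (use J in auto)
    ultimately show ?thesis using measurable_visit_prob by simp
  qed
qed simp

lemma future_law_integrable:
  fixes f :: "(real \<Rightarrow> 'e) \<Rightarrow> real"
  assumes "f \<in> borel_measurable path_space" and fC: "\<And>w. \<bar>f w\<bar> \<le> C"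
  shows "integrable (future_law y) f"
proof -
  interpret L: prob_space "future_law y" by (rule prob_future_law)
  show ?thesis
    using assms by (intro L.integrable_const_bound[where B=C]) (auto cong: measurable_cong_sets)
qed

lemma future_law_integral_bound:
  fixes f :: "(real \<Rightarrow> 'e) \<Rightarrow> real"
  assumes f: "f \<in> borel_measurable path_space" and fC: "\<And>w. \<bar>f w\<bar> \<le> C"
  shows "\<bar>LINT w|future_law y. f w\<bar> \<le> C"
proof -
  interpret L: prob_space "future_law y" by (rule prob_future_law)
  have "\<bar>LINT w|future_law y. f w\<bar> \<le> (LINT w|future_law y. \<bar>f w\<bar>)" by (rule integral_abs_bound)
  also have "\<dots> \<le> (LINT w|future_law y. C)"
    using future_law_integrable[OF f fC] fC by (intro integral_mono) auto
  finally show ?thesis by (simp add: L.prob_space)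
qed

text \<open>Both sides are finite measures in \<open>E\<close> that agree on cylinder sets.\<close>

lemma stopping_future_law:
  assumes x: "x \<in> S" and T: "stopping_time F T" and A: "A \<in> sets (pre_sigma T)"
    and fin: "\<And>\<omega>. \<omega> \<in> A \<Longrightarrow> T \<omega> < \<infinity>" and E: "E \<in> sets path_space"
  shows "emeasure (P x) {\<omega>\<in>A. future (enn2real (T \<omega>)) \<omega> \<in> E}
     = (\<integral>\<^sup>+\<omega>\<in>A. emeasure (future_law (X (enn2real (T \<omega>)) \<omega>)) E \<partial>P x)"
proof -
  interpret prob_space "P x" by (rule prob_P[OF x])
  note [measurable] = stopping_time_measurable_P[OF x T]
  have AP[measurable]: "A \<in> sets (P x)" using A pre_sigma_subset[OF x T] by blast
  have A_sub: "A \<subseteq> \<Omega>" by (rule pre_sigma_sub_space[OF A])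
  let ?Y = "\<lambda>\<omega>. X (enn2real (T \<omega>)) \<omega>" and ?Z = "\<lambda>\<omega>. future (enn2real (T \<omega>)) \<omega>"
  have Y[measurable]: "?Y \<in> borel_measurable (P x)" and Z[measurable]: "?Z \<in> P x \<rightarrow>\<^sub>M path_space"
    by (auto intro!: X_at_measurable_P[OF x] measurable_future[OF x])
  note L[measurable] = measurable_future_law
  let ?M = "density (P x) (indicator A)"
  interpret M: finite_measure ?M
    by (rule finite_measureI) (simp add: emeasure_density nn_integral_indicator emeasure_eq_measure cong:
        nn_integral_cong)
  note lhs = emeasure_distr_restricted[OF AP Z] and rhs = emeasure_bind_restricted[OF AP Y L]
  have "distr ?M path_space ?Z = distr ?M borel ?Y \<bind> future_law"
  proof (rule measure_eqI_PiM_infinite)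
    show "finite_measure (distr ?M path_space ?Z)" by (rule M.finite_measure_distr) simp
    show "sets (distr ?M borel ?Y \<bind> future_law) = sets path_space"
      by (intro sets_bind) auto
    fix E :: "real \<Rightarrow> 'e set" and J
    assume J: "finite J" "J \<subseteq> {0..}" "\<And>j. j \<in> J \<Longrightarrow> E j \<in> sets borel"
    then have emb: "prod_emb {0..} (\<lambda>_. borel) J (Pi\<^sub>E J E) \<in> sets path_space" by simp
    have pl: "emeasure (future_law y) (prod_emb {0..} (\<lambda>_. borel) J (Pi\<^sub>E J E))
        = visit_prob (increments 0 (sorted_list_of_set J) E) y" for y
      by (rule future_law_emb) (use J in auto)
    have adm: "admissible (increments 0 (sorted_list_of_set J) E)"
      by (rule admissible_sorted) (use J in auto)
    show "emeasure (distr ?M path_space ?Z) (prod_emb {0..} (\<lambda>_. borel) J (Pi\<^sub>E J E))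
       = emeasure (distr ?M borel ?Y \<bind> future_law) (prod_emb {0..} (\<lambda>_. borel) J (Pi\<^sub>E J E))"
      unfolding lhs[OF emb] rhs[OF _ emb, simplified] pl future_in_emb[of J _ _ E, OF J(1,2)]
      using stopping_visits[OF x adm T A fin] by blast
  qed simp
  then show ?thesis using lhs[OF E] rhs[OF _ E] by simp
qed

lemma stopping_future_integral:
  fixes f :: "(real \<Rightarrow> 'e) \<Rightarrow> real"
  assumes x: "x \<in> S" and T: "stopping_time F T" and A: "A \<in> sets (pre_sigma T)"
    and fin: "\<And>\<omega>. \<omega> \<in> A \<Longrightarrow> T \<omega> < \<infinity>" and f[measurable]: "f \<in> borel_measurable path_space" and fC: "\<And>w. \<bar>f w\<bar> \<le> C"
  shows "(LINT \<omega>:A|P x. f (future (enn2real (T \<omega>)) \<omega>))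
      = (LINT \<omega>:A|P x. (LINT w|future_law (X (enn2real (T \<omega>)) \<omega>). f w))"
proof -
  interpret prob_space "P x" by (rule prob_P[OF x])
  note [measurable] = stopping_time_measurable_P[OF x T]
  have AP[measurable]: "A \<in> sets (P x)" using A pre_sigma_subset[OF x T] by blast
  let ?Y = "\<lambda>\<omega>. X (enn2real (T \<omega>)) \<omega>" and ?Z = "\<lambda>\<omega>. future (enn2real (T \<omega>)) \<omega>"
  have Y[measurable]: "?Y \<in> borel_measurable (P x)" and Z[measurable]: "?Z \<in> P x \<rightarrow>\<^sub>M path_space"
    by (auto intro!: X_at_measurable_P[OF x] measurable_future[OF x])
  have g[measurable]: "(\<lambda>y. LINT w|future_law y. f w) \<in> borel_measurable borel"
    by (rule measurable_compose[OF measurable_future_law integral_measurable_subprob_algebra[OF f]])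
  have C0: "0 \<le> C" using fC[of undefined] by linarith
  have nn: "0 \<le> f w + C" for w using fC[of w] by linarith
  note int = future_law_integrable[OF f fC] and gC = future_law_integral_bound[OF f fC]
  have int_law: "integrable (future_law y) (\<lambda>w. f w + C)"
    and law: "(LINT w|future_law y. f w + C) = (LINT w|future_law y. f w) + C" for y
  proof -
    interpret L: prob_space "future_law y" by (rule prob_future_law)
    show "integrable (future_law y) (\<lambda>w. f w + C)" using int by simp
    show "(LINT w|future_law y. f w + C) = (LINT w|future_law y. f w) + C"
      using int[of y] by (simp add: L.prob_space)
  qed
  have m1: "(\<lambda>\<omega>. f (?Z \<omega>)) \<in> borel_measurable (P x)"
    and m2: "(\<lambda>\<omega>. LINT w|future_law (?Y \<omega>). f w) \<in> borel_measurable (P x)"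
    by measurable
  have split: "integrable (P x) (\<lambda>\<omega>. indicator A \<omega> *\<^sub>R k \<omega> + indicator A \<omega> * C)"
      "(LINT \<omega>|P x. indicator A \<omega> *\<^sub>R k \<omega> + indicator A \<omega> * C) = (LINT \<omega>:A|P x. k \<omega>) + C * prob A"
      "\<And>\<omega>. 0 \<le> indicator A \<omega> *\<^sub>R k \<omega> + indicator A \<omega> * C"
    if [measurable]: "k \<in> borel_measurable (P x)" and kC: "\<And>\<omega>. \<bar>k \<omega>\<bar> \<le> C" for k
  proof -
    have i: "integrable (P x) (\<lambda>\<omega>. indicator A \<omega> *\<^sub>R k \<omega>)"
      using kC C0 by (intro integrable_const_bound[where B=C]) (auto split: split_indicator)
    have i2: "integrable (P x) (\<lambda>\<omega>. indicator A \<omega> * C)"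
      using C0 by (intro integrable_const_bound[where B=C]) (auto split: split_indicator)
    show "integrable (P x) (\<lambda>\<omega>. indicator A \<omega> *\<^sub>R k \<omega> + indicator A \<omega> * C)"
      using i i2 by (rule Bochner_Integration.integrable_add)
    show "(LINT \<omega>|P x. indicator A \<omega> *\<^sub>R k \<omega> + indicator A \<omega> * C) = (LINT \<omega>:A|P x. k \<omega>) + C * prob A"
      unfolding Bochner_Integration.integral_add[OF i i2] by (simp add: set_lebesgue_integral_def mult.commute)
    show "0 \<le> indicator A \<omega> *\<^sub>R k \<omega> + indicator A \<omega> * C" for \<omega>
      using kC[of \<omega>] by (auto split: split_indicator)
  qed
  \<comment> \<open>Adding the bound \<open>C\<close> makes the integrands nonnegative, so that \<open>nn_integral_kernel\<close> applies.\<close>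
  have conv: "(\<integral>\<^sup>+\<omega>\<in>A. ennreal (k \<omega> + C) \<partial>P x) = ennreal ((LINT \<omega>:A|P x. k \<omega>) + C * prob A)"
    if k: "k \<in> borel_measurable (P x)" "\<And>\<omega>. \<bar>k \<omega>\<bar> \<le> C" for k
  proof -
    have "(\<integral>\<^sup>+\<omega>\<in>A. ennreal (k \<omega> + C) \<partial>P x) = (\<integral>\<^sup>+\<omega>. ennreal (indicator A \<omega> *\<^sub>R k \<omega> + indicator A \<omega> * C) \<partial>P x)"
      by (intro nn_integral_cong) (auto split: split_indicator)
    also have "\<dots> = ennreal ((LINT \<omega>:A|P x. k \<omega>) + C * prob A)"
      using split[OF k] by (subst nn_integral_eq_integral) auto
    finally show ?thesis .
  qed
  have pos: "0 \<le> (LINT \<omega>:A|P x. k \<omega>) + C * prob A"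
    if k: "k \<in> borel_measurable (P x)" "\<And>\<omega>. \<bar>k \<omega>\<bar> \<le> C" for k
    unfolding split(2)[OF k, symmetric] by (rule Bochner_Integration.integral_nonneg) (rule split(3)[OF k])
  have "(\<integral>\<^sup>+\<omega>\<in>A. ennreal (f (?Z \<omega>) + C) \<partial>P x) = (\<integral>\<^sup>+\<omega>\<in>A. (\<integral>\<^sup>+w. ennreal (f w + C) \<partial>future_law (?Y \<omega>)) \<partial>P x)"
    by (rule nn_integral_kernel[OF AP Y Z measurable_future_law _ stopping_future_law[OF x T A fin]]) auto
  also have "\<dots> = (\<integral>\<^sup>+\<omega>\<in>A. ennreal ((LINT w|future_law (?Y \<omega>). f w) + C) \<partial>P x)"
    unfolding law[symmetric]
    by (intro nn_integral_cong arg_cong2[where f="(*)"] nn_integral_eq_integral int_law) (auto simp: nn)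
  finally have "ennreal ((LINT \<omega>:A|P x. f (?Z \<omega>)) + C * prob A)
      = ennreal ((LINT \<omega>:A|P x. (LINT w|future_law (?Y \<omega>). f w)) + C * prob A)"
    unfolding conv[OF m1 fC] conv[OF m2 gC] .
  then show ?thesis
    using pos[OF m1 fC] pos[OF m2 gC] by simp
qed

text \<open>On the event that \<open>T\<close> is finite, the integrals of both sides agree over every event of the past of \<open>T\<close>
(\<open>stopping_future_integral\<close>), and this event itself belongs to the past.\<close>

theorem strong_markov: "strong_markov_property S F P X"
  unfolding strong_markov_property_def
proof (intro allI impI ballI)
  fix T :: "'w \<Rightarrow> ennreal" and f :: "(real \<Rightarrow> 'e) \<Rightarrow> real" and C :: real and x
  assume T: "stopping_time F T" and f[measurable]: "f \<in> borel_measurable path_space"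
    and "\<forall>w. \<bar>f w\<bar> \<le> C" and x: "x \<in> S"
  then have fC: "\<bar>f w\<bar> \<le> C" for w by blast
  interpret prob_space "P x" by (rule prob_P[OF x])
  have sub: "subalgebra (P x) (pre_sigma T)"
    using pre_sigma_subset[OF x T] by (simp add: subalgebra_def space_P[OF x] space_pre_sigma)
  interpret finite_measure_subalgebra "P x" "pre_sigma T" by standard (rule sub)
  note [measurable] = stopping_time_measurable_P[OF x T]
  let ?Y = "\<lambda>\<omega>. X (enn2real (T \<omega>)) \<omega>" and ?Z = "\<lambda>\<omega>. future (enn2real (T \<omega>)) \<omega>"
  have Y[measurable]: "?Y \<in> borel_measurable (P x)" and Z[measurable]: "?Z \<in> P x \<rightarrow>\<^sub>M path_space"
    by (auto intro!: X_at_measurable_P[OF x] measurable_future[OF x])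
  define g where "g y = (LINT w|future_law y. f w)" for y
  have g[measurable]: "g \<in> borel_measurable borel"
    unfolding g_def by (rule measurable_compose[OF measurable_future_law
        integral_measurable_subprob_algebra[OF f]])
  have C0: "0 \<le> C" using fC[of undefined] by linarith
  have gC: "\<bar>g y\<bar> \<le> C" for y unfolding g_def by (rule future_law_integral_bound[OF f fC])
  define B where "B = {\<omega>\<in>\<Omega>. T \<omega> < \<infinity>}"
  have B: "B \<in> sets (pre_sigma T)"
  proof -
    have "{\<omega>\<in>space (pre_sigma T). T \<omega> < \<infinity>} \<in> sets (pre_sigma T)"
      using measurable_stopping_time_pre_sigma[OF T] by measurable
    then show ?thesis by (simp add: B_def space_pre_sigma)
  qed
  then have BP[measurable]: "B \<in> sets (P x)" using pre_sigma_subset[OF x T] by blast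
  have gY: "(\<lambda>\<omega>. indicator B \<omega> * g (?Y \<omega>)) \<in> borel_measurable (pre_sigma T)"
  proof (rule measurableI)
    fix U :: "real set" assume U: "U \<in> sets borel"
    have "{\<omega>\<in>B. ?Y \<omega> \<in> g -` U} \<in> sets (pre_sigma T)"
      using measurable_sets[OF g U] by (intro X_stopped_in_pre_sigma[OF T B]) (auto simp: B_def)
    moreover have "(\<lambda>\<omega>. indicator B \<omega> * g (?Y \<omega>)) -` U \<inter> space (pre_sigma T)
       = {\<omega>\<in>B. ?Y \<omega> \<in> g -` U} \<union> (if 0 \<in> U then space (pre_sigma T) - B else {})"
      using sets.sets_into_space[OF B] by (auto split: split_indicator_asm split_indicator)
    ultimately show "(\<lambda>\<omega>. indicator B \<omega> * g (?Y \<omega>)) -` U \<inter> space (pre_sigma T) \<in> sets (pre_sigma T)"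
      using B by auto
  qed simp
  have int1: "integrable (P x) (\<lambda>\<omega>. indicator B \<omega> * f (?Z \<omega>))"
    using fC C0 by (intro integrable_const_bound[where B=C]) (auto split: split_indicator)
  have int2: "integrable (P x) (\<lambda>\<omega>. indicator B \<omega> * g (?Y \<omega>))"
    using gC C0 by (intro integrable_const_bound[where B=C]) (auto split: split_indicator)
  have "AE \<omega> in P x. real_cond_exp (P x) (pre_sigma T) (\<lambda>\<omega>. indicator B \<omega> * f (?Z \<omega>)) \<omega>
      = indicator B \<omega> * g (?Y \<omega>)"
  proof (rule real_cond_exp_charact[OF _ int1 int2 gY])
    fix A assume A: "A \<in> sets (pre_sigma T)"
    have "(LINT \<omega>:A|P x. indicator B \<omega> * k \<omega>) = (LINT \<omega>:A \<inter> B|P x. k \<omega>)" for k :: "'w \<Rightarrow> real"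
      unfolding set_lebesgue_integral_def
          by (intro Bochner_Integration.integral_cong) (auto split: split_indicator)
    moreover have "(LINT \<omega>:A \<inter> B|P x. f (?Z \<omega>)) = (LINT \<omega>:A \<inter> B|P x. g (?Y \<omega>))"
      unfolding g_def using A B by (intro stopping_future_integral[OF x T _ _ f fC]) (auto simp: B_def)
    ultimately show "(LINT \<omega>:A|P x. indicator B \<omega> * f (?Z \<omega>)) = (LINT \<omega>:A|P x. indicator B \<omega> * g (?Y \<omega>))"
      by simp
  qed
  moreover have "AE \<omega> in P x. real_cond_exp (P x) (pre_sigma T) (\<lambda>\<omega>. indicator B \<omega> * f (?Z \<omega>)) \<omega>
      = indicator B \<omega> * real_cond_exp (P x) (pre_sigma T) (\<lambda>\<omega>. f (?Z \<omega>)) \<omega>"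
    by (rule real_cond_exp_mult[OF borel_measurable_indicator[OF B] _ int1]) measurable
  ultimately show "AE \<omega> in P x. T \<omega> < \<infinity> \<longrightarrow>
      real_cond_exp (P x) (pre_sigma T) (\<lambda>\<omega>'. f (\<lambda>t\<in>{0..}. X (enn2real (T \<omega>') + t) \<omega>')) \<omega>
      = (LINT \<omega>'|P (X (enn2real (T \<omega>)) \<omega>). f (\<lambda>t\<in>{0..}. X t \<omega>'))"
    using AE_space
  proof eventually_elim
    fix \<omega> assume 1: "real_cond_exp (P x) (pre_sigma T) (\<lambda>\<omega>. indicator B \<omega> * f (?Z \<omega>)) \<omega>
        = indicator B \<omega> * g (?Y \<omega>)"
      and 2: "real_cond_exp (P x) (pre_sigma T) (\<lambda>\<omega>. indicator B \<omega> * f (?Z \<omega>)) \<omega>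
        = indicator B \<omega> * real_cond_exp (P x) (pre_sigma T) (\<lambda>\<omega>. f (?Z \<omega>)) \<omega>"
      and "\<omega> \<in> space (P x)"
    then have \<omega>: "\<omega> \<in> \<Omega>" by (simp add: space_P[OF x])
    have y: "?Y \<omega> \<in> S" by (rule X_in[OF _ \<omega>]) simp
    have "g (?Y \<omega>) = (LINT \<omega>'|P (?Y \<omega>). f (future 0 \<omega>'))"
      using y measurable_future[OF y, of "\<lambda>_. 0"] by (simp add: g_def future_law_def integral_distr)
    then have gy: "g (?Y \<omega>) = (LINT \<omega>'|P (?Y \<omega>). f (\<lambda>t\<in>{0..}. X t \<omega>'))"
      by (simp add: future_def)
    show "T \<omega> < \<infinity> \<longrightarrow>
      real_cond_exp (P x) (pre_sigma T) (\<lambda>\<omega>'. f (\<lambda>t\<in>{0..}. X (enn2real (T \<omega>') + t) \<omega>')) \<omega>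
      = (LINT \<omega>'|P (X (enn2real (T \<omega>)) \<omega>). f (\<lambda>t\<in>{0..}. X t \<omega>'))"
      using 1 2 \<omega> unfolding gy future_def by (auto simp: B_def)
  qed
qed

lemma distr_X:
  assumes x: "x \<in> S" and t: "0 \<le> t"
  shows "distr (P x) borel (X t) = p t x"
proof (rule measure_eqI)
  show "sets (distr (P x) borel (X t)) = sets (p t x)" by (simp add: kernel(2)[OF t x])
  fix C assume "C \<in> sets (distr (P x) borel (X t))"
  then have C: "C \<in> sets borel" by simp
  interpret prob_space "P x" by (rule prob_P[OF x])
  have "emeasure (distr (P x) borel (X t)) C = emeasure (P x) {\<omega>\<in>\<Omega>. X (0 + t) \<omega> \<in> C}"
    using X_measurable_P[OF x t] C
    by (subst emeasure_distr) (auto simp: space_P[OF x] intro!: arg_cong[where f="emeasure (P x)"])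
  also have "\<dots> = (\<integral>\<^sup>+\<omega>\<in>\<Omega>. emeasure (\<kappa> t (X 0 \<omega>)) C \<partial>P x)"
    using sets.top[of "F 0"] by (intro markov_step[OF x _ t _ C]) auto
  also have "\<dots> = (\<integral>\<^sup>+\<omega>. emeasure (p t x) C \<partial>P x)"
    by (intro nn_integral_cong_AE)
       (use X_start[OF x] AE_space in eventually_elim, simp add: space_P[OF x] \<kappa>_eq[OF x])
  finally show "emeasure (distr (P x) borel (X t)) C = emeasure (p t x) C"
    by (simp add: emeasure_space_1)
qed

end

section \<open>Self-duality of the exit laws\<close>

lemma mlf_eq_exp_functional:
  "mlf z v = exp_functional (Complex (- (fst v + snd v)) (fst v - snd v)) (Complex (- (fst v + snd v)) (-
      (fst v - snd v))) z"
  unfolding mlf_def exp_functional_def by (rule arg_cong[where f=exp]) (simp add: complex_eq_iff algebra_simps)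

lemma measurable_mlf_integral:
  assumes \<rho>: "axes_law \<rho>" shows "(\<lambda>w. LINT z|\<rho>. mlf z w) \<in> borel_measurable borel"
proof -
  interpret \<rho>: prob_space \<rho> using \<rho> by (simp add: axes_law_def)
  have [measurable_cong]: "sets \<rho> = sets borel" using \<rho> by (simp add: axes_law_def)
  have "(\<lambda>(w, z). mlf z w) \<in> borel_measurable (borel \<Otimes>\<^sub>M borel)"
    unfolding borel_prod mlf_def case_prod_beta by (intro borel_measurable_continuous_onI continuous_intros)
  then have "(\<lambda>(w, z). mlf z w) \<in> borel_measurable (borel \<Otimes>\<^sub>M \<rho>)"
    by (simp cong: measurable_cong_sets)
  then show ?thesis by (rule \<rho>.borel_measurable_lebesgue_integral)
qed

lemma axes_law_real_integral_bind:
  fixes g :: "real \<times> real \<Rightarrow> real"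
  assumes \<mu>: "axes_law \<mu>" and K: "K \<in> borel \<rightarrow>\<^sub>M subprob_algebra borel" and KA: "\<And>x. x \<in> axes \<Longrightarrow> axes_law (K x)"
    and \<nu>: "axes_law (\<mu> \<bind> K)"
    and g[measurable]: "g \<in> borel_measurable borel" and gB: "\<And>z. z \<in> axes \<Longrightarrow> \<bar>g z\<bar> \<le> B"
  shows "(LINT z|(\<mu> \<bind> K). g z) = (LINT x|\<mu>. LINT z|K x. g z)"
proof -
  interpret \<mu>: prob_space \<mu> using \<mu> by (simp add: axes_law_def)
  have sets[measurable_cong]: "sets \<mu> = sets borel" using \<mu> by (simp add: axes_law_def)
  have K'[measurable]: "K \<in> \<mu> \<rightarrow>\<^sub>M subprob_algebra borel" using K by (simp cong: measurable_cong_sets)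
  let ?g = "\<lambda>z. indicator axes z * g z"
  have B0: "0 \<le> B" using gB[of "(0, 0)"] by (simp add: axes_iff)
  have eq: "integral\<^sup>L \<rho> ?g = integral\<^sup>L \<rho> g" if "axes_law \<rho>" for \<rho>
    using axes_law_integral[OF that g] by (simp add: set_lebesgue_integral_def)
  have meas: "(\<lambda>x. integral\<^sup>L (K x) h) \<in> borel_measurable \<mu>"
      if "h \<in> borel_measurable borel" for h :: "real \<times> real \<Rightarrow> real"
    by (rule measurable_compose[OF K' integral_measurable_subprob_algebra[OF that]])
  have "(LINT z|(\<mu> \<bind> K). g z) = integral\<^sup>L (\<mu> \<bind> K) ?g" by (rule eq[OF \<nu>, symmetric])
  also have "\<dots> = (LINT x|\<mu>. integral\<^sup>L (K x) ?g)"
  proof (rule integral_bind[where K=borel and B=B and B'=1])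
    show "AE x in \<mu>. emeasure (K x) (space (K x)) \<le> ennreal 1"
      using subprob_space.emeasure_space_le_1[OF subprob_space_kernel[OF K]] by simp
    show "\<bar>indicator axes z * g z\<bar> \<le> B" for z
      using gB B0 by (auto split: split_indicator)
  qed (use K' \<mu>.finite_measure_axioms in auto)
  also have "\<dots> = (LINT x|\<mu>. LINT z|K x. g z)"
    by (intro integral_cong_AE meas) (use axes_law_AE[OF \<mu>] eq[OF KA] in \<open>auto elim: eventually_mono\<close>)
  finally show ?thesis .
qed

lemma axes_law_bind:
  assumes \<mu>: "axes_law \<mu>" and K: "K \<in> borel \<rightarrow>\<^sub>M subprob_algebra borel" and KA: "\<And>x. x \<in> axes \<Longrightarrow> axes_law (K x)"
  shows "axes_law (\<mu> \<bind> K)"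
proof -
  interpret \<mu>: prob_space \<mu> using \<mu> by (simp add: axes_law_def)
  have sets[measurable_cong]: "sets \<mu> = sets borel" using \<mu> by (simp add: axes_law_def)
  have K'[measurable]: "K \<in> \<mu> \<rightarrow>\<^sub>M subprob_algebra borel" using K by (simp cong: measurable_cong_sets)
  have "prob_space (\<mu> \<bind> K)"
    by (rule \<mu>.prob_space_bind[OF _ K'])
       (use axes_law_AE[OF \<mu>] KA in \<open>auto simp: axes_law_def elim: eventually_mono\<close>)
  moreover have "sets (\<mu> \<bind> K) = sets borel"
    by (rule sets_bind[OF sets_kernel[OF K'] \<mu>.not_empty])
  moreover have "emeasure (\<mu> \<bind> K) axes = (\<integral>\<^sup>+x. emeasure (K x) axes \<partial>\<mu>)"
    by (rule emeasure_bind[OF \<mu>.not_empty K']) simp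
  moreover have "(\<integral>\<^sup>+x. emeasure (K x) axes \<partial>\<mu>) = (\<integral>\<^sup>+x. 1 \<partial>\<mu>)"
    by (rule nn_integral_cong_AE) (use axes_law_AE[OF \<mu>] KA in \<open>auto simp: axes_law_def elim: eventually_mono\<close>)
  ultimately show ?thesis by (simp add: axes_law_def \<mu>.emeasure_space_1)
qed

lemma axes_law_mlf_bind:
  assumes \<mu>: "axes_law \<mu>" and K: "K \<in> borel \<rightarrow>\<^sub>M subprob_algebra borel" and KA: "\<And>x. x \<in> axes \<Longrightarrow> axes_law (K x)"
    and v: "v \<in> axes"
  shows "(LINT z|(\<mu> \<bind> K). mlf z v) = (LINT x|\<mu>. LINT z|K x. mlf z v)"
proof -
  have \<nu>: "axes_law (\<mu> \<bind> K)" by (rule axes_law_bind[OF \<mu> K KA])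
  have sets[measurable_cong]: "sets \<mu> = sets borel" using \<mu> by (simp add: axes_law_def)
  have le1: "cmod (mlf z v) \<le> 1" if "z \<in> axes" for z
    using that v axes_subset_quadrant by (intro cmod_mlf_le_1) auto
  have le1': "\<bar>Re (mlf z v)\<bar> \<le> 1" "\<bar>Im (mlf z v)\<bar> \<le> 1" if "z \<in> axes" for z
    using le1[OF that] abs_Re_le_cmod[of "mlf z v"] abs_Im_le_cmod[of "mlf z v"] by linarith+
  have int: "integrable \<rho> (\<lambda>z. mlf z v)" if "axes_law \<rho>" for \<rho>
    by (rule axes_law_integrable[OF that _ le1]) simp_all
  have meas: "(\<lambda>x. LINT z|K x. mlf z v) \<in> borel_measurable borel"
    by (rule measurable_compose[OF K integral_measurable_subprob_algebra]) simp
  have bound: "cmod (LINT z|K x. mlf z v) \<le> 1" if x: "x \<in> axes" for x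
  proof -
    interpret K: prob_space "K x" using KA[OF x] by (simp add: axes_law_def)
    have "cmod (LINT z|K x. mlf z v) \<le> (LINT z|K x. cmod (mlf z v))" by (rule integral_norm_bound)
    also have "\<dots> \<le> (LINT z|K x. 1)"
      by (rule integral_mono_AE) (use int[OF KA[OF x]] axes_law_AE[OF KA[OF x]] le1 in \<open>auto elim:
          eventually_mono\<close>)
    finally show ?thesis by (simp add: K.prob_space)
  qed
  have int2: "integrable \<mu> (\<lambda>x. LINT z|K x. mlf z v)"
    by (rule axes_law_integrable[OF \<mu> meas bound])
  have part: "(LINT z|(\<mu> \<bind> K). r (mlf z v)) = (LINT x|\<mu>. r (LINT z|K x. mlf z v))"
    if r: "bounded_linear r" "\<And>z. z \<in> axes \<Longrightarrow> \<bar>r (mlf z v)\<bar> \<le> 1" for r :: "complex \<Rightarrow> real"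
  proof -
    have [measurable]: "r \<in> borel_measurable borel"
      by (rule borel_measurable_continuous_onI[OF linear_continuous_on[OF r(1)]])
    have "(LINT z|(\<mu> \<bind> K). r (mlf z v)) = (LINT x|\<mu>. LINT z|K x. r (mlf z v))"
      by (rule axes_law_real_integral_bind[OF \<mu> K KA \<nu> _ r(2)]) simp_all
    also have "\<dots> = (LINT x|\<mu>. r (LINT z|K x. mlf z v))"
    proof (rule integral_cong_AE)
      show "(\<lambda>x. LINT z|K x. r (mlf z v)) \<in> borel_measurable \<mu>"
        using measurable_compose[OF K integral_measurable_subprob_algebra, of "\<lambda>z. r (mlf z v)"]
        by (simp cong: measurable_cong_sets)
      show "(\<lambda>x. r (LINT z|K x. mlf z v)) \<in> borel_measurable \<mu>"
        using meas by simp
      show "AE x in \<mu>. (LINT z|K x. r (mlf z v)) = r (LINT z|K x. mlf z v)"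
        using axes_law_AE[OF \<mu>] by eventually_elim (rule integral_bounded_linear[OF r(1) int[OF KA]])
    qed
    finally show ?thesis .
  qed
  show ?thesis
    using part[OF bounded_linear_Re le1'(1)] part[OF bounded_linear_Im le1'(2)] int[OF \<nu>] int2
    by (simp add: complex_eq_iff)
qed

locale quadrant_exit =
  fixes M :: "real \<times> real \<Rightarrow> 'a measure" and B :: "real \<times> real \<Rightarrow> real \<Rightarrow> 'a \<Rightarrow> real \<times> real"
    and Q :: "real \<times> real \<Rightarrow> (real \<times> real) measure"
  assumes BM: "\<And>x. x \<in> quadrant \<Longrightarrow> planar_brownian_motion (M x) (B x) x"
    and Q: "\<And>x. x \<in> quadrant \<Longrightarrow> Q x = exit_law (M x) (B x)"
begin

lemma axes_law_Q:
  assumes x: "x \<in> quadrant" shows "axes_law (Q x)"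
proof -
  interpret planar_bm "M x" "B x" x by (rule planar_bm.intro) (rule BM[OF x])
  have Qx: "Q x = distr (M x) borel exit_pos" using Q[OF x] by (simp add: exit_law_eq)
  have "emeasure (Q x) axes = 1"
    using exit_pos_properties(1)[OF x] borel_quadrant_sets(3) measurable_exit_pos
    unfolding Qx by (subst emeasure_distr) (auto intro!: emeasure_eq_1_AE)
  then show ?thesis
    using prob_space_distr[OF measurable_exit_pos] by (simp add: axes_law_def Qx)
qed

lemma Q_mlf_axes:
  assumes x: "x \<in> quadrant" and v: "v \<in> axes"
  shows "(LINT z|Q x. mlf z v) = mlf x v"
proof -
  interpret planar_bm "M x" "B x" x by (rule planar_bm.intro) (rule BM[OF x])
  have v': "0 \<le> fst v" "0 \<le> snd v" "fst v * snd v = 0" using v by (auto simp: axes_iff)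
  have "(LINT z|Q x. mlf z v) = (LINT \<omega>|M x. mlf (exit_pos \<omega>) v)"
    unfolding Q[OF x] exit_law_eq by (subst integral_distr) auto
  also have "\<dots> = mlf x v"
    unfolding mlf_eq_exp_functional
    by (rule exit_pos_properties(2)[OF x])
       (use v' in \<open>auto simp: complex_eq_iff power2_eq_square algebra_simps\<close>)
  finally show ?thesis .
qed

text \<open>For \<open>z\<close> on the axes \<open>mlf z\<close> is harmonic, so \<open>mlf z v\<close> is the average of \<open>mlf z w\<close> over the exit position
\<open>w\<close> of Brownian motion started at \<open>v\<close>. The transform on the axes thus determines the whole transform.\<close>

lemma mlf_disintegration:
  assumes \<mu>: "axes_law \<mu>" and v: "v \<in> quadrant"
  shows "(LINT z|\<mu>. mlf z v) = (LINT w|Q v. LINT z|\<mu>. mlf z w)"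
proof -
  have Qv: "axes_law (Q v)" by (rule axes_law_Q[OF v])
  interpret \<mu>: prob_space \<mu> using \<mu> by (simp add: axes_law_def)
  interpret Qv: prob_space "Q v" using Qv by (simp add: axes_law_def)
  interpret pair_prob_space \<mu> "Q v" ..
  have sets[measurable_cong]: "sets \<mu> = sets borel" "sets (Q v) = sets borel" using \<mu> Qv
      by (auto simp: axes_law_def)
  have meas: "(\<lambda>(z, w). mlf z w) \<in> borel_measurable (borel \<Otimes>\<^sub>M borel)"
    unfolding borel_prod mlf_def case_prod_beta by (intro borel_measurable_continuous_onI continuous_intros)
  have meas'[measurable]: "(\<lambda>(z, w). mlf z w) \<in> borel_measurable (\<mu> \<Otimes>\<^sub>M Q v)"
    using meas by (simp cong: measurable_cong_sets sets_pair_measure_cong[OF sets] add: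
        measurable_cong_sets[OF sets_pair_measure_cong[OF sets] refl])
  have le1: "cmod (mlf z w) \<le> 1" if "z \<in> axes" "w \<in> axes" for z w
    using that axes_subset_quadrant by (intro cmod_mlf_le_1) auto
  have int: "integrable (Q v) (\<lambda>w. mlf z w)" if "z \<in> axes" for z
    by (rule axes_law_integrable[OF Qv, where B=1]) (use le1 that in \<open>auto simp: mlf_commute[of z]\<close>)
  have I: "integrable (\<mu> \<Otimes>\<^sub>M Q v) (\<lambda>(z, w). mlf z w)"
  proof (rule Fubini_integrable)
    show "integrable \<mu> (\<lambda>z. LINT w|Q v. norm (case (z, w) of (z, w) \<Rightarrow> mlf z w))"
    proof (rule \<mu>.integrable_const_bound[where B=1])
      have "norm (LINT w|Q v. cmod (mlf z w)) \<le> 1" if "z \<in> axes" for z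
      proof -
        have "(LINT w|Q v. cmod (mlf z w)) \<le> (LINT w|Q v. 1)"
          by (rule integral_mono_AE) (use int[OF that] axes_law_AE[OF Qv] le1[OF that] in \<open>auto elim:
              eventually_mono\<close>)
        moreover have "0 \<le> (LINT w|Q v. cmod (mlf z w))" by (rule Bochner_Integration.integral_nonneg) simp
        ultimately show ?thesis by (simp add: Qv.prob_space)
      qed
      then show "AE z in \<mu>. norm (LINT w|Q v. norm (case (z, w) of (z, w) \<Rightarrow> mlf z w)) \<le> 1"
        using axes_law_AE[OF \<mu>] by (auto elim: eventually_mono)
    qed measurable
    show "AE z in \<mu>. integrable (Q v) (\<lambda>w. case (z, w) of (z, w) \<Rightarrow> mlf z w)"
      using axes_law_AE[OF \<mu>] int by (auto elim: eventually_mono)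
  qed measurable
  have "(LINT z|\<mu>. mlf z v) = (LINT z|\<mu>. LINT w|Q v. mlf z w)"
  proof (rule integral_cong_AE)
    show "AE z in \<mu>. mlf z v = (LINT w|Q v. mlf z w)"
      using axes_law_AE[OF \<mu>]
    proof eventually_elim
      fix z assume "z \<in> axes"
      from Q_mlf_axes[OF v this] show "mlf z v = (LINT w|Q v. mlf z w)"
        by (simp add: mlf_commute[of z])
    qed
  qed measurable
  also have "\<dots> = (LINT w|Q v. LINT z|\<mu>. mlf z w)"
    by (rule Fubini_integral[OF I, symmetric])
  finally show ?thesis .
qed

lemma axes_law_eqI:
  assumes \<mu>: "axes_law \<mu>" and \<nu>: "axes_law \<nu>"
    and eq: "\<And>v. v \<in> axes \<Longrightarrow> (LINT z|\<mu>. mlf z v) = (LINT z|\<nu>. mlf z v)"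
  shows "\<mu> = \<nu>"
proof (rule axes_law_eqI_mlf[OF \<mu> \<nu>])
  fix v assume v: "v \<in> quadrant"
  have Qv: "axes_law (Q v)" by (rule axes_law_Q[OF v])
  have [measurable_cong]: "sets (Q v) = sets borel" using Qv by (simp add: axes_law_def)
  note [measurable] = measurable_mlf_integral
  show "(LINT z|\<mu>. mlf z v) = (LINT z|\<nu>. mlf z v)"
    unfolding mlf_disintegration[OF \<mu> v] mlf_disintegration[OF \<nu> v]
    by (rule integral_cong_AE) (use \<mu> \<nu> axes_law_AE[OF Qv] eq in \<open>auto elim: eventually_mono\<close>)
qed

text \<open>Both sides are the average of \<open>mlf z w\<close> over independent exit positions \<open>z\<close> from \<open>x\<close> and \<open>w\<close> from \<open>v\<close>.\<close>

lemma Q_duality: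
  assumes x: "x \<in> quadrant" and v: "v \<in> quadrant"
  shows "(LINT z|Q x. mlf z v) = (LINT w|Q v. mlf x w)"
proof -
  have Qv: "axes_law (Q v)" by (rule axes_law_Q[OF v])
  have [measurable_cong]: "sets (Q v) = sets borel" using Qv by (simp add: axes_law_def)
  have "(LINT z|Q x. mlf z v) = (LINT w|Q v. LINT z|Q x. mlf z w)"
    by (rule mlf_disintegration[OF axes_law_Q[OF x] v])
  also have "\<dots> = (LINT w|Q v. mlf x w)"
    by (rule integral_cong_AE)
       (use measurable_mlf_integral[OF axes_law_Q[OF x]] axes_law_AE[OF Qv] Q_mlf_axes[OF x] in
         \<open>auto simp: mlf_commute[of x] elim: eventually_mono\<close>)
  finally show ?thesis .
qed

lemma Q_mlf_continuous:
  assumes v: "v \<in> quadrant" shows "continuous_on quadrant (\<lambda>x. LINT z|Q x. mlf z v)"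
proof -
  have Qv: "axes_law (Q v)" by (rule axes_law_Q[OF v])
  interpret Qv: prob_space "Q v" using Qv by (simp add: axes_law_def)
  have [measurable_cong]: "sets (Q v) = sets borel" using Qv by (simp add: axes_law_def)
  have [measurable]: "mlf x \<in> borel_measurable borel" for x
    using measurable_mlf[of x] by (simp add: mlf_commute[of _ x])
  have "continuous_on quadrant (\<lambda>x. LINT w|Q v. mlf x w)"
    unfolding continuous_on_sequentially
  proof (intro allI ballI impI, elim conjE)
    fix u :: "nat \<Rightarrow> real \<times> real" and x
    assume x: "x \<in> quadrant" and u: "\<forall>n. u n \<in> quadrant" "u \<longlonglongrightarrow> x"
    have "(\<lambda>n. LINT w|Q v. mlf (u n) w) \<longlonglongrightarrow> (LINT w|Q v. mlf x w)"
    proof (rule integral_dominated_convergence[where w="\<lambda>_. 1"])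
      show "AE w in Q v. (\<lambda>n. mlf (u n) w) \<longlonglongrightarrow> mlf x w"
        using continuous_on_tendsto_compose[OF continuous_on_mlf[of UNIV] u(2)] by simp
      show "AE w in Q v. norm (mlf (u n) w) \<le> 1" for n
        using axes_law_AE[OF Qv] by eventually_elim (use u axes_subset_quadrant in \<open>auto intro: cmod_mlf_le_1\<close>)
    qed simp_all
    then show "((\<lambda>x. LINT w|Q v. mlf x w) \<circ> u) \<longlonglongrightarrow> (LINT w|Q v. mlf x w)"
      by (simp add: comp_def)
  qed
  then show ?thesis
    by (rule continuous_on_eq) (simp add: Q_duality v)
qed

text \<open>By duality the transforms depend continuously on the starting point.\<close>

lemma Q_weakly_continuous:
  assumes y: "\<forall>\<^sub>F i in G. y i \<in> quadrant" and x: "x \<in> quadrant" and lim: "(y \<longlongrightarrow> x) G"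
  shows "weakly_converges_on axes (\<lambda>i. Q (y i)) (Q x) G"
proof (rule weakly_converges_mlf)
  show "\<forall>\<^sub>F i in G. axes_law (Q (y i))" using y by eventually_elim (rule axes_law_Q)
  show "((\<lambda>i. LINT z|Q (y i). mlf z v) \<longlongrightarrow> (LINT z|Q x. mlf z v)) G" if "v \<in> quadrant" for v
    by (rule continuous_on_tendsto_compose[OF Q_mlf_continuous[OF that] lim x y])
qed (rule axes_law_Q[OF x])

end

section \<open>The infinite rate mutually catalytic branching process\<close>

locale imcb_kernels = quadrant_exit M B Q
  for M :: "real \<times> real \<Rightarrow> 'a measure" and B Q +
  fixes c :: real and \<theta> :: "real \<times> real"
  assumes c: "0 \<le> c" and \<theta>: "\<theta> \<in> quadrant"
begin

abbreviation p :: "real \<Rightarrow> real \<times> real \<Rightarrow> (real \<times> real) measure" where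
  "p \<equiv> imcb_kernel Q c \<theta>"

text \<open>The deterministic flow towards \<open>\<theta>\<close> at rate \<open>c\<close>; the kernel lets the state drift and then exit.\<close>

definition drift :: "real \<Rightarrow> real \<times> real \<Rightarrow> real \<times> real" where
  "drift t x = exp (- c * t) *\<^sub>R x + (1 - exp (- c * t)) *\<^sub>R \<theta>"

lemma p_eq: "p t x = Q (drift t x)"
  by (simp add: imcb_kernel_def drift_def)

lemma drift_in_quadrant: "0 \<le> t \<Longrightarrow> x \<in> quadrant \<Longrightarrow> drift t x \<in> quadrant"
  using \<theta> c by (auto simp: drift_def quadrant_def mem_Times_iff intro!: add_nonneg_nonneg mult_nonneg_nonneg)

lemma drift_tendsto: "0 < c \<Longrightarrow> ((\<lambda>t. drift t x) \<longlongrightarrow> \<theta>) at_top"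
proof -
  assume "0 < c"
  then have "((\<lambda>t. exp (- c * t)) \<longlongrightarrow> 0) at_top"
    by (intro filterlim_compose[OF exp_at_bot] filterlim_tendsto_neg_mult_at_bot[OF tendsto_const]
        filterlim_ident) auto
  then have "((\<lambda>t. exp (- c * t) *\<^sub>R x + (1 - exp (- c * t)) *\<^sub>R \<theta>) \<longlongrightarrow> 0 *\<^sub>R x + (1 - 0) *\<^sub>R \<theta>) at_top"
    by (intro tendsto_intros)
  then show ?thesis by (simp add: drift_def)
qed

lemma axes_law_p: "0 \<le> t \<Longrightarrow> x \<in> axes \<Longrightarrow> axes_law (p t x)"
  unfolding p_eq using axes_subset_quadrant by (intro axes_law_Q drift_in_quadrant) auto

lemma feller_p: "feller axes p"
  unfolding feller_def p_eq[abs_def]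
proof (intro allI impI ballI Q_weakly_continuous)
  fix t :: real and x assume t: "0 \<le> t" and x: "x \<in> axes"
  show "\<forall>\<^sub>F y in at x within axes. drift t y \<in> quadrant"
    unfolding eventually_at_filter
    using axes_subset_quadrant drift_in_quadrant[OF t] by (intro always_eventually) auto
  show "drift t x \<in> quadrant" using x axes_subset_quadrant by (intro drift_in_quadrant[OF t]) auto
  show "(drift t \<longlongrightarrow> drift t x) (at x within axes)"
    unfolding drift_def[abs_def] by (intro tendsto_intros)
qed

sublocale feller_kernel axes p
proof (rule feller_kernel.intro)
  show "feller axes p" by (rule feller_p)
  show "axes \<in> sets borel" by (rule borel_quadrant_sets)
  fix t :: real and x :: "real \<times> real" assume "0 \<le> t" "x \<in> axes"
  then have L: "axes_law (p t x)" by (rule axes_law_p)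
  show "prob_space (p t x)" using L by (simp add: axes_law_def)
  show "sets (p t x) = sets borel" using L by (simp add: axes_law_def)
  show "emeasure (p t x) axes = 1" using L by (simp add: axes_law_def)
qed

lemma axes_law_\<kappa>: "0 \<le> t \<Longrightarrow> x \<in> axes \<Longrightarrow> axes_law (\<kappa> t x)"
  by (simp add: \<kappa>_eq axes_law_p)

lemma mlf_\<kappa>:
  assumes \<mu>: "axes_law \<mu>" and t: "0 \<le> t" and v: "v \<in> axes"
  shows "(LINT z|(\<mu> \<bind> \<kappa> t). mlf z v) = (LINT x|\<mu>. mlf (drift t x) v)"
proof -
  have [measurable_cong]: "sets \<mu> = sets borel" using \<mu> by (simp add: axes_law_def)
  have "(LINT z|(\<mu> \<bind> \<kappa> t). mlf z v) = (LINT x|\<mu>. LINT z|\<kappa> t x. mlf z v)"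
    by (rule axes_law_mlf_bind[OF \<mu> measurable_\<kappa>[OF t] axes_law_\<kappa>[OF t] v])
  also have "\<dots> = (LINT x|\<mu>. mlf (drift t x) v)"
  proof (rule integral_cong_AE)
    show "(\<lambda>x. LINT z|\<kappa> t x. mlf z v) \<in> borel_measurable \<mu>"
      using measurable_compose[OF measurable_\<kappa>[OF t] integral_measurable_subprob_algebra, of "\<lambda>z. mlf z v"]
      by (simp cong: measurable_cong_sets)
    have "(\<lambda>x. mlf (drift t x) v) \<in> borel_measurable borel"
      unfolding mlf_def drift_def by (intro borel_measurable_continuous_onI continuous_intros)
    then show "(\<lambda>x. mlf (drift t x) v) \<in> borel_measurable \<mu>" by (simp cong: measurable_cong_sets)
    show "AE x in \<mu>. (LINT z|\<kappa> t x. mlf z v) = mlf (drift t x) v"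
      using axes_law_AE[OF \<mu>]
    proof eventually_elim
      fix x assume x: "x \<in> axes"
      then have "drift t x \<in> quadrant" using axes_subset_quadrant by (intro drift_in_quadrant[OF t]) auto
      from Q_mlf_axes[OF this v] show "(LINT z|\<kappa> t x. mlf z v) = mlf (drift t x) v"
        by (simp add: \<kappa>_eq[OF x] p_eq)
    qed
  qed
  finally show ?thesis .
qed

lemma invariant_prob_iff:
  "invariant_prob axes p \<mu> \<longleftrightarrow> axes_law \<mu> \<and> (\<forall>t\<ge>0. \<mu> \<bind> \<kappa> t = \<mu>)"
proof (cases "axes_law \<mu>")
  case True
  then interpret \<mu>: prob_space \<mu> by (simp add: axes_law_def)
  have sets[measurable_cong]: "sets \<mu> = sets borel" using True by (simp add: axes_law_def)
  have eq: "emeasure (\<mu> \<bind> \<kappa> t) A = (\<integral>\<^sup>+x\<in>axes. emeasure (p t x) A \<partial>\<mu>)" if t: "0 \<le> t"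
      and A: "A \<in> sets borel" for t A
  proof -
    have "\<kappa> t \<in> \<mu> \<rightarrow>\<^sub>M subprob_algebra borel" using measurable_\<kappa>[OF t] by (simp cong: measurable_cong_sets)
    then have "emeasure (\<mu> \<bind> \<kappa> t) A = (\<integral>\<^sup>+x. emeasure (\<kappa> t x) A \<partial>\<mu>)"
      by (rule emeasure_bind[OF \<mu>.not_empty _ A])
    also have "\<dots> = (\<integral>\<^sup>+x\<in>axes. emeasure (p t x) A \<partial>\<mu>)"
      by (rule nn_integral_cong_AE) (use axes_law_AE[OF True] in \<open>auto simp: \<kappa>_eq elim: eventually_mono\<close>)
    finally show ?thesis .
  qed
  have "(\<mu> \<bind> \<kappa> t = \<mu>) \<longleftrightarrow> (\<forall>A\<in>sets borel. (\<integral>\<^sup>+x\<in>axes. emeasure (p t x) A \<partial>\<mu>) = emeasure \<mu> A)" if t: "0 \<le> t" for t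
  proof
    assume *: "\<forall>A\<in>sets borel. (\<integral>\<^sup>+x\<in>axes. emeasure (p t x) A \<partial>\<mu>) = emeasure \<mu> A"
    have "sets (\<mu> \<bind> \<kappa> t) = sets borel"
      using axes_law_bind[OF True measurable_\<kappa>[OF t] axes_law_\<kappa>[OF t]] by (simp add: axes_law_def)
    then show "\<mu> \<bind> \<kappa> t = \<mu>"
      using * eq[OF t] by (intro measure_eqI) (auto simp: sets)
  qed (use eq[OF t] in simp)
  then show ?thesis using True by (auto simp: invariant_prob_def axes_law_def)
qed (auto simp: invariant_prob_def axes_law_def)

text \<open>The drift acts on the transform by scaling \<open>v\<close> and multiplying by a constant. As scaling preserves the
axes, the transform of \<open>Q \<theta>\<close> is mapped to itself because \<open>\<theta>\<close> is a fixed point of the drift.\<close>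

lemma invariant_Q: "invariant_prob axes p (Q \<theta>)"
  unfolding invariant_prob_iff
proof (intro conjI allI impI)
  show L: "axes_law (Q \<theta>)" by (rule axes_law_Q[OF \<theta>])
  fix t :: real assume t: "0 \<le> t"
  show "Q \<theta> \<bind> \<kappa> t = Q \<theta>"
  proof (rule axes_law_eqI[OF axes_law_bind[OF L measurable_\<kappa>[OF t] axes_law_\<kappa>[OF t]] L])
    fix v assume v: "v \<in> axes"
    let ?e = "exp (- c * t)"
    have ev: "?e *\<^sub>R v \<in> axes" using v by (auto simp: axes_iff)
    have mlf: "mlf (drift t x) v = mlf x (?e *\<^sub>R v) * mlf ((1 - ?e) *\<^sub>R \<theta>) v" for x
      unfolding mlf_def exp_add[symmetric] drift_def by (simp add: algebra_simps)
    have "(LINT z|(Q \<theta> \<bind> \<kappa> t). mlf z v) = mlf \<theta> (?e *\<^sub>R v) * mlf ((1 - ?e) *\<^sub>R \<theta>) v"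
      unfolding mlf_\<kappa>[OF L t v] mlf integral_mult_left_zero Q_mlf_axes[OF \<theta> ev] ..
    also have "\<dots> = mlf (drift t \<theta>) v" by (rule mlf[symmetric])
    also have "drift t \<theta> = \<theta>" by (simp add: drift_def scaleR_left_distrib[symmetric])
    finally show "(LINT z|(Q \<theta> \<bind> \<kappa> t). mlf z v) = (LINT z|Q \<theta>. mlf z v)"
      by (simp add: Q_mlf_axes[OF \<theta> v])
  qed
qed

text \<open>The transform of an invariant law is the average of \<open>mlf (drift t x) v\<close> over \<open>x\<close> for every \<open>t\<close>, and it
tends to \<open>mlf \<theta> v\<close> as \<open>t\<close> grows.\<close>

lemma invariant_unique:
  assumes c': "0 < c" and inv: "invariant_prob axes p \<mu>"
  shows "\<mu> = Q \<theta>"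
proof -
  have \<mu>: "axes_law \<mu>" and bind: "\<And>t. 0 \<le> t \<Longrightarrow> \<mu> \<bind> \<kappa> t = \<mu>" using inv by (auto simp: invariant_prob_iff)
  interpret \<mu>: prob_space \<mu> using \<mu> by (simp add: axes_law_def)
  have [measurable_cong]: "sets \<mu> = sets borel" using \<mu> by (simp add: axes_law_def)
  show ?thesis
  proof (rule axes_law_eqI[OF \<mu> axes_law_Q[OF \<theta>]])
    fix v assume v: "v \<in> axes"
    have const: "(LINT z|\<mu>. mlf z v) = (LINT x|\<mu>. mlf (drift (real n) x) v)" for n
      using mlf_\<kappa>[OF \<mu> _ v, of "real n"] bind[of "real n"] by simp
    have "(\<lambda>n. LINT x|\<mu>. mlf (drift (real n) x) v) \<longlonglongrightarrow> (LINT x|\<mu>. mlf \<theta> v)"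
    proof (rule integral_dominated_convergence[where w="\<lambda>_. 1"])
      have "(\<lambda>x. mlf (drift t x) v) \<in> borel_measurable borel" for t
        unfolding mlf_def drift_def by (intro borel_measurable_continuous_onI continuous_intros)
      then show "(\<lambda>x. mlf (drift (real n) x) v) \<in> borel_measurable \<mu>" for n by (simp cong: measurable_cong_sets)
      show "AE x in \<mu>. (\<lambda>n. mlf (drift (real n) x) v) \<longlonglongrightarrow> mlf \<theta> v"
        using filterlim_compose[OF drift_tendsto[OF c'] filterlim_real_sequentially]
        by (intro AE_I2 continuous_on_tendsto_compose[OF continuous_on_mlf[of UNIV]]) auto
      show "AE x in \<mu>. norm (mlf (drift (real n) x) v) \<le> 1" for n
        using axes_law_AE[OF \<mu>]
        by eventually_elim (use v axes_subset_quadrant in \<open>auto intro!: cmod_mlf_le_1 drift_in_quadrant\<close>)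
    qed simp_all
    then have "(LINT z|\<mu>. mlf z v) = mlf \<theta> v"
      unfolding const[symmetric] by (simp add: LIMSEQ_const_iff \<mu>.prob_space)
    then show "(LINT z|\<mu>. mlf z v) = (LINT z|Q \<theta>. mlf z v)"
      by (simp add: Q_mlf_axes[OF \<theta> v])
  qed
qed

lemma weakly_converges_p:
  assumes c': "0 < c" and x: "x \<in> quadrant"
  shows "weakly_converges_on axes (\<lambda>t. p t x) (Q \<theta>) at_top"
  unfolding p_eq
proof (rule Q_weakly_continuous[OF _ \<theta> drift_tendsto[OF c']])
  show "\<forall>\<^sub>F t in at_top. drift t x \<in> quadrant"
    using eventually_ge_at_top[of 0] by eventually_elim (rule drift_in_quadrant[OF _ x])
qed

end

theorem proposition1p2:
  fixes M :: "real \<times> real \<Rightarrow> 'a measure"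
    and B :: "real \<times> real \<Rightarrow> real \<Rightarrow> 'a \<Rightarrow> real \<times> real"
    and Q :: "real \<times> real \<Rightarrow> (real \<times> real) measure"
    and c :: real and \<theta> :: "real \<times> real"
    and F :: "ennreal \<Rightarrow> 'w measure"
    and P :: "real \<times> real \<Rightarrow> 'w measure"
    and X :: "real \<Rightarrow> 'w \<Rightarrow> real \<times> real"
  assumes BM: "\<And>x. x \<in> quadrant \<Longrightarrow> planar_brownian_motion (M x) (B x) x"
    and Q: "\<And>x. x \<in> quadrant \<Longrightarrow> Q x = exit_law (M x) (B x)"
    and c: "c \<ge> 0" and \<theta>: "\<theta> \<in> quadrant"
    and X: "imcb_process Q c \<theta> F P X"
  shows "feller axes (imcb_kernel Q c \<theta>) \<and>
         strong_markov_property axes F P X \<and>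
         invariant_prob axes (imcb_kernel Q c \<theta>) (Q \<theta>) \<and>
         (c > 0 \<longrightarrow>
            ergodic axes (imcb_kernel Q c \<theta>) P X \<and>
            (\<forall>\<mu>. invariant_prob axes (imcb_kernel Q c \<theta>) \<mu> \<longleftrightarrow> \<mu> = Q \<theta>))"
proof -
  interpret imcb_kernels M B Q c \<theta>
    by standard (use BM Q c \<theta> in auto)
  interpret feller_markov axes p F P X
  proof (intro feller_markov.intro feller_markov_axioms.intro)
    show "feller_kernel axes p" by (rule feller_kernel_axioms)
    show "markov_process axes p F P X" using X by (simp add: imcb_process_def)
    show "((\<lambda>t. X t \<omega>) \<longlongrightarrow> X t \<omega>) (at_right t)" if "\<omega> \<in> space (F 0)" "0 \<le> t" for \<omega> t
      using X that by (simp add: imcb_process_def cadlag_def)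
  qed
  have "ergodic axes p P X" if c': "0 < c"
    unfolding ergodic_def
  proof (intro exI[of _ "Q \<theta>"] conjI allI impI ballI)
    show "invariant_prob axes p (Q \<theta>)" by (rule invariant_Q)
    show "\<mu> = Q \<theta>" if "invariant_prob axes p \<mu>" for \<mu> by (rule invariant_unique[OF c' that])
    fix x assume x: "x \<in> axes"
    have conv: "weakly_converges_on axes (\<lambda>t. p t x) (Q \<theta>) at_top"
      using x axes_subset_quadrant by (intro weakly_converges_p c') auto
    show "weakly_converges_on axes (\<lambda>t. distr (P x) borel (X t)) (Q \<theta>) at_top"
      unfolding weakly_converges_on_def
    proof (intro allI impI)
      fix f :: "real \<times> real \<Rightarrow> real" assume f: "continuous_on axes f" "bounded (f ` axes)"
      have eq: "\<forall>\<^sub>F t in at_top. (LINT y:axes|p t x. f y) = (LINT y:axes|distr (P x) borel (X t). f y)"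
        using eventually_ge_at_top[of 0] by eventually_elim (simp only: distr_X[OF x])
      have "((\<lambda>t. LINT y:axes|p t x. f y) \<longlongrightarrow> (LINT y:axes|Q \<theta>. f y)) at_top"
        using conv f unfolding weakly_converges_on_def by blast
      from this eq show "((\<lambda>t. LINT y:axes|distr (P x) borel (X t). f y) \<longlongrightarrow> (LINT y:axes|Q \<theta>. f y)) at_top"
        by (rule Lim_transform_eventually)
    qed
  qed
  moreover have "invariant_prob axes p \<mu> \<longleftrightarrow> \<mu> = Q \<theta>" if c': "0 < c" for \<mu>
    using invariant_Q invariant_unique[OF c', of \<mu>] by metis
  ultimately show ?thesis
    using feller_p strong_markov invariant_Q by simp
qed

end
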